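(* Let $c\in(0,\infty)$ be fixed. Define polynomials $\{p_n\}_{n\ge 0}$ by $p_0=1$, $p_1=x$, $p_{n+1}=xp_n-(n+c)p_{n-1}$ for $n\ge 1$, and let $P_n$ be a primitive of $p_n$, that is, $P_n'=p_n$. For each $N$ let $L_N$ be the empirical distribution of the Gaussian beta ensemble of size $N$ with parameter $\beta=2c/N$. Then for each $n\ge 0$, as $N\to\infty$ with $\beta N=2c$, $$\sqrt N\Big(\langle L_N,P_n\rangle-\langle \nu_c,P_n\rangle\Big)\to \mathcal N(0,\sigma_{P_n,c}^2)\quad\text{in distribution},$$ where $$\sigma_{P_n,c}^2=\frac{1}{n+1}\int p_n(x)p_n(x)\,d\nu_c(x)=\frac{1}{n+1}(c+1)\cdots(c+n).$$ Moreover, for any $M\in\mathbb N$, the random variables $\{\sqrt N(\langle L_N,P_n\rangle-\langle\nu_c,P_n\rangle)\}_{n=0}^M$ jointly converge in distribution to independent Gaussian random variables.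
   Context: The Gaussian beta ensemble of size $N$ with parameter $\beta>0$ is the random vector $(\lambda_1,\dots,\lambda_N)$ with $\lambda_1\le\dots\le\lambda_N$ whose joint density is proportional to $\prod_{1\le i<j\le N}|\lambda_j-\lambda_i|^\beta\prod_{l=1}^N e^{-\lambda_l^2/2}$ on $\{\lambda_1\le\dots\le\lambda_N\}$. Its empirical distribution is $L_N=\frac1N\sum_{i=1}^N\delta_{\lambda_i}$, with $\delta_\lambda$ the Dirac measure at $\lambda$. For a probability measure $\mu$ on $\mathbb R$ and an integrable function $f$, $\langle\mu,f\rangle=\int f\,d\mu$. For $c>0$, $\nu_c$ is the probability measure on $\mathbb R$ with density $$\nu_c(x)=\frac{e^{-x^2/2}}{\sqrt{2\pi}\,|\hat f_c(x)|^2},\qquad \hat f_c(x)=\sqrt{\frac{c}{\Gamma(c)}}\int_0^\infty t^{c-1}e^{-t^2/2}e^{ixt}\,dt .$$ The $p_n$ (associated Hermite polynomials) are orthogonal with respect to $\nu_c$. $\mathcal N(0,\sigma^2)$ is the centered Gaussian law of variance $\sigma^2$. *)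

theory Defs
  imports "HOL-Probability.Probability"
begin

text \<open>Vectors \<open>(\<lambda>\<^sub>1, \<dots>, \<lambda>\<^sub>N)\<close> are functions \<^typ>\<open>nat \<Rightarrow> real\<close> on the index set \<open>{1..N}\<close>, i.e. points
  of the product space \<open>Pi\<^sub>M {1..N} (\<lambda>_. lborel)\<close>. The exponent \<open>\<beta>\<close> is only used for \<open>\<beta> > 0\<close>, where
  \<open>0 powr \<beta> = 0\<close> is the right convention.\<close>

definition GBE_weight :: "nat \<Rightarrow> real \<Rightarrow> (nat \<Rightarrow> real) \<Rightarrow> real" where
  "GBE_weight N \<beta> l =
     (if \<forall>i\<in>{1..N}. \<forall>j\<in>{1..N}. i \<le> j \<longrightarrow> l i \<le> l j
      then (\<Prod>j\<in>{1..N}. \<Prod>i\<in>{1..<j}. \<bar>l j - l i\<bar> powr \<beta>) * (\<Prod>k\<in>{1..N}. exp (- (l k)\<^sup>2 / 2))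
      else 0)"

text \<open>On a probability space \<open>M\<close> the constant \<open>Z\<close> is forced to be the integral of the weight.\<close>

definition gaussian_beta_ensemble ::
    "nat \<Rightarrow> real \<Rightarrow> 'a measure \<Rightarrow> ('a \<Rightarrow> nat \<Rightarrow> real) \<Rightarrow> bool" where
  "gaussian_beta_ensemble N \<beta> M X \<longleftrightarrow>
     (\<exists>Z>0. distributed M (Pi\<^sub>M {1..N} (\<lambda>_. lborel)) X (\<lambda>l. ennreal (GBE_weight N \<beta> l / Z)))"

definition empirical_distribution :: "nat \<Rightarrow> (nat \<Rightarrow> real) \<Rightarrow> real measure" where
  "empirical_distribution N l =
     measure_of UNIV (sets borel) (\<lambda>A. (\<Sum>i\<in>{1..N}. emeasure (return borel (l i)) A) / of_nat N)"

definition f_hat :: "real \<Rightarrow> real \<Rightarrow> complex" where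
  "f_hat c x = complex_of_real (sqrt (c / Gamma c)) *
     (LINT t:{0<..}|lborel.
        complex_of_real (t powr (c - 1) * exp (- t\<^sup>2 / 2)) * exp (\<i> * complex_of_real (x * t)))"

definition nu :: "real \<Rightarrow> real measure" where
  "nu c = density lborel (\<lambda>x. ennreal (exp (- x\<^sup>2 / 2) / (sqrt (2 * pi) * (cmod (f_hat c x))\<^sup>2)))"

fun assoc_hermite :: "real \<Rightarrow> nat \<Rightarrow> real poly" where
  "assoc_hermite c 0 = 1"
| "assoc_hermite c (Suc 0) = [:0, 1:]"
| "assoc_hermite c (Suc (Suc n)) =
     [:0, 1:] * assoc_hermite c (Suc n) - smult (real (Suc n) + c) (assoc_hermite c n)"

definition sigma2 :: "real \<Rightarrow> nat \<Rightarrow> real" where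
  "sigma2 c n = 1 / (real n + 1) *
     (LINT x|nu c. poly (assoc_hermite c n) x * poly (assoc_hermite c n) x)"

text \<open>The second argument of \<^const>\<open>normal_density\<close> is the standard deviation, that of \<open>gaussian\<close>
  the variance \<open>v > 0\<close>.\<close>

definition gaussian :: "real \<Rightarrow> real \<Rightarrow> real measure" where
  "gaussian m v = density lborel (\<lambda>x. ennreal (normal_density m (sqrt v) x))"

definition fluctuation ::
    "real \<Rightarrow> (real \<Rightarrow> real) \<Rightarrow> nat \<Rightarrow> (nat \<Rightarrow> real) \<Rightarrow> real" where
  "fluctuation c f N l =
     sqrt (real N) * ((LINT x|empirical_distribution N l. f x) - (LINT x|nu c. f x))"

text \<open>Convergence in distribution in \<open>\<real>\<^sup>I\<close> for a finite index set \<open>I\<close>, tested on bounded continuous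
  functions (\<^const>\<open>weak_conv_m\<close> covers the real line only). The measures live on
  \<open>Pi\<^sub>M I (\<lambda>_. borel)\<close>, whose space is the topological space of the product topology.\<close>

definition weak_conv_vec ::
    "'i set \<Rightarrow> (nat \<Rightarrow> ('i \<Rightarrow> real) measure) \<Rightarrow> ('i \<Rightarrow> real) measure \<Rightarrow> bool" where
  "weak_conv_vec I \<mu> \<mu>' \<longleftrightarrow>
     (\<forall>g. continuous_map (product_topology (\<lambda>_. euclideanreal) I) euclideanreal g \<and>
          bounded (g ` (I \<rightarrow>\<^sub>E UNIV))
        \<longrightarrow> (\<lambda>N. LINT y|\<mu> N. g y) \<longlonglongrightarrow> (LINT y|\<mu>'. g y))"

lemma sets_empirical_distribution [simp, measurable_cong]:
  "sets (empirical_distribution N l) = sets borel"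
  unfolding empirical_distribution_def
  by (metis sets.sets_measure_of_eq space_borel)

lemma emeasure_empirical_distribution:
  assumes "A \<in> sets borel"
  shows "emeasure (empirical_distribution N l) A =
           (\<Sum>i\<in>{1..N}. emeasure (return borel (l i)) A) / of_nat N"
proof (rule emeasure_measure_of[OF empirical_distribution_def])
  show "sets borel \<subseteq> Pow (UNIV :: real set)" by simp
  show "A \<in> sets (empirical_distribution N l)" using assms by simp
  show "positive (sets (empirical_distribution N l))
     (\<lambda>A. (\<Sum>i\<in>{1..N}. emeasure (return borel (l i)) A) / of_nat N)"
    by (simp add: positive_def)
  show "countably_additive (sets (empirical_distribution N l))
     (\<lambda>A. (\<Sum>i\<in>{1..N}. emeasure (return borel (l i)) A) / of_nat N)"
  proof (rule countably_additiveI)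
    fix B :: "nat \<Rightarrow> real set"
    assume B: "range B \<subseteq> sets (empirical_distribution N l)" "disjoint_family B"
    have "(\<Sum>k. (\<Sum>i\<in>{1..N}. emeasure (return borel (l i)) (B k)) / of_nat N) =
          (\<Sum>i\<in>{1..N}. (\<Sum>k. emeasure (return borel (l i)) (B k))) / of_nat N"
      by (simp add: suminf_sum divide_ennreal_def)
    also have "\<dots> = (\<Sum>i\<in>{1..N}. emeasure (return borel (l i)) (\<Union> (range B))) / of_nat N"
      using B by (subst suminf_emeasure) auto
    finally show "(\<Sum>k. (\<Sum>i\<in>{1..N}. emeasure (return borel (l i)) (B k)) / of_nat N) =
       (\<Sum>i\<in>{1..N}. emeasure (return borel (l i)) (\<Union> (range B))) / of_nat N" .
  qed
qed

end

theory Submission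
  imports Defs "HOL-Complex_Analysis.Complex_Analysis" "HOL-Real_Asymp.Real_Asymp"
begin

text \<open>
  The fluctuation field \<open>Y f = \<surd>N (\<langle>L\<^sub>N, f\<rangle> - \<langle>\<nu>\<^sub>c, f\<rangle>)\<close> is studied on polynomials by the method of moments, and
  the moments come from one identity. Integrating by parts against the joint density, for a polynomial \<open>f\<close> and a
  statistic \<open>G\<close> of polynomial growth,
  \<open>E[G (\<Sum>\<^sub>k (f'(\<lambda>\<^sub>k) - \<lambda>\<^sub>k f(\<lambda>\<^sub>k)) + \<beta> \<Sum>\<^bsub>i<j\<^esub> (f(\<lambda>\<^sub>j) - f(\<lambda>\<^sub>i)) / (\<lambda>\<^sub>j - \<lambda>\<^sub>i)) + \<Sum>\<^sub>k f(\<lambda>\<^sub>k) \<partial>\<^sub>kG] = 0\<close>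
  (\<open>loop_equation\<close>). For \<open>\<beta> = 2c/N\<close> the deterministic part of order \<open>N\<close> cancels, because the moment functional \<open>L\<close> of
  \<open>\<nu>\<^sub>c\<close> satisfies \<open>L(xf) = L(f') + c L(Qf)\<close> with \<open>Qf(x) = \<integral> (f(x) - f(y)) / (x - y) d\<nu>\<^sub>c(y)\<close> (\<open>L_loop_equation\<close>). In what
  remains the fluctuations enter linearly through \<open>Y(\<Lambda>f)\<close>, where \<open>\<Lambda>f = xf - f' - 2c Qf\<close>, and quadratically with a
  factor \<open>N\<^bsup>-1/2\<^esup>\<close> (\<open>loop_equation_Y\<close>).

  Three facts about \<open>\<Lambda>\<close> and \<open>Q\<close> turn this into the theorem. The operator \<open>\<Lambda>\<close> raises the degree by one, while every other
  term of the loop equation has total degree at least two lower than its leading term; induction on the total degree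
  bounds all mixed moments of the \<open>Y(x\<^sup>a)\<close> uniformly in \<open>N\<close> (\<open>bounded_mean_monomial\<close>). Next,
  \<open>(\<Lambda>p\<^sub>n)' = (n + 1) p\<^sub>n\<close> (\<open>pderiv_\<Lambda>_hermite\<close>): a primitive of \<open>\<Sum> t\<^sub>n p\<^sub>n\<close> is, up to a constant, \<open>\<Lambda>f\<close> with
  \<open>f = \<Sum> t\<^sub>n/(n+1) p\<^sub>n\<close>. With this \<open>f\<close> and \<open>G\<close> a power of \<open>T = Y(\<Lambda>f)\<close> the loop equation reads
  \<open>E[T\<^bsup>k+1\<^esup>] = k V E[T\<^bsup>k-1\<^esup>] + O(N\<^bsup>-1/2\<^esup>)\<close>, the recursion for the moments of a centred Gaussian of variance
  \<open>V = L(f \<Sum> t\<^sub>n p\<^sub>n) = \<Sum> t\<^sub>n\<^sup>2 L(p\<^sub>n\<^sup>2)/(n+1)\<close> (\<open>moments_converge\<close>). That \<open>V\<close> has no mixed terms, which is the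
  orthogonality of the \<open>p\<^sub>n\<close>, is the independence of the limits.

  The measure \<open>\<nu>\<^sub>c\<close> enters through \<open>L(p\<^sub>n) = \<delta>\<^bsub>n0\<^esub>\<close> (\<open>integral_assoc_hermite_nu\<close>), from which the three-term recurrence
  yields everything else about \<open>L\<close>. To see this value, let \<open>F\<^sub>a(z) = \<integral>\<^sub>0\<^sup>\<infinity> t\<^bsup>a-1\<^esup> e\<^bsup>-t\<^sup>2/2\<^esup> e\<^bsup>izt\<^esup> dt\<close>. The ratios
  \<open>r\<^sub>n = (-i)\<^bsup>n+1\<^esup> F\<^bsub>c+n+1\<^esub> / (c F\<^sub>c)\<close> obey the recurrence of the \<open>p\<^sub>n\<close>; they are holomorphic on the closed upper
  half plane because \<open>F\<^sub>c\<close> has no zeros there (\<open>hermF_nonzero\<close>); on the real line \<open>- Im r\<^sub>n / \<pi>\<close> is \<open>p\<^sub>n\<close> times the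
  density of \<open>\<nu>\<^sub>c\<close>, by a Wronskian identity; and \<open>r\<^sub>n(z) = \<delta>\<^bsub>n0\<^esub>/z + O(|z|\<^bsup>-2\<^esup>)\<close> at infinity. Integration over a large
  half disc gives the claim.

  Finally, moments determine characteristic functions in the limit (\<open>char_tendsto_of_moments\<close>), which settles the
  one-dimensional statement by Levy's theorem. For vectors, trigonometric polynomials approximate a bounded continuous
  function on a box without exceeding its bound outside, and the bounded second moments control the complement of the
  box (\<open>weak_conv_vec_of_char\<close>).
\<close>

section \<open>Laplace transforms of kernels on the half line\<close>

lemma integrable_std_normal_poly:
  "integrable lborel (\<lambda>x. std_normal_density x * (1 + \<bar>x\<bar>) ^ n)"
proof (rule Bochner_Integration.integrable_bound)
  show "integrable lborel (\<lambda>x. 2 ^ n * (std_normal_density x * \<bar>x\<bar> ^ 0 + std_normal_density x * \<bar>x\<bar> ^ n))"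
    by (intro integrable_mult_right Bochner_Integration.integrable_add integrable_std_normal_moment_abs)
  show "AE x in lborel. norm (std_normal_density x * (1 + \<bar>x\<bar>) ^ n)
         \<le> norm (2 ^ n * (std_normal_density x * \<bar>x\<bar> ^ 0 + std_normal_density x * \<bar>x\<bar> ^ n))"
  proof (intro AE_I2)
    fix x :: real
    have "(1 + \<bar>x\<bar>) ^ n \<le> (2 * max 1 \<bar>x\<bar>) ^ n" by (intro power_mono) auto
    also have "\<dots> \<le> 2 ^ n * (1 + \<bar>x\<bar> ^ n)" by (auto simp: power_mult_distrib max_def)
    finally have "std_normal_density x * (1 + \<bar>x\<bar>) ^ n \<le> std_normal_density x * (2 ^ n * (1 + \<bar>x\<bar> ^ n))"
      by (intro mult_left_mono) auto
    then show "norm (std_normal_density x * (1 + \<bar>x\<bar>) ^ n)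
         \<le> norm (2 ^ n * (std_normal_density x * \<bar>x\<bar> ^ 0 + std_normal_density x * \<bar>x\<bar> ^ n))"
      by (simp add: abs_mult algebra_simps)
  qed
qed measurable

definition laplace :: "(real \<Rightarrow> real) \<Rightarrow> complex \<Rightarrow> complex" where
  "laplace k s = (LINT t|lborel. of_real (k t) * exp (- (s * of_real t)))"

lemma norm_laplace_integrand:
  "cmod (of_real (k t) * exp (- (s * of_real t))) = \<bar>k t\<bar> * exp (- (Re s * t))"
  by (simp add: norm_mult)

lemma integrable_laplace:
  fixes k :: "real \<Rightarrow> real"
  assumes [measurable]: "k \<in> borel_measurable borel"
    and "integrable lborel (\<lambda>t. \<bar>k t\<bar> * exp (- (Re s * t)))"
  shows "integrable lborel (\<lambda>t. of_real (k t) * exp (- (s * of_real t)) :: complex)"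
  by (rule Bochner_Integration.integrable_bound[OF assms(2)])
     (auto simp: norm_laplace_integrand)

lemma square_le_exp:
  fixes r t :: real
  assumes "r > 0" "t \<ge> 0"
  shows "t\<^sup>2 \<le> 2 / r\<^sup>2 * exp (r * t)"
proof -
  have "1 + r * t + (r * t)\<^sup>2 / 2 \<le> exp (r * t)"
    using exp_lower_Taylor_quadratic[of "r * t"] assms by simp
  moreover have "r * t \<ge> 0" using assms by simp
  ultimately have "(r * t)\<^sup>2 / 2 \<le> exp (r * t)" by linarith
  then show ?thesis using assms by (simp add: field_simps power_mult_distrib)
qed

text \<open>The second-order Taylor remainder of \<open>exp (- h t)\<close> is at most \<open>\<bar>h\<bar>\<^sup>2 t\<^sup>2 exp (\<bar>h\<bar> t)\<close>. Since the integral converges on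
an open half plane, a slight loss in the exponential rate absorbs both the factor \<open>t\<^sup>2\<close> and \<open>exp (\<bar>h\<bar> t)\<close>, and the
remainder of the difference quotient is \<open>O(\<bar>h\<bar>)\<close>.\<close>

lemma laplace_has_field_derivative:
  fixes k :: "real \<Rightarrow> real"
  assumes meas [measurable]: "k \<in> borel_measurable borel"
    and neg: "\<And>t. t \<le> 0 \<Longrightarrow> k t = 0"
    and int: "\<And>\<sigma>. \<sigma> > \<sigma>0 \<Longrightarrow> integrable lborel (\<lambda>t. \<bar>k t\<bar> * exp (- (\<sigma> * t)))"
    and s: "Re s > \<sigma>0"
  shows "(laplace k has_field_derivative - laplace (\<lambda>t. t * k t) s) (at s)"
proof -
  (* A third of the room to the left of Re s: r pays once for |h| < r and once for the factor t^2, which leaves the rate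
     Re s - 2 * r above the abscissa. *)
  define r where "r = (Re s - \<sigma>0) / 3"
  have r: "r > 0" using s by (simp add: r_def)
  let ?u = "\<lambda>t. 2 / r\<^sup>2 * (\<bar>k t\<bar> * exp (- ((Re s - 2 * r) * t)))"
  let ?v = "\<lambda>t. \<bar>k t\<bar> * exp (- ((Re s - r) * t))"
  define K where "K = (LINT t|lborel. ?u t)"
  have intK: "integrable lborel (\<lambda>t. ?u t)"
    using r by (intro integrable_mult_right int) (simp add: r_def field_simps)
  have int': "integrable lborel (\<lambda>t. of_real (k t) * exp (- (z * of_real t)) :: complex)"
    if "Re z > \<sigma>0" for z
    by (rule integrable_laplace[OF meas int[OF that]])
  have bnd: "\<bar>t\<^sup>2 * k t\<bar> * exp (- ((Re s - r) * t)) \<le> ?u t" for t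
  proof (cases "t \<le> 0")
    case False
    then have "t\<^sup>2 \<le> 2 / r\<^sup>2 * exp (r * t)" using square_le_exp[OF r] by simp
    then have "t\<^sup>2 * (?v t) \<le> (2 / r\<^sup>2 * exp (r * t)) * (?v t)"
      by (intro mult_right_mono) auto
    also have "\<dots> = 2 / r\<^sup>2 * (\<bar>k t\<bar> * exp (r * t - (Re s - r) * t))"
    proof -
      have "exp (r * t - (Re s - r) * t) = exp (r * t) * exp (- ((Re s - r) * t))"
        by (simp add: mult_exp_exp)
      then show ?thesis by (simp only: mult_ac)
    qed
    also have "r * t - (Re s - r) * t = - ((Re s - 2 * r) * t)" by (simp add: algebra_simps)
    finally show ?thesis by (simp add: abs_mult mult.assoc)
  qed (simp add: neg)
  have int1: "integrable lborel (\<lambda>t. of_real (t * k t) * exp (- (s * of_real t)) :: complex)"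
  proof (rule Bochner_Integration.integrable_bound)
    have 2: "Re s - r > \<sigma>0" using r by (simp add: r_def field_simps)
    show "integrable lborel (\<lambda>t. ?v t + ?u t)"
      by (intro Bochner_Integration.integrable_add intK int[OF 2])
    show "AE t in lborel. norm (complex_of_real (t * k t) * exp (- (s * of_real t)))
       \<le> norm (?v t + ?u t)"
    proof (intro AE_I2)
      fix t :: real
      have "norm (complex_of_real (t * k t) * exp (- (s * of_real t))) \<le> ?v t + \<bar>t\<^sup>2 * k t\<bar> * exp (- ((Re s - r) * t))"
      proof (cases "t \<le> 0")
        case False
        then have t: "t > 0" by simp
        have "t \<le> 1 + t\<^sup>2" using zero_le_power2[of "t - 1/2"] by (simp add: power2_eq_square algebra_simps)
        moreover have "exp (- (Re s * t)) \<le> exp (- ((Re s - r) * t))" using t r by simp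
        ultimately have "t * exp (- (Re s * t)) \<le> (1 + t\<^sup>2) * exp (- ((Re s - r) * t))" using t
          by (intro mult_mono) auto
        then have "\<bar>k t\<bar> * (t * exp (- (Re s * t))) \<le> \<bar>k t\<bar> * ((1 + t\<^sup>2) * exp (- ((Re s - r) * t)))"
          by (intro mult_left_mono) auto
        moreover have "norm (complex_of_real (t * k t) * exp (- (s * of_real t))) = \<bar>k t\<bar> * (t * exp (- (Re s * t)))"
          using t by (subst norm_laplace_integrand) (simp add: abs_mult)
        ultimately show ?thesis by (simp add: abs_mult algebra_simps)
      qed (simp add: neg)
      also have "\<dots> \<le> ?v t + ?u t"
        using bnd by simp
      finally show "norm (complex_of_real (t * k t) * exp (- (s * of_real t))) \<le> norm (?v t + ?u t)"
        by simp
    qed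
  qed measurable
  have "norm ((laplace k (s + h) - laplace k s) / h - - laplace (\<lambda>t. t * k t) s) \<le> norm h * K"
    if h: "h \<noteq> 0" "norm h < r" for h
  proof -
    have "\<bar>Re h\<bar> < r" using h(2) abs_Re_le_cmod[of h] by linarith
    then have sh: "Re (s + h) > \<sigma>0" using r by (simp add: r_def)
    let ?g = "\<lambda>t. of_real (k t) * exp (- ((s + h) * of_real t)) - of_real (k t) * exp (- (s * of_real t))
        + h * (of_real (t * k t) * exp (- (s * of_real t)))"
    have ig: "integrable lborel ?g"
      by (intro Bochner_Integration.integrable_add Bochner_Integration.integrable_diff
            integrable_mult_right int' int1 sh s)
    have eq: "laplace k (s + h) - laplace k s + h * laplace (\<lambda>t. t * k t) s = (LINT t|lborel. ?g t)"
      unfolding laplace_def using int'[OF sh] int'[OF s] int1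
      by (subst Bochner_Integration.integral_add Bochner_Integration.integral_diff | simp)+
    have "norm (LINT t|lborel. ?g t) \<le> (LINT t|lborel. norm (?g t))" by simp
    also have "\<dots> \<le> (LINT t|lborel. (norm h)\<^sup>2 * (?u t))"
    proof (rule integral_mono)
      show "integrable lborel (\<lambda>t. norm (?g t))" using ig by simp
      show "integrable lborel (\<lambda>t. (norm h)\<^sup>2 * (?u t))"
        by (intro integrable_mult_right intK)
      fix t :: real
      show "norm (?g t) \<le> (norm h)\<^sup>2 * (?u t)"
      proof (cases "t \<le> 0")
        case False
        then have t: "t > 0" by simp
        have e: "exp (- ((s + h) * of_real t)) = exp (- (s * of_real t)) * exp (- (h * of_real t))"
          by (simp add: distrib_right flip: exp_add)
        have "?g t = of_real (k t) * exp (- (s * of_real t)) * (exp (- (h * of_real t)) - (1 + - (h * of_real t)))"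
          unfolding e by (simp add: algebra_simps)
        then have "norm (?g t) = \<bar>k t\<bar> * exp (- (Re s * t)) * norm (exp (- (h * of_real t)) - (1 + - (h * of_real t)))"
          by (simp add: norm_mult)
        also have "norm (exp (- (h * of_real t)) - (1 + - (h * of_real t))) \<le> exp (norm (- (h * of_real t))) * norm (- (h * of_real t)) ^ 2"
          using Taylor_exp_field[of "- (h * of_real t)" 1] by (simp add: numeral_2_eq_2)
        also have "\<dots> = exp (norm h * t) * (norm h * t)\<^sup>2" using t by (simp add: norm_mult)
        also have "\<dots> \<le> exp (r * t) * (norm h * t)\<^sup>2"
          using h t by (intro mult_right_mono) (auto simp: mult_right_mono)
        finally have "norm (?g t) \<le> \<bar>k t\<bar> * exp (- (Re s * t)) * (exp (r * t) * (norm h * t)\<^sup>2)"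
          by (simp add: mult_left_mono)
        also have "\<dots> = (norm h)\<^sup>2 * (\<bar>t\<^sup>2 * k t\<bar> * exp (r * t - Re s * t))"
          by (simp add: abs_mult power_mult_distrib exp_diff exp_minus field_simps)
        also have "r * t - Re s * t = - ((Re s - r) * t)" by (simp add: algebra_simps)
        also have "(norm h)\<^sup>2 * (\<bar>t\<^sup>2 * k t\<bar> * exp (- ((Re s - r) * t))) \<le> (norm h)\<^sup>2 * (?u t)"
          by (intro mult_left_mono bnd) auto
        finally show ?thesis .
      qed (simp add: neg)
    qed
    also have "\<dots> = (norm h)\<^sup>2 * K" unfolding K_def by (rule integral_mult_right_zero)
    finally have b: "norm (laplace k (s + h) - laplace k s + h * laplace (\<lambda>t. t * k t) s) \<le> (norm h)\<^sup>2 * K"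
      using eq by simp
    have "(laplace k (s + h) - laplace k s) / h - - laplace (\<lambda>t. t * k t) s
        = (laplace k (s + h) - laplace k s + h * laplace (\<lambda>t. t * k t) s) / h"
      using h by (simp add: field_simps)
    then have "norm ((laplace k (s + h) - laplace k s) / h - - laplace (\<lambda>t. t * k t) s)
        = norm (laplace k (s + h) - laplace k s + h * laplace (\<lambda>t. t * k t) s) / norm h"
      by (simp add: norm_divide)
    also have "\<dots> \<le> (norm h)\<^sup>2 * K / norm h" using b h by (intro divide_right_mono) auto
    also have "\<dots> = norm h * K" using h by (simp add: power2_eq_square)
    finally show ?thesis .
  qed
  then have "\<forall>\<^sub>F h in at 0. norm ((laplace k (s + h) - laplace k s) / h - - laplace (\<lambda>t. t * k t) s) \<le> norm h * K"
    using r by (auto simp: eventually_at intro!: exI[of _ r])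
  moreover have "((\<lambda>h::complex. norm h * K) \<longlongrightarrow> 0) (at 0)"
    by (auto intro!: tendsto_eq_intros)
  ultimately have "((\<lambda>h. (laplace k (s + h) - laplace k s) / h - - laplace (\<lambda>t. t * k t) s) \<longlongrightarrow> 0) (at 0)"
    by (rule Lim_null_comparison)
  then show ?thesis unfolding DERIV_def by (subst (asm) LIM_zero_iff)
qed

definition gamma_kernel :: "real \<Rightarrow> real \<Rightarrow> real" where
  "gamma_kernel a t = (if t > 0 then t powr (a - 1) else 0)"

lemma gamma_kernel_nonneg: "gamma_kernel a t \<ge> 0"
  by (simp add: gamma_kernel_def)

lemma measurable_gamma_kernel [measurable]: "gamma_kernel a \<in> borel_measurable borel"
  unfolding gamma_kernel_def by measurable

lemma gamma_kernel_times: "t * gamma_kernel a t = gamma_kernel (a + 1) t"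
  by (auto simp: gamma_kernel_def powr_diff powr_add)

lemma has_bochner_integral_gamma_kernel:
  assumes "a > 0"
  shows "has_bochner_integral lborel (\<lambda>t. gamma_kernel a t * exp (- t)) (Gamma a)"
proof -
  have "((\<lambda>t. t powr (a - 1) / exp t) has_integral Gamma a) {0..}"
    by (rule Gamma_integral_real[OF assms])
  then have "((\<lambda>t. if t \<in> {0..} then t powr (a - 1) / exp t else 0) has_integral Gamma a) UNIV"
    by (subst has_integral_restrict_UNIV)
  moreover have "(\<lambda>t. if t \<in> {0..} then t powr (a - 1) / exp t else 0) = (\<lambda>t. gamma_kernel a t * exp (- t))"
    by (auto simp: gamma_kernel_def fun_eq_iff exp_minus field_simps)
  ultimately have "((\<lambda>t. gamma_kernel a t * exp (- t)) has_integral Gamma a) UNIV" by simp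
  then show ?thesis
    by (intro has_bochner_integral_nn_integral nn_integral_has_integral_lborel)
      (auto simp: gamma_kernel_nonneg Gamma_real_pos assms less_imp_le)
qed

lemma has_bochner_integral_gamma_kernel_scaled:
  assumes a: "a > 0" and s: "\<sigma> > 0"
  shows "has_bochner_integral lborel (\<lambda>t. gamma_kernel a t * exp (- (\<sigma> * t))) (Gamma a * \<sigma> powr - a)"
proof -
  have "has_bochner_integral lborel (\<lambda>t. gamma_kernel a (0 + \<sigma> * t) * exp (- (0 + \<sigma> * t))) (Gamma a /\<^sub>R \<bar>\<sigma>\<bar>)"
    by (rule lborel_has_bochner_integral_real_affine_iff[THEN iffD1]) (use s has_bochner_integral_gamma_kernel[OF a] in auto)
  then have h: "has_bochner_integral lborel (\<lambda>t. \<sigma> powr (1 - a) * (gamma_kernel a (\<sigma> * t) * exp (- (\<sigma> * t)))) (\<sigma> powr (1 - a) * (Gamma a /\<^sub>R \<bar>\<sigma>\<bar>))"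
    by (intro has_bochner_integral_mult_right) auto
  have e1: "\<sigma> powr (1 - a) * (gamma_kernel a (\<sigma> * t) * exp (- (\<sigma> * t))) = gamma_kernel a t * exp (- (\<sigma> * t))" for t
    using s by (auto simp: gamma_kernel_def zero_less_mult_iff powr_mult powr_diff)
  have e2: "\<sigma> powr (1 - a) * (Gamma a /\<^sub>R \<bar>\<sigma>\<bar>) = Gamma a * \<sigma> powr - a"
    using s by (simp add: powr_diff powr_minus field_simps)
  show ?thesis using h unfolding e1 e2 .
qed

text \<open>On the positive real axis this is the Euler integral after scaling; both sides are holomorphic on the right half plane,
so the identity theorem extends it.\<close>

lemma laplace_gamma_kernel:
  assumes a: "a > 0" and s: "Re s > 0"
  shows "laplace (gamma_kernel a) s = of_real (Gamma a) * s powr (- of_real a)"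
proof -
  let ?H = "{z. 0 < Re z}"
  have int: "integrable lborel (\<lambda>t. \<bar>gamma_kernel a t\<bar> * exp (- (\<sigma> * t)))" if "\<sigma> > 0" for \<sigma>
    using has_bochner_integral_gamma_kernel_scaled[OF a that]
    by (simp add: gamma_kernel_nonneg has_bochner_integral_iff)
  have hol: "laplace (gamma_kernel a) holomorphic_on ?H"
    using laplace_has_field_derivative[of "gamma_kernel a" 0] int
    by (auto intro!: holomorphic_onI simp: gamma_kernel_def field_differentiable_def has_field_derivative_at_within)
      (blast intro: has_field_derivative_at_within)
  have real: "laplace (gamma_kernel a) z - of_real (Gamma a) * z powr (- of_real a) = 0"
    if "z \<in> of_real ` {0<..}" for z
  proof -
    from that obtain \<sigma> :: real where z: "z = of_real \<sigma>" "\<sigma> > 0" by auto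
    have "laplace (gamma_kernel a) z = (LINT t|lborel. of_real (gamma_kernel a t * exp (- (\<sigma> * t))))"
      unfolding laplace_def z by (simp add: exp_of_real flip: of_real_mult of_real_minus)
    also have "\<dots> = of_real (Gamma a * \<sigma> powr - a)"
      using has_bochner_integral_gamma_kernel_scaled[OF a z(2)]
      by (subst integral_complex_of_real) (simp add: has_bochner_integral_iff)
    also have "\<dots> = of_real (Gamma a) * z powr (- of_real a)"
      using z by (simp add: powr_of_real flip: of_real_minus)
    finally show ?thesis by simp
  qed
  have "laplace (gamma_kernel a) s - of_real (Gamma a) * s powr (- of_real a) = 0"
  proof (rule analytic_continuation[where S = ?H and U = "of_real ` {0<..}" and \<xi> = 1
      and f = "\<lambda>s. laplace (gamma_kernel a) s - of_real (Gamma a) * s powr (- of_real a)"])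
    show "(\<lambda>s. laplace (gamma_kernel a) s - of_real (Gamma a) * s powr (- of_real a)) holomorphic_on ?H"
      by (intro holomorphic_intros hol) (auto simp: complex_nonpos_Reals_iff)
    show "open ?H" by (rule open_halfspace_Re_gt)
    show "connected ?H" by (intro convex_connected convex_halfspace_Re_gt)
    show "of_real ` {0<..} \<subseteq> ?H" by auto
    show "1 islimpt (complex_of_real ` {0<..})"
      unfolding islimpt_approachable
    proof (intro allI impI)
      fix e :: real assume "e > 0"
      then have "of_real (1 + e / 2) \<in> complex_of_real ` {0<..}" by (intro imageI) auto
      moreover have "complex_of_real (1 + e / 2) \<noteq> 1" using \<open>e > 0\<close> by (simp only: of_real_eq_1_iff)
      moreover have "dist (complex_of_real (1 + e / 2)) (of_real 1) < e" using \<open>e > 0\<close> by (subst dist_of_real) (simp add: dist_norm)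
      ultimately show "\<exists>x'\<in>complex_of_real ` {0<..}. x' \<noteq> 1 \<and> dist x' 1 < e"
        by (metis of_real_1)
    qed
  qed (use real s in auto)
  then show ?thesis by simp
qed

section \<open>The functions \<open>F\<^sub>a\<close> and their behaviour at infinity\<close>

definition hermite_kernel :: "real \<Rightarrow> real \<Rightarrow> real" where
  "hermite_kernel a t = gamma_kernel a t * exp (- t\<^sup>2 / 2)"

text \<open>The function \<open>F\<^sub>a(z) = \<integral>\<^sub>0\<^sup>\<infinity> t\<^bsup>a-1\<^esup> e\<^bsup>-t\<^sup>2/2\<^esup> e\<^bsup>izt\<^esup> dt\<close>, a parabolic cylinder function up to elementary factors.
Extending it from the real line, where \<open>a = c\<close> gives a multiple of \<open>f_hat c\<close>, makes contour integration available.\<close>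

definition hermF :: "real \<Rightarrow> complex \<Rightarrow> complex" where
  "hermF a z = laplace (hermite_kernel a) (- (\<i> * z))"

lemma hermite_kernel_nonneg: "hermite_kernel a t \<ge> 0"
  by (simp add: hermite_kernel_def gamma_kernel_nonneg)

lemma measurable_hermite_kernel [measurable]: "hermite_kernel a \<in> borel_measurable borel"
  unfolding hermite_kernel_def by measurable

lemma hermite_kernel_times: "(\<lambda>t. t * hermite_kernel a t) = hermite_kernel (a + 1)"
  by (simp add: hermite_kernel_def fun_eq_iff gamma_kernel_times flip: mult.assoc)

lemma integrable_hermite_kernel:
  assumes a: "a > 0"
  shows "integrable lborel (\<lambda>t. \<bar>hermite_kernel a t\<bar> * exp (- (\<sigma> * t)))"
proof (rule Bochner_Integration.integrable_bound)
  show "integrable lborel (\<lambda>t. exp ((1 - \<sigma>)\<^sup>2 / 2) * (gamma_kernel a t * exp (- t)))"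
    using has_bochner_integral_gamma_kernel[OF a] by (intro integrable_mult_right) (auto simp: has_bochner_integral_iff)
  show "AE t in lborel. norm (\<bar>hermite_kernel a t\<bar> * exp (- (\<sigma> * t)))
      \<le> norm (exp ((1 - \<sigma>)\<^sup>2 / 2) * (gamma_kernel a t * exp (- t)))"
  proof (intro AE_I2)
    fix t :: real
    have "- t\<^sup>2 / 2 - \<sigma> * t \<le> (1 - \<sigma>)\<^sup>2 / 2 - t"
      using zero_le_power2[of "t + (\<sigma> - 1)"] by (simp add: power2_eq_square algebra_simps)
    then have "exp (- t\<^sup>2 / 2) * exp (- (\<sigma> * t)) \<le> exp ((1 - \<sigma>)\<^sup>2 / 2) * exp (- t)"
      by (simp add: mult_exp_exp)
    then have "gamma_kernel a t * (exp (- t\<^sup>2 / 2) * exp (- (\<sigma> * t))) \<le> gamma_kernel a t * (exp ((1 - \<sigma>)\<^sup>2 / 2) * exp (- t))"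
      by (intro mult_left_mono gamma_kernel_nonneg)
    then show "norm (\<bar>hermite_kernel a t\<bar> * exp (- (\<sigma> * t)))
      \<le> norm (exp ((1 - \<sigma>)\<^sup>2 / 2) * (gamma_kernel a t * exp (- t)))"
      by (simp add: hermite_kernel_def gamma_kernel_nonneg abs_mult algebra_simps)
  qed
qed measurable

lemma hermite_kernel_nonpos: "t \<le> 0 \<Longrightarrow> hermite_kernel a t = 0"
  by (simp add: hermite_kernel_def gamma_kernel_def)

lemma hermF_has_field_derivative:
  assumes "a > 0"
  shows "(hermF a has_field_derivative \<i> * hermF (a + 1) z) (at z within S)"
proof -
  have "(laplace (hermite_kernel a) has_field_derivative - hermF (a + 1) z) (at (- (\<i> * z)))"
    using laplace_has_field_derivative[of "hermite_kernel a" "Re (- (\<i> * z)) - 1" "- (\<i> * z)"]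
      integrable_hermite_kernel[OF assms]
    unfolding hermite_kernel_times hermF_def[of "a + 1"]
    by (simp add: hermite_kernel_nonpos)
  then have "((\<lambda>z. laplace (hermite_kernel a) (- (\<i> * z))) has_field_derivative - hermF (a + 1) z * - \<i>) (at z)"
    by (rule DERIV_chain2) (auto intro!: derivative_eq_intros)
  then have "(hermF a has_field_derivative \<i> * hermF (a + 1) z) (at z)"
    unfolding hermF_def[abs_def] by (simp add: mult.commute)
  then show ?thesis by (rule has_field_derivative_at_within)
qed

text \<open>The derivative of \<open>t\<^sup>a e\<^bsup>-t\<^sup>2/2 + izt\<^esup>\<close> is a combination of the three integrands, and the function vanishes at \<open>0\<close> and
at infinity.\<close>

lemma hermF_recurrence:
  assumes a: "a > 0"
  shows "hermF (a + 2) z = \<i> * z * hermF (a + 1) z + of_real a * hermF a z"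
proof -
  define s where "s = - (\<i> * z)"
  have int: "integrable lborel (\<lambda>t. of_real (hermite_kernel b t) * exp (- (s * of_real t)) :: complex)" if "b > 0" for b
    by (rule integrable_laplace) (use integrable_hermite_kernel[OF that] in auto)
  define f where "f t = of_real a * (of_real (hermite_kernel a t) * exp (- (s * of_real t)))
      - (of_real (hermite_kernel (a + 2) t) * exp (- (s * of_real t)))
      - s * (of_real (hermite_kernel (a + 1) t) * exp (- (s * of_real t)) :: complex)" for t
  define G where "G t = of_real (t powr a * exp (- t\<^sup>2 / 2)) * (exp (- (s * of_real t)) :: complex)" for t :: real
  have intf: "integrable lborel f"
    unfolding f_def using int[of a] int[of "a + 1"] int[of "a + 2"] a by auto
  have feq: "f t = of_real (a * t powr (a - 1) * exp (- t\<^sup>2 / 2) - t powr a * (t * exp (- t\<^sup>2 / 2))) * exp (- (s * of_real t))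
      + of_real (t powr a * exp (- t\<^sup>2 / 2)) * (- s * exp (- (s * of_real t)))" if "t > 0" for t
    using that by (simp add: f_def hermite_kernel_def gamma_kernel_def powr_add powr_diff field_simps)
  have deriv: "(G has_vector_derivative f t) (at t)" if "t > 0" for t
  proof -
    have 1: "((\<lambda>t. t powr a * exp (- t\<^sup>2 / 2)) has_real_derivative (a * t powr (a - 1) * exp (- t\<^sup>2 / 2) - t powr a * (t * exp (- t\<^sup>2 / 2)))) (at t)"
      using that by (auto intro!: derivative_eq_intros simp: powr_diff field_simps)
    have 2: "((\<lambda>t. exp (- (s * of_real t))) has_vector_derivative (- s * exp (- (s * of_real t)))) (at t)"
      by (rule has_vector_derivative_real_field) (auto intro!: derivative_eq_intros)
    have 3: "((\<lambda>t. complex_of_real (t powr a * exp (- t\<^sup>2 / 2))) has_vector_derivative of_real (a * t powr (a - 1) * exp (- t\<^sup>2 / 2) - t powr a * (t * exp (- t\<^sup>2 / 2)))) (at t)"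
      by (rule has_vector_derivative_of_real) (use 1 in \<open>simp add: has_real_derivative_iff_has_vector_derivative\<close>)
    show ?thesis
      unfolding G_def[abs_def] feq[OF that]
      using has_vector_derivative_mult[OF 3 2] by (simp add: algebra_simps)
  qed
  have nG: "norm (G t) = t powr a * exp (- t\<^sup>2 / 2) * exp (- (Re s * t))" for t
    by (simp add: G_def norm_mult)
  have cont: "isCont f t" if "t > 0" for t
  proof -
    let ?g = "\<lambda>t. of_real (a * t powr (a - 1) * exp (- t\<^sup>2 / 2) - t powr a * (t * exp (- t\<^sup>2 / 2))) * exp (- (s * of_real t))
      + of_real (t powr a * exp (- t\<^sup>2 / 2)) * (- s * exp (- (s * of_real t)))"
    have "isCont ?g t" using that by (intro continuous_intros) auto
    moreover have "\<forall>\<^sub>F x in nhds t. f x = ?g x"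
      using that by (intro eventually_nhds[THEN iffD2] exI[of _ "{0<..}"]) (auto simp: feq)
    ultimately show ?thesis by (subst isCont_cong)
  qed
  have "(LBINT t=0..\<infinity>. f t) = 0 - 0"
  proof (rule interval_integral_FTC_integrable)
    show "(G has_vector_derivative f x) (at x)" "isCont f x" if "0 < ereal x" "ereal x < \<infinity>" for x
      using deriv cont that by auto
    show "set_integrable lborel (einterval 0 \<infinity>) f"
      using integrable_mult_indicator[OF _ intf, of "einterval 0 \<infinity>"] by (simp add: set_integrable_def)
    have "((\<lambda>t. t powr a * exp (- t\<^sup>2 / 2) * exp (- (Re s * t))) \<longlongrightarrow> 0) (at_right 0)"
      using a by real_asymp
    then show "((G \<circ> real_of_ereal) \<longlongrightarrow> 0) (at_right 0)"
      unfolding zero_ereal_def ereal_tendsto_simps by (subst tendsto_norm_zero_iff[symmetric]) (simp add: nG)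
    have "((\<lambda>t. t powr a * exp (- t\<^sup>2 / 2) * exp (- (Re s * t))) \<longlongrightarrow> 0) at_top"
    proof (cases "Re s" "0 :: real" rule: linorder_cases)
      case less
      then show ?thesis using a by real_asymp
    next
      case equal
      then show ?thesis using a by simp real_asymp
    next
      case greater
      then show ?thesis using a by real_asymp
    qed
    then show "((G \<circ> real_of_ereal) \<longlongrightarrow> 0) (at_left \<infinity>)"
      unfolding ereal_tendsto_simps by (subst tendsto_norm_zero_iff[symmetric]) (simp add: nG)
  qed simp
  moreover have "(LBINT t=0..\<infinity>. f t) = (LINT t|lborel. f t)"
    unfolding zero_ereal_def interval_integral_to_infinity_eq set_lebesgue_integral_def
    by (intro Bochner_Integration.integral_cong) (auto simp: f_def hermite_kernel_def gamma_kernel_def indicator_def)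
  moreover have "(LINT t|lborel. f t) = of_real a * hermF a z - hermF (a + 2) z - s * hermF (a + 1) z"
    unfolding f_def hermF_def laplace_def s_def[symmetric]
    using int[of a] int[of "a + 1"] int[of "a + 2"] a
    by (subst Bochner_Integration.integral_diff | simp)+
  ultimately show ?thesis by (simp add: s_def) algebra
qed

lemma hermF_bounded:
  assumes a: "a > 0" and z: "Im z \<ge> 0"
  shows "norm (hermF a z) \<le> (LINT t|lborel. hermite_kernel a t)"
proof -
  have i: "integrable lborel (\<lambda>t. hermite_kernel a t)"
    using integrable_hermite_kernel[OF a, of 0] by (simp add: hermite_kernel_nonneg)
  have "norm (hermF a z) \<le> (LINT t|lborel. norm (of_real (hermite_kernel a t) * exp (- (- (\<i> * z) * of_real t))))"
    unfolding hermF_def laplace_def by (rule integral_norm_bound)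
  also have "\<dots> \<le> (LINT t|lborel. hermite_kernel a t)"
  proof (rule integral_mono)
    show "integrable lborel (\<lambda>t. norm (of_real (hermite_kernel a t) * exp (- (- (\<i> * z) * of_real t))))"
      unfolding norm_laplace_integrand by (rule integrable_hermite_kernel[OF a])
    show "norm (of_real (hermite_kernel a t) * exp (- (- (\<i> * z) * of_real t))) \<le> hermite_kernel a t" for t
      unfolding norm_laplace_integrand using z
      by (cases "t > 0") (auto simp: hermite_kernel_def gamma_kernel_def intro!: mult_left_le)
  qed (rule i)
  finally show ?thesis .
qed

text \<open>On the imaginary axis the integrand is real and positive.\<close>

lemma hermF_imaginary_axis_nonzero:
  assumes a: "a > 0"
  shows "hermF a (\<i> * of_real y) \<noteq> 0"
proof
  assume 0: "hermF a (\<i> * of_real y) = 0"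
  let ?f = "\<lambda>t. hermite_kernel a t * exp (- (y * t))"
  have i: "integrable lborel ?f"
    using integrable_hermite_kernel[OF a, of y] by (simp add: hermite_kernel_nonneg)
  have "hermF a (\<i> * of_real y) = (LINT t|lborel. of_real (?f t))"
    unfolding hermF_def laplace_def
    by (intro Bochner_Integration.integral_cong) (simp_all flip: mult.assoc exp_of_real)
  also have "\<dots> = of_real (LINT t|lborel. ?f t)" by (rule integral_complex_of_real)
  finally have "(LINT t|lborel. ?f t) = 0" using 0 by (metis of_real_eq_0_iff)
  then have "AE t in lborel. ?f t = 0"
    using integral_nonneg_eq_0_iff_AE[OF i] by (auto simp: hermite_kernel_nonneg)
  then have "AE t in lborel. t \<notin> {0<..<1::real}"
    by eventually_elim (auto simp: hermite_kernel_def gamma_kernel_def)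
  then have "emeasure lborel {0<..<1::real} = 0"
    by (subst (asm) AE_iff_measurable[of "{0<..<1}"]) auto
  then show False by simp
qed

lemma powr_divide_halfplane:
  fixes u v x :: complex
  assumes "Re u > 0" "Re v > 0"
  shows "(u / v) powr x = u powr x * v powr (- x)"
proof -
  have nz: "u \<noteq> 0" "v \<noteq> 0" using assms by auto
  have "\<bar>Im (Ln u)\<bar> < pi / 2" "\<bar>Im (Ln v)\<bar> < pi / 2" using assms nz Re_Ln_pos_lt by auto
  then have *: "Ln (u / v) = Ln u - Ln v"
    using nz by (intro Ln_unique) (auto simp: exp_diff)
  show ?thesis using nz unfolding powr_def * by (simp add: right_diff_distrib flip: exp_add)
qed

lemma std_normal_char:
  "(LINT g|lborel. of_real (std_normal_density g) * exp (\<i> * of_real (t * g))) = complex_of_real (exp (- (t\<^sup>2) / 2))"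
proof -
  have "char std_normal_distribution t = complex_of_real (exp (- (t\<^sup>2) / 2))"
    by (simp add: char_std_normal_distribution)
  moreover have "char std_normal_distribution t = (LINT g|lborel. std_normal_density g *\<^sub>R exp (\<i> * of_real (t * g)))"
    unfolding char_def by (intro integral_density) auto
  ultimately show ?thesis by (simp add: scaleR_conv_of_real)
qed

text \<open>Write \<open>e\<^bsup>-t\<^sup>2/2\<^esup> = e\<^bsup>1/2\<^esup> e\<^bsup>-t\<^esup> e\<^bsup>-(t-1)\<^sup>2/2\<^esup>\<close>, replace the last factor by the Gaussian average of
\<open>e\<^bsup>i(t-1)g\<^esup>\<close> and integrate over \<open>t\<close> first. Splitting off \<open>e\<^bsup>-t\<^esup>\<close> is what makes this useful: the power function is then
evaluated on the half plane of real part at least one, so its singularity stays away from the closed upper half plane,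
the real line included.\<close>

lemma hermF_gaussian_average:
  assumes a: "a > 0" and z: "Im z \<ge> 0"
  shows "hermF a z = of_real (exp (1/2) * Gamma a) *
    (LINT g|lborel. of_real (std_normal_density g) * exp (- (\<i> * of_real g)) * (1 - \<i> * z - \<i> * of_real g) powr (- of_real a))"
proof -
  define s where "s = 1 - \<i> * z"
  have s: "Re s \<ge> 1" using z by (simp add: s_def)
  define H where "H t g = of_real (gamma_kernel a t) * exp (- (s * of_real t)) *
     (of_real (std_normal_density g) * exp (\<i> * of_real ((t - 1) * g)))" for t g :: real
  have norm_sn: "integrable lborel std_normal_density" "integral\<^sup>L lborel std_normal_density = 1"
    using integrable_std_normal_moment[of 0] integral_std_normal_moment_even[of 0] by auto
  have normH: "norm (H t g) = gamma_kernel a t * exp (- (Re s * t)) * std_normal_density g" for t g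
    by (simp add: H_def norm_mult gamma_kernel_nonneg)
  have intH: "integrable (lborel \<Otimes>\<^sub>M lborel) (\<lambda>(t, g). H t g)"
  proof (rule lborel_pair.Fubini_integrable)
    show "(\<lambda>(t, g). H t g) \<in> borel_measurable (lborel \<Otimes>\<^sub>M lborel)"
      unfolding H_def[abs_def] case_prod_unfold by measurable
    show "integrable lborel (\<lambda>x. LBINT y. norm (case (x, y) of (t, g) \<Rightarrow> H t g))"
      using has_bochner_integral_gamma_kernel_scaled[OF a, of "Re s"] s
      by (simp add: normH norm_sn has_bochner_integral_iff)
    show "AE x in lborel. integrable lborel (\<lambda>y. case (x, y) of (t, g) \<Rightarrow> H t g)"
    proof (intro AE_I2)
      fix x
      have "integrable lborel (\<lambda>y. norm (H x y))" unfolding normH by (intro integrable_mult_right norm_sn)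
      then show "integrable lborel (\<lambda>y. case (x, y) of (t, g) \<Rightarrow> H t g)"
        by (subst (asm) integrable_norm_iff) (auto simp: H_def[abs_def])
    qed
  qed
  have "hermF a z = (LINT t|lborel. of_real (exp (1/2)) * (LINT g|lborel. H t g))"
    unfolding hermF_def laplace_def
  proof (intro Bochner_Integration.integral_cong refl)
    fix t :: real
    have "(LINT g|lborel. H t g) = of_real (gamma_kernel a t) * exp (- (s * of_real t)) * of_real (exp (- ((t - 1)\<^sup>2) / 2))"
      unfolding H_def by (subst integral_mult_right_zero) (simp only: std_normal_char)
    moreover have "of_real (exp (1/2)) * (exp (- (s * of_real t)) * of_real (exp (- ((t - 1)\<^sup>2) / 2))) = of_real (exp (- t\<^sup>2 / 2)) * exp (- (- (\<i> * z) * of_real t))"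
    proof -
      have "1/2 - s * of_real t - (of_real t - 1)\<^sup>2 / 2 = - (of_real t)\<^sup>2 / 2 - (- (\<i> * z) * of_real t)"
        by (simp add: s_def power2_eq_square field_simps)
      then have "exp (1/2 - s * of_real t - (of_real t - 1)\<^sup>2 / 2) = exp (- (of_real t)\<^sup>2 / 2 - (- (\<i> * z) * of_real t))"
        by (simp only:)
      then have "exp (1/2) * exp (- (s * of_real t)) * exp (- ((of_real t - 1)\<^sup>2) / 2) = exp (- (of_real t)\<^sup>2 / 2) * exp (- (- (\<i> * z) * of_real t))"
        by (simp only: mult_exp_exp minus_divide_left diff_conv_add_uminus)
      then show ?thesis by (simp add: mult.assoc flip: exp_of_real)
    qed
    ultimately show "of_real (hermite_kernel a t) * exp (- (- (\<i> * z) * of_real t)) = of_real (exp (1/2)) * (LINT g|lborel. H t g)"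
      by (simp add: hermite_kernel_def mult_ac)
  qed
  also have "\<dots> = of_real (exp (1/2)) * (LINT g|lborel. LINT t|lborel. H t g)"
    by (simp add: lborel_pair.Fubini_integral[OF intH])
  also have "(LINT g|lborel. LINT t|lborel. H t g) = (LINT g|lborel. of_real (Gamma a) * (of_real (std_normal_density g) * exp (- (\<i> * of_real g)) * (1 - \<i> * z - \<i> * of_real g) powr (- of_real a)))"
  proof (intro Bochner_Integration.integral_cong refl)
    fix g :: real
    have "(LINT t|lborel. H t g) = (LINT t|lborel. of_real (std_normal_density g) * exp (- (\<i> * of_real g)) * (of_real (gamma_kernel a t) * exp (- ((s - \<i> * of_real g) * of_real t))))"
    proof (intro Bochner_Integration.integral_cong refl)
      fix t :: real
      have "exp (- (s * of_real t)) * exp (\<i> * of_real ((t - 1) * g)) = exp (- (\<i> * of_real g)) * exp (- ((s - \<i> * of_real g) * of_real t))"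
        by (simp add: algebra_simps flip: exp_add)
      moreover have "H t g = of_real (gamma_kernel a t) * of_real (std_normal_density g) * (exp (- (s * of_real t)) * exp (\<i> * of_real ((t - 1) * g)))"
        by (simp only: H_def mult_ac)
      ultimately show "H t g = of_real (std_normal_density g) * exp (- (\<i> * of_real g)) * (of_real (gamma_kernel a t) * exp (- ((s - \<i> * of_real g) * of_real t)))"
        by (simp only: mult_ac)
    qed
    also have "\<dots> = of_real (std_normal_density g) * exp (- (\<i> * of_real g)) * laplace (gamma_kernel a) (s - \<i> * of_real g)"
      unfolding laplace_def by (rule integral_mult_right_zero)
    also have "laplace (gamma_kernel a) (s - \<i> * of_real g) = of_real (Gamma a) * (s - \<i> * of_real g) powr (- of_real a)"
      using s by (intro laplace_gamma_kernel a) simp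
    finally show "(LINT t|lborel. H t g) = of_real (Gamma a) * (of_real (std_normal_density g) * exp (- (\<i> * of_real g)) * (1 - \<i> * z - \<i> * of_real g) powr (- of_real a))"
      by (simp add: s_def mult_ac)
  qed
  finally show ?thesis by (simp add: mult_ac)
qed

text \<open>After division by \<open>s = 1 - iz\<close> the power in the Gaussian average becomes \<open>(1 - ig/s)\<^bsup>-a\<^esup>\<close>, which tends to one. The
inequality \<open>\<bar>s\<bar> \<le> \<bar>s - ig\<bar> (1 + \<bar>g\<bar>)\<close> dominates it by a power of \<open>1 + \<bar>g\<bar>\<close>. The form with
arbitrary sequences expresses uniformity over all directions of the closed half plane.\<close>

lemma hermF_asymptotic:
  assumes a: "a > 0" and Im: "\<And>n. Im (z n) \<ge> 0" and lim: "filterlim (\<lambda>n. norm (z n)) at_top sequentially"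
  shows "(\<lambda>n. hermF a (z n) * (1 - \<i> * z n) powr of_real a) \<longlonglongrightarrow> of_real (Gamma a)"
proof -
  define s where "s n = 1 - \<i> * z n" for n
  have s: "Re (s n) \<ge> 1" for n using Im by (simp add: s_def)
  have slim: "filterlim (\<lambda>n. norm (s n)) at_top sequentially"
  proof (rule filterlim_at_top_mono)
    show "filterlim (\<lambda>n. - 1 + norm (z n)) at_top sequentially"
      by (rule filterlim_tendsto_add_at_top[OF tendsto_const lim])
    show "\<forall>\<^sub>F n in sequentially. - 1 + norm (z n) \<le> norm (s n)"
      unfolding s_def using norm_triangle_ineq3[of "\<i> * z n" 1 for n]
      by (intro always_eventually allI) (metis (no_types, opaque_lifting) abs_le_iff add.commute diff_conv_add_uminus norm_ii norm_minus_commute norm_mult norm_one mult_1 norm_triangle_ineq2)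
  qed
  define u where "u n g = (s n - \<i> * of_real g) / s n" for n and g :: real
  have seq: "hermF a (z n) * s n powr of_real a = of_real (exp (1/2) * Gamma a) *
     (LINT g|lborel. of_real (std_normal_density g) * exp (- (\<i> * of_real g)) * u n g powr (- of_real a))" for n
  proof -
    have "u n g powr (- of_real a) = (s n - \<i> * of_real g) powr (- of_real a) * s n powr of_real a" for g
      unfolding u_def using s[of n] by (subst powr_divide_halfplane) auto
    then have "(LINT g|lborel. of_real (std_normal_density g) * exp (- (\<i> * of_real g)) * u n g powr (- of_real a))
      = (LINT g|lborel. (of_real (std_normal_density g) * exp (- (\<i> * of_real g)) * (s n - \<i> * of_real g) powr (- of_real a)) * s n powr of_real a)"
      by (simp add: mult_ac)
    also have "\<dots> = (LINT g|lborel. (of_real (std_normal_density g) * exp (- (\<i> * of_real g)) * (s n - \<i> * of_real g) powr (- of_real a))) * s n powr of_real a"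
      by (rule integral_mult_left_zero)
    finally show ?thesis unfolding hermF_gaussian_average[OF a Im] s_def by simp
  qed
  have "(\<lambda>n. LINT g|lborel. of_real (std_normal_density g) * exp (- (\<i> * of_real g)) * u n g powr (- of_real a))
     \<longlonglongrightarrow> (LINT g|lborel. of_real (std_normal_density g) * exp (- (\<i> * of_real g)))"
  proof (rule integral_dominated_convergence)
    show "(\<lambda>g. of_real (std_normal_density g) * exp (- (\<i> * of_real g)) :: complex) \<in> borel_measurable lborel" by measurable
    have "continuous_on UNIV (\<lambda>g. u n g powr (- of_real a))" for n
    proof (intro continuous_at_imp_continuous_on ballI isCont_powr_complex)
      fix g :: real
      have "s n \<noteq> 0" using s[of n] by auto
      show "u n g \<notin> \<real>\<^sub>\<le>\<^sub>0"
      proof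
        assume *: "u n g \<in> \<real>\<^sub>\<le>\<^sub>0"
        then obtain r where r: "u n g = of_real r" "r \<le> 0" by (auto elim: nonpos_Reals_cases)
        then have "s n - \<i> * of_real g = of_real r * s n" using \<open>s n \<noteq> 0\<close> by (simp add: u_def field_simps)
        then have "Re (s n) = r * Re (s n)" by (auto simp: complex_eq_iff)
        then show False using s[of n] r(2) by (smt (verit) mult_nonpos_nonneg)
      qed
      show "isCont (u n) g"
        unfolding u_def[abs_def] using \<open>s n \<noteq> 0\<close> by (intro continuous_intros)
    qed auto
    then have m [measurable]: "(\<lambda>g. u n g powr (- of_real a)) \<in> borel_measurable borel" for n
      by (rule borel_measurable_continuous_onI)
    show "(\<lambda>g. of_real (std_normal_density g) * exp (- (\<i> * of_real g)) * u n g powr (- of_real a)) \<in> borel_measurable lborel" for n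
      by measurable
    show "integrable lborel (\<lambda>x. std_normal_density x * (1 + \<bar>x\<bar>) ^ nat \<lceil>a\<rceil>)" by (rule integrable_std_normal_poly)
    show "AE g in lborel. (\<lambda>n. of_real (std_normal_density g) * exp (- (\<i> * of_real g)) * u n g powr (- of_real a)) \<longlonglongrightarrow> of_real (std_normal_density g) * exp (- (\<i> * of_real g))"
    proof (intro AE_I2)
      fix g :: real
      have "(\<lambda>n. \<i> * of_real g / s n) \<longlonglongrightarrow> 0"
        by (rule tendsto_divide_0[OF tendsto_const]) (use slim in \<open>simp add: filterlim_at_infinity_conv_norm_at_top\<close>)
      then have "(\<lambda>n. 1 - \<i> * of_real g / s n) \<longlonglongrightarrow> 1 - 0" by (intro tendsto_intros)
      moreover have "1 - \<i> * of_real g / s n = u n g" for n using s[of n] by (auto simp: u_def diff_divide_distrib)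
      ultimately have "(\<lambda>n. u n g) \<longlonglongrightarrow> 1" by simp
      then have "(\<lambda>n. u n g powr (- of_real a)) \<longlonglongrightarrow> 1 powr (- of_real a)" by (intro tendsto_powr_complex) auto
      then have "(\<lambda>n. of_real (std_normal_density g) * exp (- (\<i> * of_real g)) * u n g powr (- of_real a)) \<longlonglongrightarrow> of_real (std_normal_density g) * exp (- (\<i> * of_real g)) * 1 powr (- of_real a)"
        by (rule tendsto_mult[OF tendsto_const])
      then show "(\<lambda>n. of_real (std_normal_density g) * exp (- (\<i> * of_real g)) * u n g powr (- of_real a)) \<longlonglongrightarrow> of_real (std_normal_density g) * exp (- (\<i> * of_real g))"
        by simp
    qed
    show "AE g in lborel. norm (of_real (std_normal_density g) * exp (- (\<i> * of_real g)) * u n g powr (- of_real a)) \<le> std_normal_density g * (1 + \<bar>g\<bar>) ^ nat \<lceil>a\<rceil>" for n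
    proof (intro AE_I2)
      fix g :: real
      let ?w = "s n - \<i> * of_real g"
      have w1: "1 \<le> norm ?w" using s[of n] complex_Re_le_cmod[of ?w] by simp
      have s1: "1 \<le> norm (s n)" using s[of n] complex_Re_le_cmod[of "s n"] by simp
      have "norm (s n) \<le> norm ?w + \<bar>g\<bar>" using norm_triangle_ineq[of ?w "\<i> * of_real g"] by (simp add: norm_mult)
      also have "\<dots> \<le> norm ?w * (1 + \<bar>g\<bar>)" using mult_right_mono[OF w1, of "\<bar>g\<bar>"] by (simp add: algebra_simps)
      finally have "norm (s n) / norm ?w \<le> 1 + \<bar>g\<bar>" using w1 by (subst pos_divide_le_eq) (auto simp: mult.commute)
      then have "inverse (norm (u n g)) \<le> 1 + \<bar>g\<bar>" by (simp add: u_def norm_divide)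
      moreover have "norm ?w > 0" "norm (s n) > 0" using w1 s1 by linarith+
      then have un: "norm (u n g) > 0" by (simp only: u_def norm_divide divide_pos_pos)
      ultimately have "inverse (norm (u n g)) powr a \<le> (1 + \<bar>g\<bar>) powr a" using a by (intro powr_mono2) auto
      also have "\<dots> \<le> (1 + \<bar>g\<bar>) powr real (nat \<lceil>a\<rceil>)" using a by (intro powr_mono) (auto simp: real_nat_ceiling_ge)
      also have "\<dots> = (1 + \<bar>g\<bar>) ^ nat \<lceil>a\<rceil>" by (intro powr_realpow) auto
      finally have *: "inverse (norm (u n g)) powr a \<le> (1 + \<bar>g\<bar>) ^ nat \<lceil>a\<rceil>" .
      have "norm (u n g powr (- of_real a)) \<le> (1 + \<bar>g\<bar>) ^ nat \<lceil>a\<rceil>"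
      proof -
        have "norm (u n g powr (- of_real a)) = norm (u n g) powr (- a)"
          using norm_powr_real_powr'[of "- complex_of_real a" "u n g"] by simp
        also have "\<dots> = inverse (norm (u n g)) powr a" using un by (simp add: powr_minus inverse_powr)
        finally show ?thesis using * by (simp only:)
      qed
      then show "norm (of_real (std_normal_density g) * exp (- (\<i> * of_real g)) * u n g powr (- of_real a)) \<le> std_normal_density g * (1 + \<bar>g\<bar>) ^ nat \<lceil>a\<rceil>"
        by (simp add: norm_mult mult_left_mono)
    qed
  qed
  then have "(\<lambda>n. hermF a (z n) * s n powr of_real a) \<longlonglongrightarrow> of_real (exp (1/2) * Gamma a) * (LINT g|lborel. of_real (std_normal_density g) * exp (- (\<i> * of_real g)))"
    unfolding seq by (intro tendsto_intros)
  moreover have "(LINT g|lborel. of_real (std_normal_density g) * exp (- (\<i> * of_real g))) = complex_of_real (exp (-1/2))"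
    using std_normal_char[of "-1"] by simp
  moreover have "complex_of_real (exp (1/2) * Gamma a) * of_real (exp (-1/2)) = of_real (Gamma a)"
  proof -
    have "exp (1/2) * Gamma a * exp (-1/2) = Gamma a" by (simp add: exp_minus)
    then show ?thesis by (simp only: of_real_mult[symmetric])
  qed
  ultimately show ?thesis by (simp only: s_def)
qed

section \<open>Zeros and Wronskian of \<open>F\<^sub>a\<close>\<close>

text \<open>The function \<open>V = F\<^sub>a e\<^bsup>z\<^sup>2/4\<^esup>\<close> solves the Weber equation \<open>V'' = (1/2 - a + z\<^sup>2/4) V\<close>. Along the vertical ray
\<open>x + i(y + s)\<close>, \<open>s \<ge> 0\<close>, the quantity \<open>x Re (cnj V * V')\<close> has the derivative \<open>- x\<^sup>2 (y + s) \<bar>V\<bar>\<^sup>2 / 2\<close>, so it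
decreases. At a zero \<open>z\<^sub>0 = x + iy\<close> it starts from \<open>0\<close>, and it tends to \<open>0\<close> because of the factor \<open>e\<^bsup>z\<^sup>2/4\<^esup>\<close>; hence it is
constant, \<open>V\<close> vanishes on the whole ray, and this contradicts the asymptotics. For \<open>x = 0\<close> the argument is void and
positivity on the imaginary axis takes its place.\<close>

lemma hermF_nonzero:
  assumes a: "a > 0" and Im: "Im z0 \<ge> 0"
  shows "hermF a z0 \<noteq> 0"
proof
  assume zero: "hermF a z0 = 0"
  define x y where "x = Re z0" and "y = Im z0"
  have z0: "z0 = of_real x + \<i> * of_real y" by (simp add: x_def y_def complex_eq_iff)
  have x0: "x \<noteq> 0" using hermF_imaginary_axis_nonzero[OF a, of y] zero z0 by auto
  have y: "y \<ge> 0" using Im by (simp add: y_def)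
  define V where "V z = hermF a z * exp (z\<^sup>2 / 4)" for z
  (* U is the derivative of V. *)
  define U where "U z = (\<i> * hermF (a + 1) z + z / 2 * hermF a z) * exp (z\<^sup>2 / 4)" for z
  have dV: "(V has_field_derivative U z) (at z)" for z
    unfolding V_def[abs_def] U_def
    by (auto intro!: derivative_eq_intros hermF_has_field_derivative a simp: algebra_simps)
  have dU: "(U has_field_derivative (1/2 - of_real a + z\<^sup>2 / 4) * V z) (at z)" for z
  proof -
    have rec: "hermF (a + 1 + 1) z = \<i> * z * hermF (a + 1) z + of_real a * hermF a z"
      using hermF_recurrence[OF a, of z] by (simp add: add.assoc)
    have "(U has_field_derivative ((\<i> * (\<i> * hermF (a + 1 + 1) z) + (hermF a z / 2 + z / 2 * (\<i> * hermF (a + 1) z))) * exp (z\<^sup>2 / 4)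
        + (\<i> * hermF (a + 1) z + z / 2 * hermF a z) * (exp (z\<^sup>2 / 4) * (z / 2)))) (at z)"
      unfolding U_def[abs_def] using a
      by (auto intro!: derivative_eq_intros hermF_has_field_derivative simp: algebra_simps)
    moreover have "(\<i> * (\<i> * hermF (a + 1 + 1) z) + (hermF a z / 2 + z / 2 * (\<i> * hermF (a + 1) z))) * exp (z\<^sup>2 / 4)
        + (\<i> * hermF (a + 1) z + z / 2 * hermF a z) * (exp (z\<^sup>2 / 4) * (z / 2)) = (1/2 - of_real a + z\<^sup>2 / 4) * V z"
    proof -
      have "(\<i> * (\<i> * (\<i> * z * G + A * F)) + (F / 2 + z / 2 * (\<i> * G))) * E + (\<i> * G + z / 2 * F) * (E * (z / 2))
        = (1/2 - A + z\<^sup>2 / 4) * (F * E)" for F G E A :: complex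
        by (simp add: field_simps power2_eq_square)
      then show ?thesis unfolding V_def rec .
    qed
    ultimately show ?thesis by simp
  qed
  define p where "p s = of_real x + \<i> * of_real (y + s)" for s :: real
  have dp: "(p has_vector_derivative \<i>) (at s)" for s
    unfolding p_def[abs_def] by (auto intro!: derivative_eq_intros simp: has_vector_derivative_def scaleR_conv_of_real)
  (* The factor x makes the monotonicity independent of the side of the imaginary axis. *)
  define h where "h s = x * (Re (V (p s)) * Re (U (p s)) + Im (V (p s)) * Im (U (p s)))" for s
  have dVp: "((\<lambda>s. V (p s)) has_vector_derivative \<i> * U (p s)) (at s)" for s
    using field_vector_diff_chain_at[OF dp dV] by (simp add: o_def)
  have dUp: "((\<lambda>s. U (p s)) has_vector_derivative \<i> * ((1/2 - of_real a + (p s)\<^sup>2 / 4) * V (p s))) (at s)" for s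
    using field_vector_diff_chain_at[OF dp dU] by (simp add: o_def)
  have imp: "Im ((p s)\<^sup>2) = 2 * x * (y + s)" for s
    by (simp add: p_def power2_eq_square algebra_simps)
  have dh: "(h has_real_derivative - (x\<^sup>2 * (y + s) / 2 * (norm (V (p s)))\<^sup>2)) (at s)" for s
  proof -
    note D = has_field_derivative_Re[OF dVp[of s]] has_field_derivative_Im[OF dVp[of s]] has_field_derivative_Re[OF dUp[of s]] has_field_derivative_Im[OF dUp[of s]]
    define q where "q = 1/2 - of_real a + (p s)\<^sup>2 / 4"
    have imq: "Im q = x * (y + s) / 2" using imp[of s] by (simp add: q_def)
    have "(h has_real_derivative x * ((Re (\<i> * U (p s)) * Re (U (p s)) + Re (\<i> * (q * V (p s))) * Re (V (p s))) + (Im (\<i> * U (p s)) * Im (U (p s)) + Im (\<i> * (q * V (p s))) * Im (V (p s))))) (at s)"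
      unfolding h_def[abs_def] q_def by (intro DERIV_cmult DERIV_add DERIV_mult D)
    moreover have "x * ((Re (\<i> * U (p s)) * Re (U (p s)) + Re (\<i> * (q * V (p s))) * Re (V (p s))) + (Im (\<i> * U (p s)) * Im (U (p s)) + Im (\<i> * (q * V (p s))) * Im (V (p s)))) = - (x * Im q * (norm (V (p s)))\<^sup>2)"
      unfolding cmod_power2 by (simp add: power2_eq_square algebra_simps)
    ultimately show ?thesis by (simp add: imq power2_eq_square mult.assoc)
  qed
  have h0: "h 0 = 0" using zero z0 by (simp add: h_def V_def p_def)
  define A B where "A = (LINT t|lborel. hermite_kernel a t)" and "B = (LINT t|lborel. hermite_kernel (a + 1) t)"
  have A: "A \<ge> 0" and B: "B \<ge> 0" by (auto simp: A_def B_def hermite_kernel_nonneg intro!: Bochner_Integration.integral_nonneg)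
  have hbound: "norm (h s) \<le> \<bar>x\<bar> * (A * (B + (\<bar>x\<bar> + y + s) / 2 * A) * exp ((x\<^sup>2 - (y + s)\<^sup>2) / 2))" if "s \<ge> 0" for s
  proof -
    have np: "norm (p s) \<le> \<bar>x\<bar> + y + s"
      using norm_triangle_ineq[of "of_real x" "\<i> * of_real (y + s)"] that y unfolding p_def by (simp add: norm_mult del: of_real_add)
    have ip: "Im (p s) \<ge> 0" using that y by (simp add: p_def)
    have e: "norm (exp ((p s)\<^sup>2 / 4)) = exp ((x\<^sup>2 - (y + s)\<^sup>2) / 4)"
      by (simp add: p_def power2_eq_square algebra_simps)
    have nV: "norm (V (p s)) \<le> A * exp ((x\<^sup>2 - (y + s)\<^sup>2) / 4)"
      unfolding V_def norm_mult e by (intro mult_right_mono) (auto simp: A_def intro!: hermF_bounded a ip)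
    have "norm (U (p s)) \<le> (B + (\<bar>x\<bar> + y + s) / 2 * A) * exp ((x\<^sup>2 - (y + s)\<^sup>2) / 4)"
      unfolding U_def norm_mult e
    proof (intro mult_right_mono order.trans[OF norm_triangle_ineq] add_mono)
      show "norm (\<i> * hermF (a + 1) (p s)) \<le> B" using hermF_bounded[of "a + 1", OF _ ip] a by (simp add: norm_mult B_def)
      show "norm (p s / 2 * hermF a (p s)) \<le> (\<bar>x\<bar> + y + s) / 2 * A"
        unfolding norm_mult using hermF_bounded[OF a ip] np that y by (intro mult_mono) (auto simp: A_def norm_divide)
    qed simp
    moreover have "(Re (V (p s)) * Re (U (p s)) + Im (V (p s)) * Im (U (p s))) = Re (cnj (V (p s)) * U (p s))" by simp
    then have "norm (h s) \<le> \<bar>x\<bar> * (norm (V (p s)) * norm (U (p s)))"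
      unfolding h_def by (metis abs_Re_le_cmod abs_ge_zero abs_mult complex_mod_cnj mult_left_mono norm_mult real_norm_def)
    moreover have "norm (V (p s)) * norm (U (p s)) \<le> (A * exp ((x\<^sup>2 - (y + s)\<^sup>2) / 4)) * ((B + (\<bar>x\<bar> + y + s) / 2 * A) * exp ((x\<^sup>2 - (y + s)\<^sup>2) / 4))"
      using A by (intro mult_mono nV calculation(1)) auto
    moreover have "exp ((x\<^sup>2 - (y + s)\<^sup>2) / 4) * exp ((x\<^sup>2 - (y + s)\<^sup>2) / 4) = exp ((x\<^sup>2 - (y + s)\<^sup>2) / 2)"
      by (simp add: mult_exp_exp)
    then have "(A * exp ((x\<^sup>2 - (y + s)\<^sup>2) / 4)) * ((B + (\<bar>x\<bar> + y + s) / 2 * A) * exp ((x\<^sup>2 - (y + s)\<^sup>2) / 4)) = A * (B + (\<bar>x\<bar> + y + s) / 2 * A) * exp ((x\<^sup>2 - (y + s)\<^sup>2) / 2)"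
      by (metis (no_types, opaque_lifting) mult.assoc mult.left_commute)
    ultimately show ?thesis by (smt (verit, best) abs_ge_zero mult_left_mono)
  qed
  have hlim: "(h \<longlongrightarrow> 0) at_top"
  proof (rule Lim_null_comparison)
    show "\<forall>\<^sub>F s in at_top. norm (h s) \<le> \<bar>x\<bar> * (A * (B + (\<bar>x\<bar> + y + s) / 2 * A) * exp ((x\<^sup>2 - (y + s)\<^sup>2) / 2))"
      using eventually_ge_at_top[of 0] by eventually_elim (rule hbound)
    show "((\<lambda>s. \<bar>x\<bar> * (A * (B + (\<bar>x\<bar> + y + s) / 2 * A) * exp ((x\<^sup>2 - (y + s)\<^sup>2) / 2))) \<longlongrightarrow> 0) at_top"
      by real_asymp
  qed
  have mono: "h t \<le> h s" if "0 \<le> s" "s \<le> t" for s t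
  proof (rule DERIV_nonpos_imp_nonincreasing[OF that(2)])
    fix u assume "s \<le> u" "u \<le> t"
    then show "\<exists>d. (h has_real_derivative d) (at u) \<and> d \<le> 0"
      using dh[of u] y that(1) by (intro exI[of _ "- (x\<^sup>2 * (y + u) / 2 * (norm (V (p u)))\<^sup>2)"]) auto
  qed
  have h_zero: "h s = 0" if "s \<ge> 0" for s
  proof (rule antisym)
    show "h s \<le> 0" using mono[of 0 s] h0 that by simp
    show "h s \<ge> 0"
      by (rule tendsto_upperbound[OF hlim])
        (use mono[OF that] in \<open>auto simp: eventually_at_top_linorder\<close>)
  qed
  have F0: "hermF a (p s) = 0" if "s > 0" for s
  proof -
    have "\<forall>\<^sub>F u in nhds s. h u = 0"
      using that h_zero by (intro eventually_nhds[THEN iffD2] exI[of _ "{0<..}"]) auto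
    then have "(h has_real_derivative 0) (at s)"
      by (subst DERIV_cong_ev[where g = "\<lambda>_. 0"]) auto
    then have "x\<^sup>2 * (y + s) / 2 * (norm (V (p s)))\<^sup>2 = 0" using DERIV_unique[OF dh] by fastforce
    then show ?thesis using x0 y that by (auto simp: V_def)
  qed
  have "(\<lambda>n. hermF a (p (real (Suc n))) * (1 - \<i> * p (real (Suc n))) powr of_real a) \<longlonglongrightarrow> of_real (Gamma a)"
  proof (rule hermF_asymptotic[OF a])
    show "Im (p (real (Suc n))) \<ge> 0" for n using y by (simp add: p_def)
    show "filterlim (\<lambda>n. norm (p (real (Suc n)))) at_top sequentially"
    proof (rule filterlim_at_top_mono[OF filterlim_real_sequentially])
      show "\<forall>\<^sub>F n in sequentially. real n \<le> norm (p (real (Suc n)))"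
        using y abs_Im_le_cmod[of "p (real (Suc n))" for n]
        by (intro always_eventually allI) (smt (verit) Im_complex_of_real Im_i_times Re_complex_of_real of_nat_Suc p_def plus_complex.simps(2))
    qed
  qed
  then have "Gamma a = 0" using F0 by (simp add: LIMSEQ_const_iff)
  then show False using Gamma_real_pos[OF a] by simp
qed

text \<open>The substitution \<open>u = t\<^sup>2/2\<close> turns the integral into a Gamma integral.\<close>

lemma hermF_0:
  assumes a: "a > 0"
  shows "hermF a 0 = of_real (2 powr (a / 2 - 1) * Gamma (a / 2))"
proof -
  define f where "f u = 2 powr (a / 2 - 1) * (u powr (a / 2 - 1) * exp (- u))" for u :: real
  have eq: "f (x\<^sup>2 / 2) * x = x powr (a - 1) * exp (- x\<^sup>2 / 2)" if "x > 0" for x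
  proof -
    have "2 powr (a / 2 - 1) * (x\<^sup>2 / 2) powr (a / 2 - 1) = (x\<^sup>2) powr (a / 2 - 1)"
      using that by (simp add: powr_divide)
    also have "\<dots> = x powr (a - 2)"
    proof -
      have "x\<^sup>2 = x powr 2" using that by (simp add: powr_numeral)
      then show ?thesis by (simp add: powr_powr)
    qed
    finally have "f (x\<^sup>2 / 2) * x = x powr (a - 2) * x powr 1 * exp (- x\<^sup>2 / 2)"
      using that unfolding f_def by (simp add: mult_ac)
    moreover have "x powr (a - 2) * x powr 1 = x powr (a - 1)" by (simp only: powr_add[symmetric]) simp
    ultimately show ?thesis by (simp only:)
  qed
  have set: "set_lebesgue_integral lborel {0<..} (\<lambda>x. x powr (b - 1) * g x) = (LINT x|lborel. gamma_kernel b x * g x)" for b g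
    unfolding set_lebesgue_integral_def
    by (intro Bochner_Integration.integral_cong) (auto simp: gamma_kernel_def indicator_def)
  have "(LBINT x=0..\<infinity>. f x) = (LBINT x=0..\<infinity>. f (x\<^sup>2 / 2) * x)"
  proof (rule interval_integral_substitution_nonneg(2))
    show "((\<lambda>x. x\<^sup>2 / 2) has_real_derivative x) (at x)" for x :: real
      by (auto intro!: derivative_eq_intros)
    show "isCont f (x\<^sup>2 / 2)" if "0 < ereal x" for x
      unfolding f_def[abs_def] using that by (intro continuous_intros) auto
    show "((ereal \<circ> (\<lambda>x. x\<^sup>2 / 2) \<circ> real_of_ereal) \<longlongrightarrow> 0) (at_right 0)"
      unfolding zero_ereal_def ereal_tendsto_simps by real_asymp
    show "((ereal \<circ> (\<lambda>x. x\<^sup>2 / 2) \<circ> real_of_ereal) \<longlongrightarrow> \<infinity>) (at_left \<infinity>)"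
      unfolding ereal_tendsto_simps by real_asymp
    have "set_integrable lborel (einterval 0 \<infinity>) (\<lambda>x. f (x\<^sup>2 / 2) * x) \<longleftrightarrow> integrable lborel (hermite_kernel a)"
      unfolding set_integrable_def
      by (intro Bochner_Integration.integrable_cong refl) (auto simp: indicator_def einterval_def hermite_kernel_def gamma_kernel_def eq)
    then show "set_integrable lborel (einterval 0 \<infinity>) (\<lambda>x. f (x\<^sup>2 / 2) * x)"
      using integrable_hermite_kernel[OF a, of 0] by (simp add: hermite_kernel_nonneg)
  qed (auto simp: f_def)
  also have "\<dots> = (LINT x|lborel. hermite_kernel a x)"
    unfolding zero_ereal_def interval_integral_to_infinity_eq set_lebesgue_integral_def
    by (intro Bochner_Integration.integral_cong) (auto simp: indicator_def hermite_kernel_def gamma_kernel_def eq)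
  finally have 1: "(LINT x|lborel. hermite_kernel a x) = (LBINT x=0..\<infinity>. f x)" by simp
  have "(LBINT x=0..\<infinity>. f x) = 2 powr (a / 2 - 1) * Gamma (a / 2)"
    unfolding zero_ereal_def interval_integral_to_infinity_eq f_def
    using has_bochner_integral_gamma_kernel[of "a / 2"] a
    by (simp add: set has_bochner_integral_iff)
  moreover have "hermF a 0 = (LINT x|lborel. of_real (hermite_kernel a x))"
    by (simp add: hermF_def laplace_def)
  ultimately show ?thesis using 1 by simp
qed

text \<open>By the recurrence the left side \<open>W\<close> satisfies \<open>W' = - x W\<close>, so it equals \<open>W(0) e\<^bsup>-x\<^sup>2/2\<^esup>\<close>; the value at \<open>0\<close> is a product
\<open>\<Gamma>(a/2) \<Gamma>((a+1)/2)\<close> up to powers of two, evaluated by the duplication formula.\<close>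

lemma hermF_wronskian:
  assumes a: "a > 0"
  shows "Re (hermF (a + 1) (of_real x) * cnj (hermF a (of_real x))) = Gamma a * sqrt (pi / 2) * exp (- x\<^sup>2 / 2)"
proof -
  define W where "W x = Re (hermF (a + 1) (of_real x) * cnj (hermF a (of_real x)))" for x
  have dW: "(W has_real_derivative - x * W x) (at x)" for x
  proof -
    have rec: "hermF (a + 1 + 1) x = \<i> * x * hermF (a + 1) x + of_real a * hermF a x"
      using hermF_recurrence[OF a, of "of_real x"] by (simp add: add.assoc)
    have d: "((\<lambda>x. hermF b (of_real x)) has_vector_derivative \<i> * hermF (b + 1) (of_real x)) (at x)" if "b > 0" for b
      by (rule has_vector_derivative_real_field) (rule hermF_has_field_derivative[OF that])
    have "a + 1 > 0" using a by simp
    note D = has_field_derivative_Re[OF d[OF a]] has_field_derivative_Im[OF d[OF a]]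
      has_field_derivative_Re[OF d[OF this]] has_field_derivative_Im[OF d[OF this]]
    let ?F = "\<lambda>x. hermF a (complex_of_real x)" and ?G = "\<lambda>x. hermF (a + 1) (complex_of_real x)"
    have "(W has_real_derivative (Re (\<i> * hermF (a + 1 + 1) (of_real x)) * Re (?F x) + Re (\<i> * ?G x) * Re (?G x))
       + (Im (\<i> * hermF (a + 1 + 1) (of_real x)) * Im (?F x) + Im (\<i> * ?G x) * Im (?G x))) (at x)"
    proof -
      have "W = (\<lambda>x. Re (?G x) * Re (?F x) + Im (?G x) * Im (?F x))" by (simp add: W_def fun_eq_iff)
      then show ?thesis by (simp only:) (intro DERIV_add DERIV_mult D)
    qed
    moreover have "(Re (\<i> * hermF (a + 1 + 1) (of_real x)) * Re (?F x) + Re (\<i> * ?G x) * Re (?G x))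
       + (Im (\<i> * hermF (a + 1 + 1) (of_real x)) * Im (?F x) + Im (\<i> * ?G x) * Im (?G x)) = - x * W x"
      unfolding rec W_def by (simp add: algebra_simps)
    ultimately show ?thesis by simp
  qed
  have "W x * exp (x\<^sup>2 / 2) = W 0 * exp (0\<^sup>2 / 2)"
  proof (rule DERIV_isconst_all[of "\<lambda>x. W x * exp (x\<^sup>2 / 2)"], rule allI)
    show "((\<lambda>x. W x * exp (x\<^sup>2 / 2)) has_real_derivative 0) (at x)" for x
      by (auto intro!: derivative_eq_intros dW)
  qed
  then have "W x = W 0 * exp (- x\<^sup>2 / 2)" by (simp add: exp_minus field_simps)
  moreover have "W 0 = Gamma a * sqrt (pi / 2)"
  proof -
    have nz: "complex_of_real a / 2 \<notin> \<int>\<^sub>\<le>\<^sub>0" "complex_of_real a / 2 + 1 / 2 \<notin> \<int>\<^sub>\<le>\<^sub>0"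
      using a by (auto elim!: nonpos_Ints_cases simp: complex_eq_iff)
    have "exp ((1 - complex_of_real a) * complex_of_real (ln 2)) = complex_of_real (exp ((1 - a) * ln 2))"
      by (subst exp_of_real[symmetric]) simp
    moreover have "complex_of_real a / 2 + 1 / 2 = of_real ((a + 1) / 2)" "2 * (complex_of_real a / 2) = of_real a"
      "complex_of_real a / 2 = of_real (a / 2)" by (simp_all add: add_divide_distrib)
    ultimately have "complex_of_real (Gamma (a / 2) * Gamma ((a + 1) / 2)) = of_real (exp ((1 - a) * ln 2) * sqrt pi * Gamma a)"
      using Gamma_legendre_duplication[OF nz] by (simp only: Gamma_complex_of_real of_real_mult)
    then have dup: "Gamma (a / 2) * Gamma ((a + 1) / 2) = 2 powr (1 - a) * sqrt pi * Gamma a"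
      by (simp only: of_real_eq_iff) (simp add: powr_def)
    have "W 0 = (2 powr ((a + 1) / 2 - 1) * Gamma ((a + 1) / 2)) * (2 powr (a / 2 - 1) * Gamma (a / 2))"
      using a by (simp add: W_def hermF_0)
    also have "\<dots> = (2 powr ((a + 1) / 2 - 1) * 2 powr (a / 2 - 1) * 2 powr (1 - a)) * sqrt pi * Gamma a"
      using dup by (simp add: mult_ac)
    also have "2 powr ((a + 1) / 2 - 1) * 2 powr (a / 2 - 1) * 2 powr (1 - a) = (2 :: real) powr (- 1 / 2)"
    proof -
      have "(a + 1) / 2 - 1 + (a / 2 - 1) + (1 - a) = - 1 / 2" by (simp add: field_simps)
      then show ?thesis by (simp only: powr_add[symmetric])
    qed
    also have "(2 :: real) powr (- 1 / 2) = inverse (2 powr (1 / 2))" by (subst powr_minus[symmetric]) simp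
    also have "\<dots> = inverse (sqrt 2)" by (simp add: powr_half_sqrt)
    finally have "W 0 = inverse (sqrt 2) * sqrt pi * Gamma a" .
    moreover have "sqrt (pi / 2) = inverse (sqrt 2) * sqrt pi"
      unfolding real_sqrt_divide by (simp only: divide_inverse mult.commute)
    ultimately show ?thesis by (simp only: mult_ac)
  qed
  ultimately show ?thesis by (simp add: W_def)
qed

section \<open>Orthogonality of the associated Hermite polynomials\<close>

lemma continuous_on_hermF: "a > 0 \<Longrightarrow> continuous_on S (hermF a)"
  by (meson DERIV_continuous_on hermF_has_field_derivative)

text \<open>The asymptotics confine \<open>\<bar>F\<^sub>a(z)\<bar> \<bar>1 - iz\<bar>\<^sup>a\<close> near \<open>\<Gamma>(a)\<close> outside a large disc; inside, compactness and the absence of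
zeros do the rest.\<close>

lemma hermF_two_sided_bound:
  assumes a: "a > 0"
  obtains m M where "0 < m" "\<And>z. Im z \<ge> 0 \<Longrightarrow> m \<le> norm (hermF a z) * norm (1 - \<i> * z) powr a"
    "\<And>z. Im z \<ge> 0 \<Longrightarrow> norm (hermF a z) * norm (1 - \<i> * z) powr a \<le> M"
proof -
  define G where "G z = norm (hermF a z) * norm (1 - \<i> * z) powr a" for z
  have G: "G z = norm (hermF a z * (1 - \<i> * z) powr of_real a)" for z
    by (simp add: G_def norm_mult norm_powr_real_powr')
  have Gam: "Gamma a > 0" by (rule Gamma_real_pos[OF a])
  have "\<exists>R. \<forall>z. Im z \<ge> 0 \<longrightarrow> R \<le> norm z \<longrightarrow> Gamma a / 2 < G z \<and> G z < 2 * Gamma a"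
  proof (rule ccontr)
    assume "\<not> ?thesis"
    then have "\<forall>n::nat. \<exists>z. Im z \<ge> 0 \<and> real n \<le> norm z \<and> \<not> (Gamma a / 2 < G z \<and> G z < 2 * Gamma a)"
      by meson
    then obtain z where z: "\<And>n. Im (z n) \<ge> 0" "\<And>n. real n \<le> norm (z n)" "\<And>n. \<not> (Gamma a / 2 < G (z n) \<and> G (z n) < 2 * Gamma a)"
      by metis
    have "filterlim (\<lambda>n. norm (z n)) at_top sequentially"
      by (rule filterlim_at_top_mono[OF filterlim_real_sequentially]) (use z in auto)
    then have "(\<lambda>n. norm (hermF a (z n) * (1 - \<i> * z n) powr of_real a)) \<longlonglongrightarrow> norm (complex_of_real (Gamma a))"
      by (intro tendsto_norm hermF_asymptotic a z)
    then have lim: "(\<lambda>n. G (z n)) \<longlonglongrightarrow> Gamma a" using Gam by (simp add: G)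
    have "\<forall>\<^sub>F n in sequentially. Gamma a / 2 < G (z n)" "\<forall>\<^sub>F n in sequentially. G (z n) < 2 * Gamma a"
      using order_tendstoD(1)[OF lim, of "Gamma a / 2"] order_tendstoD(2)[OF lim, of "2 * Gamma a"] Gam by simp_all
    then have "\<forall>\<^sub>F n in sequentially. False" by eventually_elim (use z in blast)
    then show False by simp
  qed
  then obtain R where R: "\<And>z. Im z \<ge> 0 \<Longrightarrow> R \<le> norm z \<Longrightarrow> Gamma a / 2 < G z \<and> G z < 2 * Gamma a" by blast
  define K where "K = cball 0 \<bar>R\<bar> \<inter> {z. 0 \<le> Im z}"
  have "compact K" unfolding K_def by (intro compact_Int_closed compact_cball closed_halfspace_Im_ge)
  moreover have "0 \<in> K" by (simp add: K_def)
  then have "K \<noteq> {}" by auto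
  moreover have cont: "continuous_on K G"
    unfolding G_def by (intro continuous_intros continuous_on_hermF a) (auto simp: K_def complex_eq_iff)
  ultimately obtain z1 z2 where z1: "z1 \<in> K" "\<And>z. z \<in> K \<Longrightarrow> G z1 \<le> G z" and z2: "z2 \<in> K" "\<And>z. z \<in> K \<Longrightarrow> G z \<le> G z2"
    using continuous_attains_inf[of K G] continuous_attains_sup[of K G] by blast
  have "G z1 > 0"
    using hermF_nonzero[OF a, of z1] z1(1) by (auto simp: G_def K_def complex_eq_iff)
  have inK: "z \<in> K \<or> R \<le> norm z" if "Im z \<ge> 0" for z using that by (auto simp: K_def)
  show thesis
  proof (rule that[of "min (G z1) (Gamma a / 2)" "max (G z2) (2 * Gamma a)"])
    show "0 < min (G z1) (Gamma a / 2)" using \<open>G z1 > 0\<close> Gam by simp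
    fix z assume z: "Im z \<ge> 0"
    show "min (G z1) (Gamma a / 2) \<le> norm (hermF a z) * norm (1 - \<i> * z) powr a"
      using inK[OF z] z1(2)[of z] R[OF z] unfolding G_def[symmetric] by (smt (verit))
    show "norm (hermF a z) * norm (1 - \<i> * z) powr a \<le> max (G z2) (2 * Gamma a)"
      using inK[OF z] z2(2)[of z] R[OF z] unfolding G_def[symmetric] by (smt (verit))
  qed
qed

text \<open>These are the functions of the second kind of the associated Hermite polynomials. The power of \<open>- i\<close> absorbs the factor \<open>i\<close>
in the recurrence of the \<open>F\<^sub>a\<close>, so that the recurrence of the polynomials results.\<close>

definition remainder :: "real \<Rightarrow> nat \<Rightarrow> complex \<Rightarrow> complex" where
  "remainder c n z = (- \<i>) ^ Suc n / of_real c * hermF (c + real n + 1) z / hermF c z"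

lemma remainder_1:
  assumes c: "c > 0" and z: "Im z \<ge> 0"
  shows "remainder c 1 z = z * remainder c 0 z - 1"
proof -
  have "hermF (c + 2) z = \<i> * z * hermF (c + 1) z + of_real c * hermF c z" by (rule hermF_recurrence[OF c])
  then show ?thesis using hermF_nonzero[OF c z] c by (simp add: remainder_def field_simps)
qed

lemma remainder_Suc_Suc:
  assumes c: "c > 0" and z: "Im z \<ge> 0"
  shows "remainder c (Suc (Suc n)) z = z * remainder c (Suc n) z - of_real (real (Suc n) + c) * remainder c n z"
proof -
  have "hermF (c + real n + 1 + 2) z = \<i> * z * hermF (c + real n + 1 + 1) z + of_real (c + real n + 1) * hermF (c + real n + 1) z"
    by (rule hermF_recurrence) (use c in linarith)
  moreover have "c + real n + 1 + 2 = c + real (Suc (Suc n)) + 1" "c + real n + 1 + 1 = c + real (Suc n) + 1" by auto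
  ultimately have rec: "hermF (c + real (Suc (Suc n)) + 1) z = \<i> * z * hermF (c + real (Suc n) + 1) z + of_real (c + real n + 1) * hermF (c + real n + 1) z"
    by (simp only:)
  show ?thesis
    unfolding remainder_def rec using hermF_nonzero[OF c z] c by (simp add: field_simps)
qed

lemma remainder_bound:
  assumes c: "c > 0"
  obtains C where "C \<ge> 0" "\<And>z. Im z \<ge> 0 \<Longrightarrow> norm (remainder c n z) \<le> C / norm (1 - \<i> * z) ^ Suc n"
proof -
  obtain m where m: "0 < m" "\<And>z. Im z \<ge> 0 \<Longrightarrow> m \<le> norm (hermF c z) * norm (1 - \<i> * z) powr c"
    using hermF_two_sided_bound[OF c] by metis
  have "c + real n + 1 > 0" using c by simp
  from hermF_two_sided_bound[OF this] obtain m' M where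
    M: "\<And>z. Im z \<ge> 0 \<Longrightarrow> norm (hermF (c + real n + 1) z) * norm (1 - \<i> * z) powr (c + real n + 1) \<le> M"
    by metis
  show thesis
  proof (rule that[of "\<bar>M\<bar> / (m * c)"])
    fix z :: complex assume z: "Im z \<ge> 0"
    let ?s = "norm (1 - \<i> * z)"
    have s: "?s > 0" using z by (auto simp: complex_eq_iff)
    have F: "norm (hermF c z) > 0" using hermF_nonzero[OF c z] by simp
    have p: "?s powr (c + real n + 1) = ?s powr c * ?s ^ Suc n"
      using s by (simp only: powr_add powr_realpow[symmetric] of_nat_Suc) (simp add: powr_add)
    have "norm (remainder c n z) = norm (hermF (c + real n + 1) z) / (c * norm (hermF c z))"
      using c by (simp add: remainder_def norm_mult norm_divide norm_power)
    also have "\<dots> = (norm (hermF (c + real n + 1) z) * ?s powr (c + real n + 1)) / ((norm (hermF c z) * ?s powr c) * c) / ?s ^ Suc n"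
      unfolding p using s F c by (simp add: field_simps)
    also have "\<dots> \<le> \<bar>M\<bar> / (m * c) / ?s ^ Suc n"
      using M[OF z] m(1) m(2)[OF z] c s F
      by (intro divide_right_mono frac_le mult_right_mono) (auto intro!: mult_nonneg_nonneg)
    finally show "norm (remainder c n z) \<le> \<bar>M\<bar> / (m * c) / ?s ^ Suc n" .
  qed (use m c in auto)
qed

lemma norm_one_minus_i_times:
  assumes "Im z \<ge> 0"
  shows "norm (1 - \<i> * z) \<ge> 1" "norm (1 - \<i> * z) \<ge> norm z"
proof -
  have "(norm (1 - \<i> * z))\<^sup>2 = 1 + 2 * Im z + (norm z)\<^sup>2"
    by (simp only: cmod_power2) (simp add: power2_eq_square algebra_simps)
  then have "1\<^sup>2 \<le> (norm (1 - \<i> * z))\<^sup>2" "(norm z)\<^sup>2 \<le> (norm (1 - \<i> * z))\<^sup>2" using assms by simp_all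
  then show "norm (1 - \<i> * z) \<ge> 1" "norm (1 - \<i> * z) \<ge> norm z"
    using power2_le_imp_le[of 1 "norm (1 - \<i> * z)"] power2_le_imp_le[of "norm z" "norm (1 - \<i> * z)"] by simp_all
qed

text \<open>For \<open>n \<ge> 1\<close> this is the decay of order \<open>n + 1 \<ge> 2\<close>; for \<open>n = 0\<close> the relation \<open>z r\<^sub>0 - 1 = r\<^sub>1\<close> exhibits the leading
term \<open>1/z\<close>, with the error \<open>r\<^sub>1/z\<close>.\<close>

lemma remainder_asymptotic:
  assumes c: "c > 0"
  obtains C where "\<And>z. Im z \<ge> 0 \<Longrightarrow> z \<noteq> 0 \<Longrightarrow>
    norm (remainder c n z - (if n = 0 then 1 else 0) / z) \<le> C / (norm z)\<^sup>2"
proof -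
  obtain C where C: "C \<ge> 0" "\<And>z. Im z \<ge> 0 \<Longrightarrow> norm (remainder c (max n 1) z) \<le> C / norm (1 - \<i> * z) ^ Suc (max n 1)"
    using remainder_bound[OF c] by metis
  have bound: "norm (remainder c (max n 1) z) \<le> C / norm (1 - \<i> * z) ^ 2" if "Im z \<ge> 0" for z
  proof -
    have "norm (1 - \<i> * z) > 0" using norm_one_minus_i_times(1)[OF that] by linarith
    then show ?thesis using norm_one_minus_i_times(1)[OF that] C(1)
      by (intro order.trans[OF C(2)[OF that]] divide_left_mono power_increasing mult_pos_pos zero_less_power) auto
  qed
  show thesis
  proof (rule that[of C])
    fix z :: complex assume z: "Im z \<ge> 0" "z \<noteq> 0"
    note s = norm_one_minus_i_times[OF z(1)]
    have nz: "norm z > 0" using z by simp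
    show "norm (remainder c n z - (if n = 0 then 1 else 0) / z) \<le> C / (norm z)\<^sup>2"
    proof (cases "n = 0")
      case False
      have "C / norm (1 - \<i> * z) ^ 2 \<le> C / (norm z)\<^sup>2"
        using s nz C(1) by (intro divide_left_mono power_mono mult_pos_pos zero_less_power) auto
      moreover have "max n 1 = n" using False by simp
      ultimately show ?thesis using bound[OF z(1)] False by simp
    next
      case True
      have "remainder c n z - 1 / z = remainder c 1 z / z"
        using z by (simp add: remainder_1[OF c z(1), simplified] True diff_divide_distrib)
      then have "norm (remainder c n z - 1 / z) = norm (remainder c 1 z) / norm z" by (simp add: norm_divide)
      also have "\<dots> \<le> C / norm (1 - \<i> * z) ^ 2 / norm z"
        using bound[OF z(1)] True by (intro divide_right_mono) auto
      also have "\<dots> \<le> C / norm z / norm z"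
      proof (intro divide_right_mono divide_left_mono mult_pos_pos zero_less_power nz)
        have "norm z \<le> norm (1 - \<i> * z) * 1" using s by simp
        also have "\<dots> \<le> norm (1 - \<i> * z) * norm (1 - \<i> * z)" using s by (intro mult_left_mono) auto
        finally show "norm z \<le> norm (1 - \<i> * z) ^ 2" by (simp add: power2_eq_square)
      qed (use s C in auto)
      finally show ?thesis using True by (simp add: power2_eq_square)
    qed
  qed
qed

text \<open>By Cauchy's theorem the integral over the diameter is minus the integral over the half circle, on which \<open>\<kappa>/z\<close> contributes
\<open>i \<pi> \<kappa>\<close> and the error at most \<open>\<pi> C / R\<close>.\<close>

lemma half_disc_integral:
  fixes f :: "complex \<Rightarrow> complex"
  assumes hol: "f holomorphic_on {z. 0 \<le> Im z}"
    and bound: "\<And>z. 0 \<le> Im z \<Longrightarrow> z \<noteq> 0 \<Longrightarrow> norm (f z - \<kappa> / z) \<le> C / (norm z)\<^sup>2"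
  shows "((\<lambda>R. integral {-R..R} (\<lambda>x. f (of_real x))) \<longlongrightarrow> - \<i> * of_real pi * \<kappa>) at_top"
proof -
  let ?S = "{z. 0 \<le> Im z}"
  have cont: "continuous_on ?S f" by (rule holomorphic_on_imp_continuous_on[OF hol])
  have est: "norm (integral {-R..R} (\<lambda>x. f (of_real x)) - - \<i> * of_real pi * \<kappa>) \<le> C / R * pi" if R: "R > 0" for R
  proof -
    let ?l = "linepath (- of_real R) (complex_of_real R)" and ?p = "part_circlepath 0 R 0 pi"
    have il: "path_image ?l \<subseteq> ?S"
      by (auto simp: closed_segment_def)
    have ip: "path_image ?p \<subseteq> ?S"
      using R by (auto simp: path_image_part_circlepath Im_exp intro!: mult_nonneg_nonneg sin_ge_zero)
    have join: "pathfinish ?l = pathstart ?p" by simp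
    have "(f has_contour_integral 0) (?l +++ ?p)"
      by (rule Cauchy_theorem_convex_simple[OF hol])
        (use il ip in \<open>auto simp: convex_halfspace_Im_ge path_image_join intro!: valid_path_join\<close>)
    moreover have intl: "f contour_integrable_on ?l"
      by (rule contour_integrable_continuous_linepath) (use il cont in \<open>auto intro: continuous_on_subset\<close>)
    have conta: "continuous_on {0..pi} (\<lambda>t. f (of_real R * cis t))"
      by (rule continuous_on_compose2[OF cont])
        (use R in \<open>auto intro!: continuous_intros mult_nonneg_nonneg sin_ge_zero\<close>)
    have intc: "(\<lambda>t. f (0 + of_real R * cis t) * of_real R * \<i> * cis t) integrable_on {0..pi}"
      by (intro integrable_continuous_real continuous_intros) (use conta in simp)
    then have intp: "f contour_integrable_on ?p" by (subst contour_integrable_part_circlepath_iff) auto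
    ultimately have "contour_integral ?l f + contour_integral ?p f = 0"
      using contour_integral_join[OF intl intp] contour_integral_unique by fastforce
    moreover have "contour_integral ?l f = integral {-R..R} (\<lambda>x. f (of_real x))"
      using R by (subst contour_integral_linepath_Reals_eq) auto
    moreover have "contour_integral ?p f = integral {0..pi} (\<lambda>t. f (of_real R * cis t) * of_real R * \<i> * cis t)"
      by (subst contour_integral_part_circlepath_eq) auto
    moreover have "integral {0..pi} (\<lambda>t. f (of_real R * cis t) * of_real R * \<i> * cis t) - \<i> * of_real pi * \<kappa>
      = integral {0..pi} (\<lambda>t. f (of_real R * cis t) * of_real R * \<i> * cis t - \<i> * \<kappa>)"
      using intc by (subst Henstock_Kurzweil_Integration.integral_diff) (auto simp: scaleR_conv_of_real)
    moreover have "norm (integral {0..pi} (\<lambda>t. f (of_real R * cis t) * of_real R * \<i> * cis t - \<i> * \<kappa>)) \<le> C / R * (pi - 0)"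
    proof (rule integral_bound)
      show "continuous_on {0..pi} (\<lambda>t. f (of_real R * cis t) * of_real R * \<i> * cis t - \<i> * \<kappa>)"
        by (intro continuous_intros conta)
      fix t assume t: "t \<in> {0..pi}"
      let ?z = "of_real R * cis t"
      have z: "?z \<noteq> 0" "Im ?z \<ge> 0" "norm ?z = R"
        using t R by (auto simp: norm_mult intro!: mult_nonneg_nonneg sin_ge_zero)
      have "f ?z * of_real R * \<i> * cis t - \<i> * \<kappa> = (f ?z - \<kappa> / ?z) * (\<i> * ?z)"
        using z by (simp add: field_simps)
      then have "norm (f ?z * of_real R * \<i> * cis t - \<i> * \<kappa>) = norm (f ?z - \<kappa> / ?z) * R"
        using z R by (simp only: norm_mult) simp
      also have "\<dots> \<le> C / R\<^sup>2 * R" using bound[OF z(2,1)] R unfolding z(3) by (intro mult_right_mono) auto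
      finally show "norm (f ?z * of_real R * \<i> * cis t - \<i> * \<kappa>) \<le> C / R" using R by (simp add: power2_eq_square)
    qed simp
    ultimately show ?thesis
      by (smt (verit, best) add_eq_0_iff diff_zero minus_diff_commute minus_mult_left minus_mult_minus norm_minus_commute diff_minus_eq_add)
  qed
  have "((\<lambda>R. integral {-R..R} (\<lambda>x. f (of_real x)) - - \<i> * of_real pi * \<kappa>) \<longlongrightarrow> 0) at_top"
  proof (rule Lim_null_comparison)
    show "\<forall>\<^sub>F R in at_top. norm (integral {-R..R} (\<lambda>x. f (of_real x)) - - \<i> * of_real pi * \<kappa>) \<le> C / R * pi"
      using eventually_gt_at_top[of 0] by eventually_elim (rule est)
    show "((\<lambda>R. C / R * pi) \<longlongrightarrow> 0) at_top" by real_asymp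
  qed
  then show ?thesis by (subst (asm) LIM_zero_iff)
qed

definition nu_density :: "real \<Rightarrow> real \<Rightarrow> real" where
  "nu_density c x = exp (- x\<^sup>2 / 2) / (sqrt (2 * pi) * (cmod (f_hat c x))\<^sup>2)"

lemma nu_density_nonneg: "nu_density c x \<ge> 0"
  by (simp add: nu_density_def)

lemma f_hat_eq: "f_hat c x = of_real (sqrt (c / Gamma c)) * hermF c (of_real x)"
  unfolding f_hat_def hermF_def laplace_def set_lebesgue_integral_def
  by (intro arg_cong2[where f = "(*)"] refl Bochner_Integration.integral_cong)
     (auto simp: hermite_kernel_def gamma_kernel_def indicator_def mult_ac)

text \<open>The imaginary part of \<open>r\<^sub>0 = - i F\<^bsub>c+1\<^esub> / (c F\<^sub>c)\<close> is \<open>- Re (F\<^bsub>c+1\<^esub> * cnj F\<^sub>c) / (c \<bar>F\<^sub>c\<bar>\<^sup>2)\<close>, and the Wronskian identity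
evaluates the numerator.\<close>

lemma nu_density_eq:
  assumes c: "c > 0"
  shows "nu_density c x = - Im (remainder c 0 (of_real x)) / pi"
proof -
  let ?F = "hermF c (of_real x)" and ?G = "hermF (c + 1) (of_real x)"
  have F: "norm ?F > 0" using hermF_nonzero[OF c, of "of_real x"] by simp
  have Gam: "Gamma c > 0" by (rule Gamma_real_pos[OF c])
  have "remainder c 0 (of_real x) = - (\<i> * (?G / ?F)) / of_real c"
    by (simp add: remainder_def)
  then have "Im (remainder c 0 (of_real x)) = - Re (?G / ?F) / c"
  proof -
    have "Im (- (\<i> * q) / of_real c) = - Re q / c" for q by (simp add: Im_divide_of_real)
    then show ?thesis using \<open>remainder c 0 (of_real x) = _\<close> by (simp only:)
  qed
  also have "Re (?G / ?F) = Re (?G * cnj ?F) / (norm ?F)\<^sup>2"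
    by (simp add: Re_divide cmod_power2)
  also have "\<dots> = Gamma c * sqrt (pi / 2) * exp (- x\<^sup>2 / 2) / (norm ?F)\<^sup>2"
    using hermF_wronskian[OF c] by simp
  finally have 1: "- Im (remainder c 0 (of_real x)) / pi = Gamma c * (sqrt (pi / 2) / pi) * exp (- x\<^sup>2 / 2) / (c * (norm ?F)\<^sup>2)"
    by (simp add: field_simps)
  have 2: "sqrt (pi / 2) / pi = 1 / sqrt (2 * pi)"
    by (simp add: real_sqrt_divide real_sqrt_mult field_simps)
  have fh: "(cmod (f_hat c x))\<^sup>2 = c / Gamma c * (norm ?F)\<^sup>2"
    using c Gam by (simp add: f_hat_eq norm_mult power_mult_distrib)
  then show ?thesis unfolding 1 2 nu_density_def fh using F c Gam by (simp add: field_simps)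
qed

text \<open>Both sides satisfy the same three-term recurrence with real coefficients. The inhomogeneity \<open>- 1\<close> in \<open>r\<^sub>1 = z r\<^sub>0 - 1\<close> is
real, so it disappears from the imaginary part.\<close>

lemma poly_hermite_nu_density:
  assumes c: "c > 0"
  shows "poly (assoc_hermite c n) x * nu_density c x = - Im (remainder c n (of_real x)) / pi"
proof (induction n rule: induct_nat_012)
  case 0
  show ?case using nu_density_eq[OF c] by simp
next
  case 1
  show ?case using nu_density_eq[OF c, of x] remainder_1[OF c, of "of_real x"] by simp
next
  case (ge2 n)
  have "poly (assoc_hermite c (Suc (Suc n))) x * nu_density c x = x * (poly (assoc_hermite c (Suc n)) x * nu_density c x) - (real (Suc n) + c) * (poly (assoc_hermite c n) x * nu_density c x)"
    by (simp add: algebra_simps)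
  also have "\<dots> = - Im (remainder c (Suc (Suc n)) (of_real x)) / pi"
    unfolding ge2 by (simp add: remainder_Suc_Suc[OF c] field_simps)
  finally show ?case .
qed

lemma poly_growth:
  fixes p :: "real poly"
  obtains C d where "C \<ge> 0" "\<And>x. \<bar>poly p x\<bar> \<le> C * (1 + \<bar>x\<bar>) ^ d"
proof -
  have "\<exists>C d. C \<ge> 0 \<and> (\<forall>x. \<bar>poly p x\<bar> \<le> C * (1 + \<bar>x\<bar>) ^ d)"
  proof (induction p)
    case (pCons a p)
    then obtain C d where C: "C \<ge> 0" "\<And>x. \<bar>poly p x\<bar> \<le> C * (1 + \<bar>x\<bar>) ^ d" by blast
    have "\<bar>poly (pCons a p) x\<bar> \<le> (\<bar>a\<bar> + C) * (1 + \<bar>x\<bar>) ^ Suc d" for x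
    proof -
      have "\<bar>poly (pCons a p) x\<bar> \<le> \<bar>a\<bar> * 1 + \<bar>x\<bar> * \<bar>poly p x\<bar>"
        using abs_triangle_ineq[of a "x * poly p x"] by (simp add: abs_mult)
      also have "\<dots> \<le> \<bar>a\<bar> * (1 + \<bar>x\<bar>) ^ Suc d + (1 + \<bar>x\<bar>) * (C * (1 + \<bar>x\<bar>) ^ d)"
        using C by (intro add_mono mult_mono one_le_power mult_left_mono) auto
      finally show ?thesis by (simp add: algebra_simps)
    qed
    then show ?case using C(1) by (intro exI[of _ "\<bar>a\<bar> + C"] exI[of _ "Suc d"]) auto
  qed (auto intro: exI[of _ 0])
  then show thesis using that by blast
qed

lemma measurable_nu_density:
  assumes c: "c > 0"
  shows "nu_density c \<in> borel_measurable borel"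
proof -
  have "continuous_on UNIV (\<lambda>x. hermF c (complex_of_real x))"
    by (intro continuous_on_compose2[OF continuous_on_hermF[OF c, of UNIV]] continuous_intros) auto
  then have [measurable]: "(\<lambda>x. hermF c (complex_of_real x)) \<in> borel_measurable borel"
    by (rule borel_measurable_continuous_onI)
  show ?thesis unfolding nu_density_def f_hat_eq by measurable
qed

text \<open>The lower bound on \<open>\<bar>F\<^sub>c\<bar>\<close> costs only a polynomial factor against the Gaussian \<open>e\<^bsup>-x\<^sup>2/2\<^esup>\<close>.\<close>

lemma integrable_poly_nu_density:
  assumes c: "c > 0"
  shows "integrable lborel (\<lambda>x. poly p x * nu_density c x)"
proof -
  obtain m where m: "0 < m" "\<And>z. Im z \<ge> 0 \<Longrightarrow> m \<le> norm (hermF c z) * norm (1 - \<i> * z) powr c"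
    using hermF_two_sided_bound[OF c] by metis
  obtain C d where C: "C \<ge> 0" "\<And>x. \<bar>poly p x\<bar> \<le> C * (1 + \<bar>x\<bar>) ^ d" using poly_growth by metis
  define k where "k = nat \<lceil>c\<rceil>"
  have Gam: "Gamma c > 0" by (rule Gamma_real_pos[OF c])
  have dens: "nu_density c x \<le> Gamma c / (c * m\<^sup>2) * (std_normal_density x * (1 + \<bar>x\<bar>) ^ (2 * k))" for x
  proof -
    let ?F = "norm (hermF c (of_real x))" and ?s = "norm (1 - \<i> * complex_of_real x)"
    have "?F > 0" using hermF_nonzero[OF c, of "of_real x"] by simp
    have s1: "?s \<ge> 1" using norm_one_minus_i_times(1)[of "of_real x"] by simp
    have s: "?s \<le> 1 + \<bar>x\<bar>" using norm_triangle_ineq4[of 1 "\<i> * complex_of_real x"] by (simp add: norm_mult)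
    have "?s powr c \<le> (1 + \<bar>x\<bar>) powr c" using s c by (intro powr_mono2) auto
    also have "\<dots> \<le> (1 + \<bar>x\<bar>) powr real k" by (intro powr_mono) (auto simp: k_def real_nat_ceiling_ge)
    also have "\<dots> = (1 + \<bar>x\<bar>) ^ k" by (intro powr_realpow) auto
    finally have "?F * ?s powr c \<le> ?F * (1 + \<bar>x\<bar>) ^ k" by (intro mult_left_mono) auto
    then have "m \<le> ?F * (1 + \<bar>x\<bar>) ^ k" using m(2)[of "of_real x"] by simp
    then have "m\<^sup>2 \<le> (?F * (1 + \<bar>x\<bar>) ^ k)\<^sup>2" using m(1) by (intro power_mono) auto
    also have "\<dots> = ?F\<^sup>2 * (1 + \<bar>x\<bar>) ^ (2 * k)" by (simp add: power_mult_distrib power_even_eq)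
    finally have "1 / ?F\<^sup>2 \<le> (1 + \<bar>x\<bar>) ^ (2 * k) / m\<^sup>2" using m(1) \<open>?F > 0\<close> by (simp add: field_simps)
    then have "Gamma c / c * std_normal_density x * (1 / ?F\<^sup>2) \<le> Gamma c / c * std_normal_density x * ((1 + \<bar>x\<bar>) ^ (2 * k) / m\<^sup>2)"
      using Gam c by (intro mult_left_mono) auto
    moreover have "nu_density c x = Gamma c / c * std_normal_density x * (1 / ?F\<^sup>2)"
      using c Gam by (simp add: nu_density_def f_hat_eq norm_mult power_mult_distrib std_normal_density_def field_simps)
    ultimately show ?thesis by (simp add: field_simps)
  qed
  have [measurable]: "nu_density c \<in> borel_measurable borel" by (rule measurable_nu_density[OF c])
  show ?thesis
  proof (rule Bochner_Integration.integrable_bound)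
    show "integrable lborel (\<lambda>x. C * (Gamma c / (c * m\<^sup>2)) * (std_normal_density x * (1 + \<bar>x\<bar>) ^ (d + 2 * k)))"
      by (intro integrable_mult_right integrable_std_normal_poly)
    show "(\<lambda>x. poly p x * nu_density c x) \<in> borel_measurable lborel"
      by (simp add: measurable_lborel2) (intro borel_measurable_times borel_measurable_continuous_onI continuous_intros measurable_nu_density c)
    show "AE x in lborel. norm (poly p x * nu_density c x) \<le> norm (C * (Gamma c / (c * m\<^sup>2)) * (std_normal_density x * (1 + \<bar>x\<bar>) ^ (d + 2 * k)))"
    proof (intro AE_I2)
      fix x :: real
      have "norm (poly p x * nu_density c x) = \<bar>poly p x\<bar> * nu_density c x"
        by (simp add: abs_mult nu_density_nonneg)
      also have "\<dots> \<le> (C * (1 + \<bar>x\<bar>) ^ d) * (Gamma c / (c * m\<^sup>2) * (std_normal_density x * (1 + \<bar>x\<bar>) ^ (2 * k)))"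
        using C by (intro mult_mono dens) (auto simp: nu_density_nonneg)
      also have "\<dots> = C * (Gamma c / (c * m\<^sup>2)) * (std_normal_density x * (1 + \<bar>x\<bar>) ^ (d + 2 * k))"
        by (simp add: power_add mult_ac)
      also have "\<dots> \<le> norm (C * (Gamma c / (c * m\<^sup>2)) * (std_normal_density x * (1 + \<bar>x\<bar>) ^ (d + 2 * k)))"
        by (simp only: real_norm_def abs_ge_self)
      finally show "norm (poly p x * nu_density c x) \<le> norm (C * (Gamma c / (c * m\<^sup>2)) * (std_normal_density x * (1 + \<bar>x\<bar>) ^ (d + 2 * k)))" .
    qed
  qed
qed

lemma remainder_holomorphic:
  assumes c: "c > 0"
  shows "remainder c n holomorphic_on {z. 0 \<le> Im z}"
proof -
  have "hermF b holomorphic_on S" if "b > 0" for b S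
    using hermF_has_field_derivative[OF that] by (auto simp: holomorphic_on_def field_differentiable_def)
  then show ?thesis
    unfolding remainder_def[abs_def] using c hermF_nonzero[OF c] by (intro holomorphic_intros) auto
qed

lemma integral_hermite_nu_density:
  assumes c: "c > 0"
  shows "(LINT x|lborel. poly (assoc_hermite c n) x * nu_density c x) = (if n = 0 then 1 else 0)"
proof -
  let ?f = "\<lambda>x. poly (assoc_hermite c n) x * nu_density c x"
  let ?r = "\<lambda>x. remainder c n (complex_of_real x)"
  define \<kappa> :: complex where "\<kappa> = (if n = 0 then 1 else 0)"
  obtain C where C: "\<And>z. Im z \<ge> 0 \<Longrightarrow> z \<noteq> 0 \<Longrightarrow> norm (remainder c n z - \<kappa> / z) \<le> C / (norm z)\<^sup>2"
    using remainder_asymptotic[OF c, of n] unfolding \<kappa>_def by metis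
  have int: "integrable lborel ?f" by (rule integrable_poly_nu_density[OF c])
  have cont: "continuous_on S ?r" for S
    by (rule continuous_on_compose2[OF holomorphic_on_imp_continuous_on[OF remainder_holomorphic[OF c]]])
      (auto intro!: continuous_intros)
  have "((\<lambda>R. integral {-R..R} ?r) \<longlongrightarrow> - \<i> * of_real pi * \<kappa>) at_top"
    by (rule half_disc_integral[OF remainder_holomorphic[OF c] C]) auto
  then have "((\<lambda>R. - Im (integral {-R..R} ?r) / pi) \<longlongrightarrow> - Im (- \<i> * of_real pi * \<kappa>) / pi) at_top"
    by (intro tendsto_intros) auto
  also have "- Im (- \<i> * of_real pi * \<kappa>) / pi = (if n = 0 then 1 else 0)" by (simp add: \<kappa>_def)
  also have "(\<lambda>R. - Im (integral {-R..R} ?r) / pi) = (\<lambda>R. LINT x|lborel. indicator {-R..R} x *\<^sub>R ?f x)"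
  proof
    fix R
    have "Im (integral {-R..R} ?r) = integral {-R..R} (Im \<circ> ?r)"
      by (intro integral_linear[symmetric] bounded_linear_Im integrable_continuous_real cont)
    moreover have "integral {-R..R} ?f = integral {-R..R} (\<lambda>x. (- 1 / pi) * (Im \<circ> ?r) x)"
      by (simp add: poly_hermite_nu_density[OF c])
    moreover have "\<dots> = (- 1 / pi) * integral {-R..R} (Im \<circ> ?r)"
      by (rule integral_mult_right)
    moreover have "set_integrable lborel {-R..R} ?f"
      unfolding set_integrable_def by (rule integrable_mult_indicator[OF _ int]) simp
    then have "(LINT x:{-R..R}|lborel. ?f x) = integral {-R..R} ?f"
      by (rule set_borel_integral_eq_integral)
    ultimately show "- Im (integral {-R..R} ?r) / pi = (LINT x|lborel. indicator {-R..R} x *\<^sub>R ?f x)"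
      unfolding set_lebesgue_integral_def by simp
  qed
  finally have "((\<lambda>R. LINT x|lborel. indicator {-R..R} x *\<^sub>R ?f x) \<longlongrightarrow> (if n = 0 then 1 else 0)) at_top" .
  moreover have "((\<lambda>R. LINT x|lborel. indicator {-R..R} x *\<^sub>R ?f x) \<longlongrightarrow> (LINT x|lborel. ?f x)) at_top"
  proof (rule integral_dominated_convergence_at_top)
    show "integrable lborel (\<lambda>x. norm (?f x))" using int by simp
    show "AE x in lborel. ((\<lambda>R. indicator {-R..R} x *\<^sub>R ?f x) \<longlongrightarrow> ?f x) at_top"
    proof (intro AE_I2)
      fix x :: real
      have "\<forall>\<^sub>F R in at_top. indicator {-R..R} x *\<^sub>R ?f x = ?f x"
        using eventually_ge_at_top[of "\<bar>x\<bar>"] by eventually_elim (auto simp: indicator_def)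
      then show "((\<lambda>R. indicator {-R..R} x *\<^sub>R ?f x) \<longlongrightarrow> ?f x) at_top" by (rule tendsto_eventually)
    qed
    show "\<forall>\<^sub>F R in at_top. AE x in lborel. norm (indicator {-R..R} x *\<^sub>R ?f x) \<le> norm (?f x)"
      by (auto simp: indicator_def)
  qed (use int in \<open>auto simp: integrable_iff_bounded\<close>)
  ultimately show ?thesis by (rule tendsto_unique[OF trivial_limit_at_top_linorder, rotated])
qed

lemma nu_eq: "nu c = density lborel (\<lambda>x. ennreal (nu_density c x))"
  by (simp add: nu_def nu_density_def)

lemma sets_nu [simp, measurable_cong]: "sets (nu c) = sets borel"
  by (simp add: nu_eq)

lemma measurable_poly: "poly (p :: real poly) \<in> borel_measurable borel"
  by (intro borel_measurable_continuous_onI continuous_intros)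

lemma integrable_poly_nu:
  assumes c: "c > 0"
  shows "integrable (nu c) (poly p)"
  unfolding nu_eq using measurable_nu_density[OF c] measurable_poly[of p] integrable_poly_nu_density[OF c, of p]
  by (subst integrable_density) (auto simp: nu_density_nonneg mult.commute)

lemma integral_poly_nu:
  assumes c: "c > 0"
  shows "(LINT x|nu c. poly p x) = (LINT x|lborel. poly p x * nu_density c x)"
  unfolding nu_eq using measurable_nu_density[OF c] measurable_poly[of p]
  by (subst integral_density) (auto simp: nu_density_nonneg mult.commute)

lemma integral_assoc_hermite_nu:
  assumes c: "c > 0"
  shows "(LINT x|nu c. poly (assoc_hermite c n) x) = (if n = 0 then 1 else 0)"
  using integral_hermite_nu_density[OF c] integral_poly_nu[OF c] by simp

section \<open>Algebra of the associated Hermite polynomials\<close>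

text \<open>The operator \<open>Q\<close> with \<open>(Q f)(x) = L\<^sub>y((f(x) - f(y)) / (x - y))\<close>, where \<open>L\<^sub>y\<close> acts on polynomials in \<open>y\<close>. The identity
\<open>x f(x) - y f(y) = x (f(x) - f(y)) + (x - y) f(y)\<close> gives a recursion along the coefficients, which avoids polynomials in two
variables.\<close>

primrec divided_difference_coeffs :: "(real poly \<Rightarrow> real) \<Rightarrow> real list \<Rightarrow> real poly" where
  "divided_difference_coeffs L [] = 0"
| "divided_difference_coeffs L (a # as) = pCons 0 (divided_difference_coeffs L as) + [:L (Poly as):]"

definition divided_difference :: "(real poly \<Rightarrow> real) \<Rightarrow> real poly \<Rightarrow> real poly" where
  "divided_difference L f = divided_difference_coeffs L (coeffs f)"

lemma degree_assoc_hermite: "degree (assoc_hermite c n) = n"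
  and lead_coeff_assoc_hermite: "coeff (assoc_hermite c n) n = 1"
proof -
  have "degree (assoc_hermite c n) = n \<and> coeff (assoc_hermite c n) n = 1"
  proof (induction n rule: induct_nat_012)
    case (ge2 n)
    have nz: "assoc_hermite c (Suc n) \<noteq> 0" using ge2 by auto
    have 1: "degree ([:0, 1:] * assoc_hermite c (Suc n)) = Suc (Suc n)" using ge2 nz by simp
    have 2: "degree (smult (real (Suc n) + c) (assoc_hermite c n)) < Suc (Suc n)"
      using degree_smult_le[of "real (Suc n) + c" "assoc_hermite c n"] ge2 by (auto simp del: degree_smult_eq)
    have "degree (assoc_hermite c (Suc (Suc n))) = Suc (Suc n)"
      using degree_add_eq_left[of "- smult (real (Suc n) + c) (assoc_hermite c n)" "[:0, 1:] * assoc_hermite c (Suc n)"] 1 2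
      by (simp del: degree_smult_eq mult_pCons_left)
    moreover have "coeff (assoc_hermite c n) (Suc (Suc n)) = 0" using ge2 by (intro coeff_eq_0) auto
    ultimately show ?case using ge2 by simp
  qed auto
  then show "degree (assoc_hermite c n) = n" "coeff (assoc_hermite c n) n = 1" by auto
qed

text \<open>The moment functional of \<open>\<nu>\<^sub>c\<close>, reduced to the values that determine it: the \<open>p\<^sub>n\<close> are a basis of the polynomials.\<close>

locale hermite_functional =
  fixes c :: real and L :: "real poly \<Rightarrow> real"
  assumes c_pos: "c > 0"
    and L_add: "L (f + g) = L f + L g"
    and L_smult: "L (smult a f) = a * L f"
    and L_hermite: "L (assoc_hermite c n) = (if n = 0 then 1 else 0)"
begin

abbreviation "p \<equiv> assoc_hermite c"
abbreviation "Q \<equiv> divided_difference L"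

lemma L_0 [simp]: "L 0 = 0"
  using L_smult[of 0 0] by simp

lemma L_diff: "L (f - g) = L f - L g"
  using L_add[of f "- g"] L_smult[of "-1" g] by simp

lemma L_sum: "L (\<Sum>i\<in>A. f i) = (\<Sum>i\<in>A. L (f i))"
  by (induction A rule: infinite_finite_induct) (auto simp: L_add)

lemma L_const: "L [:a:] = a"
  using L_smult[of a 1] L_hermite[of 0] by simp

lemma Q_pCons: "Q (pCons a f) = pCons 0 (Q f) + [:L f:]"
  by (auto simp: divided_difference_def coeffs_pCons_eq_cCons cCons_def)

lemma Q_0 [simp]: "Q 0 = 0"
  by (simp add: divided_difference_def)

lemma Q_add: "Q (f + g) = Q f + Q g"
  by (induction f g rule: poly_induct2) (simp_all add: Q_pCons L_add)

lemma Q_smult: "Q (smult a f) = smult a (Q f)"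
  by (induction f) (simp_all add: Q_pCons L_smult smult_add_right)

lemma Q_diff: "Q (f - g) = Q f - Q g"
  using Q_add[of f "- g"] Q_smult[of "-1" g] by simp

lemma Q_X: "Q ([:0, 1:] * f) = [:0, 1:] * Q f + [:L f:]"
  by (simp add: Q_pCons)

lemma Q_monom: "Q (monom 1 k) = (\<Sum>a<k. monom (L (monom 1 (k - 1 - a))) a)"
proof (induction k)
  case 0
  then show ?case using Q_pCons[of 1 0] by (simp add: monom_0)
next
  case (Suc k)
  have "Q (monom 1 (Suc k)) = pCons 0 (Q (monom 1 k)) + [:L (monom 1 k):]"
    by (simp add: monom_Suc Q_pCons)
  also have "pCons 0 (Q (monom 1 k)) = [:0, 1:] * (\<Sum>a<k. monom (L (monom 1 (k - 1 - a))) a)"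
    by (simp add: Suc)
  also have "\<dots> = (\<Sum>a<k. monom (L (monom 1 (k - 1 - a))) (Suc a))"
    unfolding sum_distrib_left by (intro sum.cong refl) (simp add: monom_Suc)
  finally show ?case
    by (subst sum.lessThan_Suc_shift) (simp add: monom_0 add.commute)
qed

text \<open>Since \<open>p\<^sub>n\<close> is monic of degree \<open>n\<close>, a linear functional that vanishes on all of them is zero.\<close>

lemma hermite_induct:
  assumes add: "\<And>f g. K (f + g) = K f + (K g :: real)" and smult: "\<And>a f. K (smult a f) = a * K f"
    and zero: "\<And>n. K (p n) = 0"
  shows "K f = 0"
proof (induction "degree f" arbitrary: f rule: less_induct)
  case less
  let ?n = "degree f"
  define g where "g = f - smult (lead_coeff f) (p ?n)"
  have f: "f = g + smult (lead_coeff f) (p ?n)" by (simp add: g_def)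
  have "K g = 0"
  proof (cases "?n = 0")
    case True
    then obtain a where "f = [:a:]" by (metis degree_eq_zeroE)
    then have "g = 0" by (simp add: g_def)
    then show ?thesis using smult[of 0 0] by simp
  next
    case False
    have "coeff g ?n = 0" by (simp add: g_def lead_coeff_assoc_hermite)
    moreover have "degree g \<le> ?n"
      unfolding g_def by (intro degree_diff_le) (use degree_smult_le[of "lead_coeff f" "p ?n"] in \<open>auto simp: degree_assoc_hermite\<close>)
    ultimately have "degree g < ?n"
      using False by (metis degree_0 eq_zero_or_degree_less neq0_conv)
    then show ?thesis by (rule less)
  qed
  then show ?case by (subst f) (simp add: add smult zero)
qed

lemma X_hermite: "[:0, 1:] * p (Suc n) = p (Suc (Suc n)) + smult (real (Suc n) + c) (p n)"
  by simp

text \<open>Induction on the smaller index: moving a factor \<open>x\<close> from \<open>p\<^sub>m\<close> to \<open>p\<^sub>n\<close> expresses \<open>L(p\<^bsub>m+2\<^esub> p\<^sub>n)\<close> through products with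
smaller first index, and only the one with equal indices survives.\<close>

lemma L_hermite_prod: "L (p m * p n) = (if m = n then \<Prod>k=1..n. c + real k else 0)"
proof -
  have main: "n \<ge> m \<Longrightarrow> L (p m * p n) = (if m = n then \<Prod>k=1..n. c + real k else 0)" for m n
  proof (induction m arbitrary: n rule: induct_nat_012)
    case 0
    then show ?case by (simp add: L_hermite)
  next
    case (1 n)
    then obtain k where n: "n = Suc k" by (cases n) auto
    have "p (Suc 0) * p n = p (Suc (Suc k)) + smult (real (Suc k) + c) (p k)"
      using X_hermite[of k] n by simp
    then show ?case by (simp add: n L_add L_smult L_hermite add.commute del: assoc_hermite.simps)
  next
    case (ge2 m n)
    then obtain k where n: "n = Suc k" by (cases n) auto
    have "p (Suc (Suc m)) * p n = p (Suc m) * ([:0, 1:] * p (Suc k)) - smult (real (Suc m) + c) (p m * p n)"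
      by (simp add: n algebra_simps)
    also have "\<dots> = p (Suc m) * p (Suc n) + smult (real (Suc k) + c) (p (Suc m) * p k) - smult (real (Suc m) + c) (p m * p n)"
      by (simp only: X_hermite n) (simp add: algebra_simps)
    finally have "L (p (Suc (Suc m)) * p n) = L (p (Suc m) * p (Suc n)) + (real (Suc k) + c) * L (p (Suc m) * p k) - (real (Suc m) + c) * L (p m * p n)"
      by (simp only: L_add L_diff L_smult)
    also have "L (p (Suc m) * p (Suc n)) = 0" using ge2.IH(2)[of "Suc n"] ge2.prems by (simp del: assoc_hermite.simps)
    also have "L (p m * p n) = 0" using ge2.IH(1)[of n] ge2.prems by (simp del: assoc_hermite.simps)
    also have "L (p (Suc m) * p k) = (if Suc m = k then \<Prod>i=1..k. c + real i else 0)"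
      using ge2.IH(2)[of k] ge2.prems n by (simp del: assoc_hermite.simps)
    finally show ?case using n by (auto simp: mult.commute add.commute)
  qed
  show ?thesis
  proof (cases "m \<le> n")
    case False
    then show ?thesis using main[of n m] by (auto simp: mult.commute)
  qed (rule main)
qed

lemma pderiv_X: "pderiv ([:0, 1:] * f) = f + [:0, 1:] * pderiv f"
  by (simp add: pderiv_mult pderiv_pCons)

text \<open>The ring identity behind the induction step for \<open>pderiv_\<Lambda>_hermite\<close>. Here \<open>p0, p1\<close> are consecutive polynomials, \<open>d\<close>
and \<open>e\<close> their first and second derivatives, \<open>q\<close> and \<open>r\<close> stand for \<open>Q p\<close> and its derivative, \<open>K\<close> for the coefficient of the
recurrence, \<open>N\<close> and \<open>C\<close> for the degree and for \<open>c\<close>. Doubled terms replace multiples by two, so that plain normalisation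
of commutative rings decides it.\<close>

lemma hermite_equation_step:
  fixes X :: "'r :: comm_ring_1"
  shows "(d1 + (d1 + X * e1) - K * e0) - X * (p1 + X * d1 - K * d0)
      + (N * (X * p1 - K * p0) + (X * p1 - K * p0) + (X * p1 - K * p0)) + (C * (q1 + X * r1 - K * r0) + C * (q1 + X * r1 - K * r0))
    = X * (e1 - X * d1 + (N * p1 + p1) + (C * r1 + C * r1)) - K * (e0 - X * d0 + N * p0 + (C * r0 + C * r0))
      + ((d1 - K * p0 + C * q1) + (d1 - K * p0 + C * q1))"
  by (simp add: algebra_simps)

text \<open>Up to the factor \<open>c\<close>, \<open>Q p\<^bsub>n+1\<^esub>\<close> is the part of the derivative that separates \<open>p\<^bsub>n+1\<^esub>\<close> from an Appell sequence: for the
Hermite polynomials, \<open>c = 0\<close>, the right side is zero. Both sides obey the recurrence of the \<open>p\<^bsub>n+1\<^esub>\<close>, because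
\<open>Q(x f) = x Q f + L(f)\<close> and \<open>L(p\<^sub>n) = 0\<close> for \<open>n \<ge> 1\<close>.\<close>

lemma Q_hermite: "smult c (Q (p (Suc n))) = smult (real (Suc n) + c) (p n) - pderiv (p (Suc n))"
proof (induction n rule: induct_nat_012)
  case 0
  show ?case by (simp add: Q_pCons L_const pderiv_pCons one_pCons)
next
  case 1
  have "p (Suc (Suc 0)) = [:0, 1:] * p (Suc 0) - smult (1 + c) (p 0)" by simp
  have "Q (p (Suc (Suc 0))) = [:0, 1:]"
    using L_hermite[of "Suc 0"] by (simp add: Q_pCons Q_diff Q_smult L_const one_pCons)
  then show ?case by (simp add: pderiv_pCons pderiv_diff pderiv_smult one_pCons)
next
  case (ge2 n)
  let ?X = "[:0, 1:] :: real poly"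
  have P3: "p (Suc (Suc (Suc n))) = ?X * p (Suc (Suc n)) - smult (real (Suc (Suc n)) + c) (p (Suc n))"
    and P2: "p (Suc (Suc n)) = ?X * p (Suc n) - smult (real (Suc n) + c) (p n)" by simp_all
  have "smult c (Q (p (Suc (Suc (Suc n))))) = ?X * smult c (Q (p (Suc (Suc n)))) - smult (real (Suc (Suc n)) + c) (smult c (Q (p (Suc n))))"
    by (simp only: P3 Q_diff Q_X Q_smult L_hermite) (simp add: smult_diff_right mult.commute del: assoc_hermite.simps)
  also have "\<dots> = ?X * (smult (real (Suc (Suc n)) + c) (p (Suc n)) - pderiv (p (Suc (Suc n)))) - smult (real (Suc (Suc n)) + c) (smult (real (Suc n) + c) (p n) - pderiv (p (Suc n)))"
    by (simp only: ge2)
  also have "\<dots> = smult (real (Suc (Suc n)) + c) (p (Suc (Suc n))) - (?X * pderiv (p (Suc (Suc n))) - smult (real (Suc (Suc n)) + c) (pderiv (p (Suc n))))"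
    by (subst P2) (simp add: smult_diff_right smult_add_right algebra_simps del: assoc_hermite.simps)
  also have "\<dots> = smult (real (Suc (Suc (Suc n))) + c) (p (Suc (Suc n))) - pderiv (p (Suc (Suc (Suc n))))"
  proof -
    define b where "b = real (Suc (Suc n)) + c"
    have "pderiv (p (Suc (Suc (Suc n)))) = p (Suc (Suc n)) + ?X * pderiv (p (Suc (Suc n))) - smult b (pderiv (p (Suc n)))"
      by (simp only: P3 pderiv_diff pderiv_smult pderiv_X b_def)
    moreover have "smult (real (Suc (Suc (Suc n))) + c) f = smult b f + f" for f
    proof -
      have "real (Suc (Suc (Suc n))) + c = b + 1" by (simp add: b_def)
      then show ?thesis by (simp only: smult_add_left smult_1_left)
    qed
    ultimately show ?thesis unfolding b_def[symmetric] by simp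
  qed
  finally show ?case .
qed

text \<open>The linear part of the loop equation. The factor \<open>2 c\<close>, against \<open>c\<close> in the equation for \<open>L\<close>, comes from the two equal
contributions in the expansion of a quadratic expression around \<open>\<nu>\<^sub>c\<close>.\<close>

definition \<Lambda> :: "real poly \<Rightarrow> real poly" where
  "\<Lambda> f = [:0, 1:] * f - pderiv f - smult (2 * c) (Q f)"

lemma \<Lambda>_add: "\<Lambda> (f + g) = \<Lambda> f + \<Lambda> g"
  by (simp add: \<Lambda>_def pderiv_add Q_add smult_add_right algebra_simps)

lemma \<Lambda>_smult: "\<Lambda> (smult a f) = smult a (\<Lambda> f)"
  by (simp add: \<Lambda>_def pderiv_smult Q_smult smult_diff_right mult.commute)

text \<open>In other words \<open>p\<^sub>n'' - x p\<^sub>n' + n p\<^sub>n + 2 c (Q p\<^sub>n)' = 0\<close>, a deformation of the Hermite equation. Call the left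
side \<open>A\<^sub>n\<close>. It satisfies the recurrence of the \<open>p\<^sub>n\<close> up to an inhomogeneity, which is zero by \<open>Q_hermite\<close>.\<close>

lemma pderiv_\<Lambda>_hermite: "pderiv (\<Lambda> (p n)) = smult (real n + 1) (p n)"
proof -
  let ?X = "[:0, 1:] :: real poly"
  define A where "A n = pderiv (pderiv (p n)) - ?X * pderiv (p n) + smult (real n) (p n) + smult (2 * c) (pderiv (Q (p n)))" for n
  have "A n = 0"
  proof (induction n rule: induct_nat_012)
    case 0
    show ?case by (simp add: A_def Q_pCons one_pCons pderiv_pCons)
  next
    case 1
    show ?case by (simp add: A_def Q_pCons one_pCons pderiv_pCons)
  next
    case (ge2 n)
    define a where "a = real (Suc n) + c"
    have P2: "p (Suc (Suc n)) = ?X * p (Suc n) - smult a (p n)" by (simp add: a_def)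
    have Q2: "Q (p (Suc (Suc n))) = ?X * Q (p (Suc n)) + [:L (p (Suc n)):] - smult a (Q (p n))"
      unfolding P2 by (simp only: Q_diff Q_smult Q_X)
    have "A (Suc (Suc n)) = ?X * A (Suc n) - smult a (A n) + smult 2 (pderiv (p (Suc n)) - smult a (p n) + smult c (Q (p (Suc n))))"
    proof -
      have sm: "smult (real (Suc (Suc n))) f = [:real n:] * f + f + f" "smult (real (Suc n)) f = [:real n:] * f + f" for f
        by (simp_all only: of_nat_Suc smult_add_left smult_1_left) (simp_all add: add_ac)
      have sm2: "smult (2 * c) f = [:c:] * f + [:c:] * f" "smult 2 f = f + f" for f
        by (simp only: mult_2 smult_add_left, simp) (simp only: one_add_one[symmetric] smult_add_left smult_1_left)
      have sm': "smult b f = [:b:] * f" for b f by simp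
      have pd: "pderiv [:L (p (Suc n)):] = 0" by (simp add: pderiv_pCons)
      show ?thesis
        unfolding A_def Q2
        unfolding P2 pderiv_diff pderiv_add pderiv_X pderiv_smult sm sm2 pd add_0_right
        unfolding sm' by (rule hermite_equation_step)
    qed
    then show ?case using ge2 Q_hermite[of n] by (simp add: a_def del: assoc_hermite.simps)
  qed
  then show ?thesis
    unfolding A_def \<Lambda>_def
    by (simp add: pderiv_diff pderiv_add pderiv_mult pderiv_smult pderiv_pCons smult_add_left algebra_simps)
qed

text \<open>By linearity it suffices to test \<open>f = p\<^sub>n\<close>, where \<open>Q_hermite\<close> and the recurrence reduce it to \<open>L(p\<^sub>k) = \<delta>\<^bsub>k0\<^esub>\<close>.\<close>

lemma L_loop_equation: "L ([:0, 1:] * f) = L (pderiv f) + c * L (Q f)"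
proof -
  have "L ([:0, 1:] * f) - L (pderiv f) - c * L (Q f) = 0"
  proof (rule hermite_induct[where K = "\<lambda>f. L ([:0, 1:] * f) - L (pderiv f) - c * L (Q f)"])
    fix f g :: "real poly" and a :: real
    show "L ([:0, 1:] * (f + g)) - L (pderiv (f + g)) - c * L (Q (f + g)) = L ([:0, 1:] * f) - L (pderiv f) - c * L (Q f) + (L ([:0, 1:] * g) - L (pderiv g) - c * L (Q g))"
      by (simp only: pderiv_add Q_add L_add distrib_left)
    show "L ([:0, 1:] * smult a f) - L (pderiv (smult a f)) - c * L (Q (smult a f)) = a * (L ([:0, 1:] * f) - L (pderiv f) - c * L (Q f))"
      by (simp only: pderiv_smult Q_smult L_smult mult_smult_right) (simp add: algebra_simps)
  next
    fix n
    show "L ([:0, 1:] * p n) - L (pderiv (p n)) - c * L (Q (p n)) = 0"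
    proof (cases n)
      case 0
      then show ?thesis using L_hermite[of 1] by (simp add: one_pCons Q_pCons pderiv_pCons)
    next
      case (Suc k)
      have "c * L (Q (p (Suc k))) = L (smult c (Q (p (Suc k))))" by (simp only: L_smult)
      also have "\<dots> = (real (Suc k) + c) * L (p k) - L (pderiv (p (Suc k)))" by (simp only: Q_hermite L_diff L_smult)
      finally show ?thesis
        unfolding Suc X_hermite L_add L_smult by (simp add: L_hermite del: assoc_hermite.simps)
    qed
  qed
  then show ?thesis by simp
qed

end

section \<open>Gaussian integration by parts for functions of polynomial growth\<close>

lemma integrable_poly_gaussian_weight:
  "integrable lborel (\<lambda>x::real. (1 + \<bar>x\<bar>) ^ m * exp (- x\<^sup>2 / 2))"
proof -
  have "(1 + \<bar>x\<bar>) ^ m * exp (- x\<^sup>2 / 2) = sqrt (2 * pi) * (std_normal_density x * (1 + \<bar>x\<bar>) ^ m)" for x :: real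
    by (simp add: std_normal_density_def)
  then show ?thesis by (simp only: integrable_mult_right[OF integrable_std_normal_poly])
qed

lemma gaussian_ibp_line:
  fixes g g' :: "real \<Rightarrow> real"
  assumes g: "\<And>x. \<bar>g x\<bar> \<le> C * (1 + \<bar>x\<bar>) ^ m" and g': "\<And>x. \<bar>g' x\<bar> \<le> C' * (1 + \<bar>x\<bar>) ^ m'"
    and deriv: "\<And>x. (g has_real_derivative g' x) (at x)" and cont: "continuous_on UNIV g'"
  shows "(LINT x|lborel. (g' x - x * g x) * exp (- x\<^sup>2 / 2)) = 0"
proof -
  let ?f = "\<lambda>x. (g' x - x * g x) * exp (- x\<^sup>2 / 2)" and ?F = "\<lambda>x. g x * exp (- x\<^sup>2 / 2)"
  have cg: "continuous_on UNIV g" using deriv by (meson DERIV_continuous_on has_field_derivative_at_within)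
  have [measurable]: "g \<in> borel_measurable borel" "g' \<in> borel_measurable borel"
    using cg cont by (auto intro: borel_measurable_continuous_onI)
  have int: "integrable lborel ?f"
  proof (rule Bochner_Integration.integrable_bound)
    show "integrable lborel (\<lambda>x. C' * ((1 + \<bar>x\<bar>) ^ m' * exp (- x\<^sup>2 / 2)) + C * ((1 + \<bar>x\<bar>) ^ Suc m * exp (- x\<^sup>2 / 2)))"
      by (intro Bochner_Integration.integrable_add integrable_mult_right integrable_poly_gaussian_weight)
    show "AE x in lborel. norm (?f x) \<le> norm (C' * ((1 + \<bar>x\<bar>) ^ m' * exp (- x\<^sup>2 / 2)) + C * ((1 + \<bar>x\<bar>) ^ Suc m * exp (- x\<^sup>2 / 2)))"
    proof (intro AE_I2)
      fix x :: real
      have "\<bar>x * g x\<bar> \<le> (1 + \<bar>x\<bar>) * (C * (1 + \<bar>x\<bar>) ^ m)"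
        unfolding abs_mult by (intro mult_mono g) auto
      then have "\<bar>g' x - x * g x\<bar> \<le> C' * (1 + \<bar>x\<bar>) ^ m' + C * (1 + \<bar>x\<bar>) ^ Suc m"
        using g'[of x] abs_triangle_ineq4[of "g' x" "x * g x"] by (simp add: algebra_simps)
      then have "\<bar>g' x - x * g x\<bar> * exp (- x\<^sup>2 / 2) \<le> (C' * (1 + \<bar>x\<bar>) ^ m' + C * (1 + \<bar>x\<bar>) ^ Suc m) * exp (- x\<^sup>2 / 2)"
        by (intro mult_right_mono) auto
      also have "\<dots> = C' * ((1 + \<bar>x\<bar>) ^ m' * exp (- x\<^sup>2 / 2)) + C * ((1 + \<bar>x\<bar>) ^ Suc m * exp (- x\<^sup>2 / 2))"
        by (simp only: distrib_right mult.assoc)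
      also have "\<dots> \<le> norm \<dots>" by simp
      finally show "norm (?f x) \<le> norm (C' * ((1 + \<bar>x\<bar>) ^ m' * exp (- x\<^sup>2 / 2)) + C * ((1 + \<bar>x\<bar>) ^ Suc m * exp (- x\<^sup>2 / 2)))"
        by (simp only: real_norm_def abs_mult abs_exp_cancel)
    qed
  qed measurable
  have lim0: "((\<lambda>x::real. C * (1 + x) ^ m * exp (- x\<^sup>2 / 2)) \<longlongrightarrow> 0) at_top" by real_asymp
  have lim: "(?F \<longlongrightarrow> 0) F" if "filterlim (\<lambda>x::real. \<bar>x\<bar>) at_top F" for F
  proof (rule Lim_null_comparison)
    show "((\<lambda>x. C * (1 + \<bar>x\<bar>) ^ m * exp (- x\<^sup>2 / 2)) \<longlongrightarrow> 0) F"
      using filterlim_compose[OF lim0 that] by simp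
    show "\<forall>\<^sub>F x in F. norm (?F x) \<le> C * (1 + \<bar>x\<bar>) ^ m * exp (- x\<^sup>2 / 2)"
      using g by (intro always_eventually allI) (simp add: abs_mult mult_right_mono)
  qed
  have "(LBINT x=-\<infinity>..\<infinity>. ?f x) = 0 - 0"
  proof (rule interval_integral_FTC_integrable)
    fix x :: real
    show "(?F has_vector_derivative ?f x) (at x)"
      unfolding has_real_derivative_iff_has_vector_derivative[symmetric]
      by (auto intro!: derivative_eq_intros deriv simp: algebra_simps)
    show "isCont ?f x"
      using cg cont by (intro continuous_intros) (auto simp: continuous_on_eq_continuous_at)
  next
    show "set_integrable lborel (einterval (- \<infinity>) \<infinity>) ?f"
      using int by (simp add: set_integrable_def einterval_def)
    show "((?F \<circ> real_of_ereal) \<longlongrightarrow> 0) (at_right (- \<infinity>))"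
      unfolding ereal_tendsto_simps by (rule lim) real_asymp
    show "((?F \<circ> real_of_ereal) \<longlongrightarrow> 0) (at_left \<infinity>)"
      unfolding ereal_tendsto_simps by (rule lim) real_asymp
  qed simp
  then show ?thesis
    by (simp add: interval_lebesgue_integral_def einterval_def set_lebesgue_integral_def)
qed

text \<open>Measurable statistics of polynomial growth. The class is closed under the algebraic operations and integrable against the
Gaussian weight, so that integrability never has to be argued again.\<close>

definition tame :: "nat set \<Rightarrow> ((nat \<Rightarrow> real) \<Rightarrow> real) \<Rightarrow> bool" where
  "tame I h \<longleftrightarrow> h \<in> borel_measurable (Pi\<^sub>M I (\<lambda>_. lborel)) \<and>
     (\<exists>C m. C \<ge> 0 \<and> (\<forall>l. \<bar>h l\<bar> \<le> C * (\<Prod>k\<in>I. (1 + \<bar>l k\<bar>) ^ m)))"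

definition gauss :: "nat set \<Rightarrow> (nat \<Rightarrow> real) \<Rightarrow> real" where
  "gauss I l = (\<Prod>k\<in>I. exp (- (l k)\<^sup>2 / 2))"

lemma gauss_pos: "gauss I l > 0"
  by (simp add: gauss_def prod_pos)

lemma tameI:
  assumes "h \<in> borel_measurable (Pi\<^sub>M I (\<lambda>_. lborel))" "C \<ge> 0" "\<And>l. \<bar>h l\<bar> \<le> C * (\<Prod>k\<in>I. (1 + \<bar>l k\<bar>) ^ m)"
  shows "tame I h"
  using assms unfolding tame_def by blast

lemma tame_measurable: "tame I h \<Longrightarrow> h \<in> borel_measurable (Pi\<^sub>M I (\<lambda>_. lborel))"
  by (simp add: tame_def)

lemma growth_mono:
  assumes "m \<le> m'"
  shows "(\<Prod>k\<in>I. (1 + \<bar>l k\<bar>) ^ m) \<le> (\<Prod>k\<in>I. (1 + \<bar>l k :: real\<bar>) ^ m')"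
  using assms by (intro prod_mono conjI power_increasing) auto

lemma tame_add:
  assumes "tame I f" "tame I g"
  shows "tame I (\<lambda>l. f l + g l)"
proof -
  from assms obtain C m D n where C: "C \<ge> 0" "\<And>l. \<bar>f l\<bar> \<le> C * (\<Prod>k\<in>I. (1 + \<bar>l k\<bar>) ^ m)"
    and D: "D \<ge> 0" "\<And>l. \<bar>g l\<bar> \<le> D * (\<Prod>k\<in>I. (1 + \<bar>l k\<bar>) ^ n)" unfolding tame_def by metis
  show ?thesis
  proof (rule tameI[of _ _ "C + D" "max m n"])
    fix l
    have "\<bar>f l + g l\<bar> \<le> C * (\<Prod>k\<in>I. (1 + \<bar>l k\<bar>) ^ m) + D * (\<Prod>k\<in>I. (1 + \<bar>l k\<bar>) ^ n)"
      using C(2)[of l] D(2)[of l] by linarith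
    also have "\<dots> \<le> C * (\<Prod>k\<in>I. (1 + \<bar>l k\<bar>) ^ max m n) + D * (\<Prod>k\<in>I. (1 + \<bar>l k\<bar>) ^ max m n)"
      using C D by (intro add_mono mult_left_mono growth_mono) auto
    finally show "\<bar>f l + g l\<bar> \<le> (C + D) * (\<Prod>k\<in>I. (1 + \<bar>l k\<bar>) ^ max m n)" by (simp add: distrib_right)
  qed (use C D assms in \<open>auto simp: tame_def\<close>)
qed

lemma tame_mult:
  assumes "tame I f" "tame I g"
  shows "tame I (\<lambda>l. f l * g l)"
proof -
  from assms obtain C m D n where C: "C \<ge> 0" "\<And>l. \<bar>f l\<bar> \<le> C * (\<Prod>k\<in>I. (1 + \<bar>l k\<bar>) ^ m)"
    and D: "D \<ge> 0" "\<And>l. \<bar>g l\<bar> \<le> D * (\<Prod>k\<in>I. (1 + \<bar>l k\<bar>) ^ n)" unfolding tame_def by metis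
  show ?thesis
  proof (rule tameI[of _ _ "C * D" "m + n"])
    fix l
    have "\<bar>f l * g l\<bar> \<le> (C * (\<Prod>k\<in>I. (1 + \<bar>l k\<bar>) ^ m)) * (D * (\<Prod>k\<in>I. (1 + \<bar>l k\<bar>) ^ n))"
      unfolding abs_mult using C D by (intro mult_mono) (auto intro!: mult_nonneg_nonneg prod_nonneg)
    then show "\<bar>f l * g l\<bar> \<le> C * D * (\<Prod>k\<in>I. (1 + \<bar>l k\<bar>) ^ (m + n))"
      by (simp add: power_add prod.distrib mult_ac)
  qed (use C D assms in \<open>auto simp: tame_def\<close>)
qed

lemma tame_const [simp]: "tame I (\<lambda>_. a)"
  by (rule tameI[of _ _ "\<bar>a\<bar>" 0]) auto

lemma measurable_coordinate:
  assumes "k \<in> I"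
  shows "(\<lambda>l. l k) \<in> borel_measurable (Pi\<^sub>M I (\<lambda>_. lborel :: real measure))"
  using measurable_component_singleton[OF assms, of "\<lambda>_. lborel :: real measure"] by simp

lemma tame_minus: "tame I f \<Longrightarrow> tame I (\<lambda>l. - f l)"
  using tame_mult[OF tame_const[of I "-1"], of f] by simp

lemma tame_diff: "tame I f \<Longrightarrow> tame I g \<Longrightarrow> tame I (\<lambda>l. f l - g l)"
  using tame_add[of I f "\<lambda>l. - g l"] tame_minus[of I g] by simp

lemma tame_sum: "(\<And>a. a \<in> A \<Longrightarrow> tame I (f a)) \<Longrightarrow> tame I (\<lambda>l. \<Sum>a\<in>A. f a l)"
  by (induction A rule: infinite_finite_induct) (auto intro: tame_add)

lemma tame_prod: "(\<And>a. a \<in> A \<Longrightarrow> tame I (f a)) \<Longrightarrow> tame I (\<lambda>l. \<Prod>a\<in>A. f a l)"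
  by (induction A rule: infinite_finite_induct) (auto intro: tame_mult)

lemma tame_power: "tame I f \<Longrightarrow> tame I (\<lambda>l. f l ^ n)"
  by (induction n) (auto intro: tame_mult)

lemma tame_bound:
  assumes "tame I g" "f \<in> borel_measurable (Pi\<^sub>M I (\<lambda>_. lborel))" "\<And>l. \<bar>f l\<bar> \<le> g l"
  shows "tame I f"
proof -
  from assms(1) obtain C m where C: "C \<ge> 0" "\<And>l. \<bar>g l\<bar> \<le> C * (\<Prod>k\<in>I. (1 + \<bar>l k\<bar>) ^ m)"
    unfolding tame_def by metis
  show ?thesis
    by (rule tameI[OF assms(2) C(1), of m]) (use C(2) assms(3) in \<open>meson abs_ge_self order_trans\<close>)
qed

lemma tame_abs:
  assumes "tame I f"
  shows "tame I (\<lambda>l. \<bar>f l\<bar>)"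
proof -
  from assms obtain C m where C: "C \<ge> 0" "\<And>l. \<bar>f l\<bar> \<le> C * (\<Prod>k\<in>I. (1 + \<bar>l k\<bar>) ^ m)"
    unfolding tame_def by metis
  show ?thesis
    by (rule tameI[OF borel_measurable_abs[OF tame_measurable[OF assms]] C(1)]) (use C(2) in simp)
qed

context
  fixes I :: "nat set"
  assumes fin: "finite I"
begin

lemma tame_one_plus_abs:
  assumes "k \<in> I"
  shows "tame I (\<lambda>l. 1 + \<bar>l k\<bar>)"
proof (rule tameI[of _ _ 1 1])
  show "(\<lambda>l. 1 + \<bar>l k\<bar>) \<in> borel_measurable (Pi\<^sub>M I (\<lambda>_. lborel :: real measure))"
    using measurable_coordinate[OF assms] by measurable
  fix l :: "nat \<Rightarrow> real"
  have "1 * (1 + \<bar>l k\<bar>) \<le> (\<Prod>j\<in>I - {k}. 1 + \<bar>l j\<bar>) * (1 + \<bar>l k\<bar>)"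
    by (intro mult_right_mono prod_ge_1) auto
  also have "\<dots> = (\<Prod>j\<in>I. 1 + \<bar>l j\<bar>)" using fin assms by (simp add: prod.remove mult.commute)
  finally show "\<bar>1 + \<bar>l k\<bar>\<bar> \<le> 1 * (\<Prod>k\<in>I. (1 + \<bar>l k\<bar>) ^ 1)" by simp
qed simp

lemma tame_coordinate:
  assumes "k \<in> I"
  shows "tame I (\<lambda>l. l k)"
  by (rule tame_bound[OF tame_one_plus_abs[OF assms] measurable_coordinate[OF assms]]) auto

lemma tame_poly_coordinate:
  assumes "k \<in> I"
  shows "tame I (\<lambda>l. poly p (l k))"
  by (induction p) (auto intro!: tame_add tame_mult tame_coordinate assms)

text \<open>The bound for \<open>\<phi>\<close> becomes one for the statistic through \<open>1 + \<bar>y - x\<bar> \<le> (1 + \<bar>x\<bar>) (1 + \<bar>y\<bar>)\<close>.\<close>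

lemma tame_difference:
  assumes "i \<in> I" "j \<in> I" and [measurable]: "\<phi> \<in> borel_measurable borel" and "\<And>x. \<bar>\<phi> x\<bar> \<le> C * (1 + \<bar>x\<bar>) ^ m" "C \<ge> 0"
  shows "tame I (\<lambda>l. \<phi> (l j - l i))"
proof (rule tame_bound)
  show "tame I (\<lambda>l. C * ((1 + \<bar>l j\<bar>) * (1 + \<bar>l i\<bar>)) ^ m)"
    by (intro tame_mult tame_power tame_const tame_one_plus_abs assms)
  show "(\<lambda>l. \<phi> (l j - l i)) \<in> borel_measurable (Pi\<^sub>M I (\<lambda>_. lborel))"
    by (rule measurable_compose[OF borel_measurable_diff[OF measurable_coordinate[OF assms(2)] measurable_coordinate[OF assms(1)]] assms(3)])
  fix l :: "nat \<Rightarrow> real"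
  have "0 \<le> \<bar>l j\<bar> * \<bar>l i\<bar>" by simp
  then have "1 + \<bar>l j - l i\<bar> \<le> (1 + \<bar>l j\<bar>) * (1 + \<bar>l i\<bar>)"
    unfolding distrib_left distrib_right by linarith
  then have "C * (1 + \<bar>l j - l i\<bar>) ^ m \<le> C * ((1 + \<bar>l j\<bar>) * (1 + \<bar>l i\<bar>)) ^ m"
    using assms by (intro mult_left_mono power_mono) auto
  then show "\<bar>\<phi> (l j - l i)\<bar> \<le> C * ((1 + \<bar>l j\<bar>) * (1 + \<bar>l i\<bar>)) ^ m"
    using assms(4)[of "l j - l i"] by linarith
qed

interpretation P: product_sigma_finite "\<lambda>_::nat. lborel :: real measure"
  by (simp add: product_sigma_finite_def sigma_finite_lborel)

lemma measurable_gauss: "gauss I \<in> borel_measurable (Pi\<^sub>M I (\<lambda>_. lborel))"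
proof -
  have "(\<lambda>l. exp (- (l k :: real)\<^sup>2 / 2)) \<in> borel_measurable (Pi\<^sub>M I (\<lambda>_. lborel))" if "k \<in> I" for k :: nat
    using measurable_coordinate[OF that] by measurable
  then show ?thesis unfolding gauss_def[abs_def] by (rule borel_measurable_prod)
qed

lemma integrable_tame:
  assumes "tame I h"
  shows "integrable (Pi\<^sub>M I (\<lambda>_. lborel)) (\<lambda>l. h l * gauss I l)"
proof -
  from assms obtain C m where C: "C \<ge> 0" "\<And>l. \<bar>h l\<bar> \<le> C * (\<Prod>k\<in>I. (1 + \<bar>l k\<bar>) ^ m)"
    unfolding tame_def by metis
  show ?thesis
  proof (rule Bochner_Integration.integrable_bound)
    show "integrable (Pi\<^sub>M I (\<lambda>_. lborel)) (\<lambda>l. C * (\<Prod>k\<in>I. (1 + \<bar>l k\<bar>) ^ m * exp (- (l k)\<^sup>2 / 2)))"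
      by (intro integrable_mult_right P.product_integrable_prod fin integrable_poly_gaussian_weight)
    show "(\<lambda>l. h l * gauss I l) \<in> borel_measurable (Pi\<^sub>M I (\<lambda>_. lborel))"
      using tame_measurable[OF assms] measurable_gauss by measurable
    show "AE l in Pi\<^sub>M I (\<lambda>_. lborel). norm (h l * gauss I l) \<le> norm (C * (\<Prod>k\<in>I. (1 + \<bar>l k\<bar>) ^ m * exp (- (l k)\<^sup>2 / 2)))"
    proof (intro AE_I2)
      fix l
      have "norm (h l * gauss I l) = \<bar>h l\<bar> * gauss I l" using gauss_pos[of I l] by (simp add: abs_mult)
      also have "\<dots> \<le> (C * (\<Prod>k\<in>I. (1 + \<bar>l k\<bar>) ^ m)) * gauss I l"
        using gauss_pos[of I l] by (intro mult_right_mono C) simp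
      also have "\<dots> = C * (\<Prod>k\<in>I. (1 + \<bar>l k\<bar>) ^ m * exp (- (l k)\<^sup>2 / 2))"
        by (simp add: gauss_def prod.distrib)
      finally show "norm (h l * gauss I l) \<le> norm (C * (\<Prod>k\<in>I. (1 + \<bar>l k\<bar>) ^ m * exp (- (l k)\<^sup>2 / 2)))"
        by (rule order.trans) simp
    qed
  qed
qed

text \<open>Fubini isolates the coordinate \<open>k\<close>; along it the integrand is the derivative of \<open>h e\<^bsup>-x\<^sup>2/2\<^esup>\<close>, which vanishes at both ends.\<close>

lemma gaussian_ibp:
  assumes k: "k \<in> I" and h: "tame I h" and h': "tame I h'"
    and deriv: "\<And>l x. ((\<lambda>x. h (l(k := x))) has_real_derivative h' (l(k := x))) (at x)"
    and cont: "\<And>l. continuous_on UNIV (\<lambda>x. h' (l(k := x)))"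
  shows "(LINT l|Pi\<^sub>M I (\<lambda>_. lborel). (h' l - l k * h l) * gauss I l) = 0"
proof -
  define J where "J = I - {k}"
  have I: "I = insert k J" "k \<notin> J" "finite J" using k fin by (auto simp: J_def)
  have bound: "\<exists>C m. \<forall>x. \<bar>g (l(k := x))\<bar> \<le> C * (1 + \<bar>x\<bar>) ^ m" if "tame I g" for g l
  proof -
    from that obtain C m where C: "C \<ge> 0" "\<And>l. \<bar>g l\<bar> \<le> C * (\<Prod>k\<in>I. (1 + \<bar>l k\<bar>) ^ m)"
      unfolding tame_def by metis
    have "(\<Prod>i\<in>I. (1 + \<bar>(l(k := x)) i\<bar>) ^ m) = (1 + \<bar>x\<bar>) ^ m * (\<Prod>i\<in>J. (1 + \<bar>l i\<bar>) ^ m)" for x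
    proof -
      have "(\<Prod>i\<in>J. (1 + \<bar>(l(k := x)) i\<bar>) ^ m) = (\<Prod>i\<in>J. (1 + \<bar>l i\<bar>) ^ m)"
        using I(2) by (intro prod.cong) auto
      then show ?thesis unfolding I(1) using I by (subst prod.insert) auto
    qed
    then have "\<bar>g (l(k := x))\<bar> \<le> (C * (\<Prod>i\<in>J. (1 + \<bar>l i\<bar>) ^ m)) * (1 + \<bar>x\<bar>) ^ m" for x
      using C(2)[of "l(k := x)"] by (simp add: mult_ac)
    then show ?thesis by blast
  qed
  have gI: "gauss I (l(k := x)) = gauss J l * exp (- x\<^sup>2 / 2)" for l x
  proof -
    have "gauss J (l(k := x)) = gauss J l" unfolding gauss_def using I(2) by (intro prod.cong) auto
    then show ?thesis unfolding I(1) using I by (simp add: gauss_def mult.commute)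
  qed
  have "tame I (\<lambda>l. h' l - l k * h l)"
    by (intro tame_diff tame_mult h h' tame_coordinate k)
  then have "integrable (Pi\<^sub>M (insert k J) (\<lambda>_. lborel)) (\<lambda>l. (h' l - l k * h l) * gauss I l)"
    using integrable_tame I(1) by simp
  then have "(LINT l|Pi\<^sub>M (insert k J) (\<lambda>_. lborel). (h' l - l k * h l) * gauss I l)
    = (LINT l|Pi\<^sub>M J (\<lambda>_. lborel). LINT x|lborel. (h' (l(k := x)) - (l(k := x)) k * h (l(k := x))) * gauss I (l(k := x)))"
    by (rule P.product_integral_insert[OF I(3,2)])
  also have "\<dots> = (LINT l|Pi\<^sub>M J (\<lambda>_. lborel :: real measure). 0)"
  proof (rule Bochner_Integration.integral_cong[OF refl])
    fix l
    obtain C m where C: "\<And>x. \<bar>h (l(k := x))\<bar> \<le> C * (1 + \<bar>x\<bar>) ^ m" using bound[OF h] by blast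
    obtain C' m' where C': "\<And>x. \<bar>h' (l(k := x))\<bar> \<le> C' * (1 + \<bar>x\<bar>) ^ m'" using bound[OF h'] by blast
    have "(LINT x|lborel. (h' (l(k := x)) - (l(k := x)) k * h (l(k := x))) * gauss I (l(k := x)))
      = (LINT x|lborel. gauss J l * ((h' (l(k := x)) - x * h (l(k := x))) * exp (- x\<^sup>2 / 2)))"
      by (intro Bochner_Integration.integral_cong refl) (simp add: gI mult_ac)
    also have "\<dots> = gauss J l * (LINT x|lborel. (h' (l(k := x)) - x * h (l(k := x))) * exp (- x\<^sup>2 / 2))"
      by (rule integral_mult_right_zero)
    also have "(LINT x|lborel. (h' (l(k := x)) - x * h (l(k := x))) * exp (- x\<^sup>2 / 2)) = 0"
      by (rule gaussian_ibp_line[OF C C' deriv cont])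
    finally show "(LINT x|lborel. (h' (l(k := x)) - (l(k := x)) k * h (l(k := x))) * gauss I (l(k := x))) = 0"
      by (simp only: mult_zero_right)
  qed
  finally show ?thesis using I(1) by simp
qed

end

section \<open>The loop equation\<close>

definition pairs :: "nat set \<Rightarrow> (nat \<times> nat) set" where
  "pairs I = {(i, j). i \<in> I \<and> j \<in> I \<and> i < j}"

text \<open>The one-sided power makes the weight zero off the ordered cone, so that products of it over all pairs carry the
restriction to ordered vectors.\<close>

definition pair_repulsion :: "real \<Rightarrow> real \<Rightarrow> real" where
  "pair_repulsion \<beta> x = max x 0 powr \<beta>"

text \<open>For \<open>\<beta> < 1\<close> the power \<open>x\<^sup>\<beta>\<close> is not differentiable at \<open>0\<close>. This smoothing behaves like \<open>x\<^bsup>\<beta>+2\<^esup>/\<eta>\<close> at \<open>0\<close>, hence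
is continuously differentiable for every \<open>\<beta> > 0\<close>, vanishes on the negative axis, so that the walls of the ordered cone
contribute no boundary terms, and increases to \<open>x\<^sup>\<beta>\<close> as \<open>\<eta> \<rightarrow> 0\<close>.\<close>

definition smoothed_repulsion :: "real \<Rightarrow> real \<Rightarrow> real \<Rightarrow> real" where
  "smoothed_repulsion \<beta> \<eta> x = max x 0 powr (\<beta> + 2) / (x\<^sup>2 + \<eta>)"

definition dsmoothed_repulsion :: "real \<Rightarrow> real \<Rightarrow> real \<Rightarrow> real" where
  "dsmoothed_repulsion \<beta> \<eta> x = max x 0 powr (\<beta> + 1) / (x\<^sup>2 + \<eta>) * (\<beta> + 2 * \<eta> / (x\<^sup>2 + \<eta>))"

context
  fixes \<beta> :: real
  assumes \<beta>: "\<beta> > 0"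
begin

text \<open>The logarithmic derivative of the smoothed power is \<open>\<beta>/x\<close> up to a correction. Multiplied by \<open>x\<close>, which the loop equation
supplies as \<open>l j - l i\<close>, the correction is bounded by two and tends to zero for \<open>x \<noteq> 0\<close>.\<close>

lemma dsmoothed_repulsion_times:
  assumes "\<eta> > 0"
  shows "dsmoothed_repulsion \<beta> \<eta> x * x = smoothed_repulsion \<beta> \<eta> x * (\<beta> + 2 * \<eta> / (x\<^sup>2 + \<eta>))"
proof (cases "x > 0")
  case True
  then have "x powr (\<beta> + 2) = x powr (\<beta> + 1) * x"
    by (simp add: powr_add powr_numeral power2_eq_square)
  then show ?thesis using True by (simp add: dsmoothed_repulsion_def smoothed_repulsion_def)
qed (use \<beta> in \<open>simp add: dsmoothed_repulsion_def smoothed_repulsion_def max_def\<close>)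

lemma smoothed_repulsion_has_derivative:
  assumes \<eta>: "\<eta> > 0"
  shows "(smoothed_repulsion \<beta> \<eta> has_real_derivative dsmoothed_repulsion \<beta> \<eta> x) (at x)"
proof (cases x "0 :: real" rule: linorder_cases)
  case less
  have "\<forall>\<^sub>F y in nhds x. smoothed_repulsion \<beta> \<eta> y = 0"
    using less \<beta> by (intro eventually_nhds[THEN iffD2] exI[of _ "{..<0}"]) (auto simp: smoothed_repulsion_def max_def)
  moreover have "dsmoothed_repulsion \<beta> \<eta> x = 0" using less \<beta> by (simp add: dsmoothed_repulsion_def max_def)
  ultimately show ?thesis by (subst DERIV_cong_ev[where g = "\<lambda>_. 0"]) auto
next
  case equal
  have "((\<lambda>h. (smoothed_repulsion \<beta> \<eta> (0 + h) - smoothed_repulsion \<beta> \<eta> 0) / h) \<longlongrightarrow> 0) (at 0)"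
  proof (rule Lim_null_comparison)
    have "continuous_on UNIV (\<lambda>h::real. max h 0 powr (\<beta> + 1) / \<eta>)"
      using \<beta> \<eta> by (intro continuous_intros continuous_on_powr') auto
    then have "isCont (\<lambda>h::real. max h 0 powr (\<beta> + 1) / \<eta>) 0" by (simp add: continuous_on_eq_continuous_at)
    then show "((\<lambda>h::real. max h 0 powr (\<beta> + 1) / \<eta>) \<longlongrightarrow> 0) (at 0)" using \<beta> by (simp add: isCont_def)
    have "norm ((smoothed_repulsion \<beta> \<eta> (0 + h) - smoothed_repulsion \<beta> \<eta> 0) / h) \<le> max h 0 powr (\<beta> + 1) / \<eta>" for h
    proof (cases "h > 0")
      case True
      have "h powr (\<beta> + 2) = h powr (\<beta> + 1) * h" using True by (simp add: powr_add powr_numeral power2_eq_square)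
      then have "norm ((smoothed_repulsion \<beta> \<eta> (0 + h) - smoothed_repulsion \<beta> \<eta> 0) / h) = h powr (\<beta> + 1) / (h\<^sup>2 + \<eta>)"
        using True \<beta> \<eta> by (simp add: smoothed_repulsion_def)
      also have "\<dots> \<le> h powr (\<beta> + 1) / \<eta>" using \<eta> True by (intro divide_left_mono mult_pos_pos) (auto intro: add_nonneg_pos)
      finally show ?thesis using True by simp
    qed (use \<beta> \<eta> in \<open>simp add: smoothed_repulsion_def max_def\<close>)
    then show "\<forall>\<^sub>F h in at 0. norm ((smoothed_repulsion \<beta> \<eta> (0 + h) - smoothed_repulsion \<beta> \<eta> 0) / h) \<le> max h 0 powr (\<beta> + 1) / \<eta>"
      by (intro always_eventually allI)
  qed
  then show ?thesis using equal \<beta> by (simp add: DERIV_def dsmoothed_repulsion_def)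
next
  case greater
  have "((\<lambda>x. x powr (\<beta> + 2) / (x\<^sup>2 + \<eta>)) has_real_derivative dsmoothed_repulsion \<beta> \<eta> x) (at x)"
  proof -
    have nz: "x\<^sup>2 + \<eta> > 0" using \<eta> by (intro add_nonneg_pos) auto
    have p: "x powr (\<beta> + 2) = x powr (\<beta> + 1) * x" using greater by (simp add: powr_add powr_numeral power2_eq_square)
    have "((\<lambda>x. x powr (\<beta> + 2) / (x\<^sup>2 + \<eta>)) has_real_derivative ((\<beta> + 2) * x powr (\<beta> + 2 - 1) * (x\<^sup>2 + \<eta>) - x powr (\<beta> + 2) * (2 * x)) / ((x\<^sup>2 + \<eta>) * (x\<^sup>2 + \<eta>))) (at x)"
      using greater nz by (auto intro!: derivative_eq_intros simp: has_real_derivative_powr)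
    moreover have "\<beta> + 2 - 1 = \<beta> + 1" by simp
    moreover have "((\<beta> + 2) * x powr (\<beta> + 1) * (x\<^sup>2 + \<eta>) - x powr (\<beta> + 2) * (2 * x)) / ((x\<^sup>2 + \<eta>) * (x\<^sup>2 + \<eta>)) = dsmoothed_repulsion \<beta> \<eta> x"
      unfolding dsmoothed_repulsion_def p using nz greater by (simp add: field_simps power2_eq_square)
    ultimately show ?thesis by (simp only:)
  qed
  moreover have "\<forall>\<^sub>F y in nhds x. smoothed_repulsion \<beta> \<eta> y = y powr (\<beta> + 2) / (y\<^sup>2 + \<eta>)"
    using greater by (intro eventually_nhds[THEN iffD2] exI[of _ "{0<..}"]) (auto simp: smoothed_repulsion_def)
  ultimately show ?thesis by (subst DERIV_cong_ev) auto
qed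

lemma continuous_on_dsmoothed_repulsion:
  assumes "\<eta> > 0"
  shows "continuous_on UNIV (dsmoothed_repulsion \<beta> \<eta>)"
proof -
  have "x\<^sup>2 + \<eta> \<noteq> 0" for x :: real using assms by (metis add_nonneg_pos less_irrefl zero_le_power2)
  then show ?thesis unfolding dsmoothed_repulsion_def[abs_def]
    using \<beta> by (intro continuous_intros continuous_on_powr') auto
qed

lemma continuous_on_smoothed_repulsion: "\<eta> > 0 \<Longrightarrow> continuous_on UNIV (smoothed_repulsion \<beta> \<eta>)"
  using smoothed_repulsion_has_derivative by (meson DERIV_continuous_on has_field_derivative_at_within)

lemma continuous_on_pair_repulsion: "continuous_on UNIV (pair_repulsion \<beta>)"
  unfolding pair_repulsion_def[abs_def] using \<beta> by (intro continuous_intros continuous_on_powr') auto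

lemma max_powr_growth:
  fixes x r :: real
  assumes "r \<ge> 0"
  shows "max x 0 powr r \<le> (1 + \<bar>x\<bar>) ^ nat \<lceil>r\<rceil>"
proof -
  have "max x 0 powr r \<le> (1 + \<bar>x\<bar>) powr r" using assms by (intro powr_mono2) auto
  also have "\<dots> \<le> (1 + \<bar>x\<bar>) powr real (nat \<lceil>r\<rceil>)" by (intro powr_mono) (auto simp: real_nat_ceiling_ge)
  also have "\<dots> = (1 + \<bar>x\<bar>) ^ nat \<lceil>r\<rceil>" by (intro powr_realpow) auto
  finally show ?thesis .
qed

lemma pair_repulsion_bounds: "0 \<le> pair_repulsion \<beta> x" "pair_repulsion \<beta> x \<le> (1 + \<bar>x\<bar>) ^ nat \<lceil>\<beta>\<rceil>"
  using max_powr_growth[of \<beta> x] \<beta> by (auto simp: pair_repulsion_def)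

lemma smoothed_repulsion_bounds:
  assumes "\<eta> > 0"
  shows "0 \<le> smoothed_repulsion \<beta> \<eta> x" "smoothed_repulsion \<beta> \<eta> x \<le> pair_repulsion \<beta> x"
proof -
  show "0 \<le> smoothed_repulsion \<beta> \<eta> x" using assms by (simp add: smoothed_repulsion_def)
  show "smoothed_repulsion \<beta> \<eta> x \<le> pair_repulsion \<beta> x"
  proof (cases "x > 0")
    case True
    have "smoothed_repulsion \<beta> \<eta> x = x powr \<beta> * (x\<^sup>2 / (x\<^sup>2 + \<eta>))"
      using True by (simp add: smoothed_repulsion_def powr_add powr_numeral)
    also have "\<dots> \<le> x powr \<beta> * 1" using assms True by (intro mult_left_mono) (auto simp: divide_simps add_nonneg_pos)
    finally show ?thesis using True by (simp add: pair_repulsion_def)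
  qed (use \<beta> in \<open>simp add: smoothed_repulsion_def pair_repulsion_def max_def\<close>)
qed

lemma dsmoothed_repulsion_bound:
  assumes "\<eta> > 0"
  shows "\<bar>dsmoothed_repulsion \<beta> \<eta> x\<bar> \<le> (\<beta> + 2) / \<eta> * (1 + \<bar>x\<bar>) ^ nat \<lceil>\<beta> + 1\<rceil>"
proof -
  have p: "x\<^sup>2 + \<eta> > 0" using assms by (intro add_nonneg_pos) auto
  have "2 * \<eta> / (x\<^sup>2 + \<eta>) \<le> 2" "2 * \<eta> / (x\<^sup>2 + \<eta>) \<ge> 0" using assms p by (simp_all add: divide_simps)
  then have 1: "\<beta> + 2 * \<eta> / (x\<^sup>2 + \<eta>) \<le> \<beta> + 2" "0 \<le> \<beta> + 2 * \<eta> / (x\<^sup>2 + \<eta>)" using \<beta> by linarith+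
  have 2: "max x 0 powr (\<beta> + 1) / (x\<^sup>2 + \<eta>) \<le> (1 + \<bar>x\<bar>) ^ nat \<lceil>\<beta> + 1\<rceil> / \<eta>"
    using max_powr_growth[of "\<beta> + 1" x] \<beta> assms by (intro frac_le) auto
  have "\<bar>dsmoothed_repulsion \<beta> \<eta> x\<bar> = dsmoothed_repulsion \<beta> \<eta> x" using 1 p by (simp add: dsmoothed_repulsion_def)
  also have "\<dots> \<le> (1 + \<bar>x\<bar>) ^ nat \<lceil>\<beta> + 1\<rceil> / \<eta> * (\<beta> + 2)"
    unfolding dsmoothed_repulsion_def using 1 2 p assms by (intro mult_mono) auto
  finally show ?thesis by (simp add: mult.commute)
qed

lemma smoothed_repulsion_tendsto: "(\<lambda>n. smoothed_repulsion \<beta> (1 / real (Suc n)) x) \<longlonglongrightarrow> pair_repulsion \<beta> x"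
proof (cases "x > 0")
  case True
  have "(\<lambda>n. max x 0 powr (\<beta> + 2) / (x\<^sup>2 + 1 / real (Suc n))) \<longlonglongrightarrow> max x 0 powr (\<beta> + 2) / (x\<^sup>2 + 0)"
    using True by (intro tendsto_intros LIMSEQ_Suc[OF lim_1_over_n]) auto
  moreover have "max x 0 powr (\<beta> + 2) / (x\<^sup>2 + 0) = pair_repulsion \<beta> x"
    using True by (simp add: pair_repulsion_def powr_add powr_numeral)
  ultimately show ?thesis by (simp add: smoothed_repulsion_def)
qed (use \<beta> in \<open>simp add: smoothed_repulsion_def pair_repulsion_def max_def\<close>)

lemma smoothed_repulsion_correction_tendsto:
  assumes "x \<noteq> 0"
  shows "(\<lambda>n. 2 * (1 / real (Suc n)) / (x\<^sup>2 + 1 / real (Suc n))) \<longlonglongrightarrow> 0"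
proof -
  have "(\<lambda>n. 2 * (1 / real (Suc n)) / (x\<^sup>2 + 1 / real (Suc n))) \<longlonglongrightarrow> 2 * 0 / (x\<^sup>2 + 0)"
    using assms by (intro tendsto_intros LIMSEQ_Suc[OF lim_1_over_n]) auto
  then show ?thesis by simp
qed

context
  fixes I :: "nat set"
  assumes fin: "finite I"
begin

lemma finite_pairs: "finite (pairs I)"
  by (rule finite_subset[of _ "I \<times> I"]) (auto simp: pairs_def fin)

definition interaction :: "(nat \<Rightarrow> real) \<Rightarrow> real" where
  "interaction l = (\<Prod>(i, j)\<in>pairs I. pair_repulsion \<beta> (l j - l i))"

definition smoothed_interaction :: "real \<Rightarrow> (nat \<Rightarrow> real) \<Rightarrow> real" where
  "smoothed_interaction \<eta> l = (\<Prod>(i, j)\<in>pairs I. smoothed_repulsion \<beta> \<eta> (l j - l i))"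

definition dsmoothed_interaction :: "real \<Rightarrow> nat \<Rightarrow> (nat \<Rightarrow> real) \<Rightarrow> real" where
  "dsmoothed_interaction \<eta> k l = (\<Sum>q\<in>pairs I. (dsmoothed_repulsion \<beta> \<eta> (l (snd q) - l (fst q)) * (of_bool (snd q = k) - of_bool (fst q = k)))
      * (\<Prod>r\<in>pairs I - {q}. smoothed_repulsion \<beta> \<eta> (l (snd r) - l (fst r))))"

lemma smoothed_interaction_has_derivative:
  assumes \<eta>: "\<eta> > 0"
  shows "((\<lambda>x. smoothed_interaction \<eta> (l(k := x))) has_real_derivative dsmoothed_interaction \<eta> k (l(k := x))) (at x)"
  unfolding smoothed_interaction_def dsmoothed_interaction_def case_prod_beta
proof (rule has_field_derivative_prod)
  fix q :: "nat \<times> nat"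
  have "((\<lambda>x. (l(k := x)) (snd q) - (l(k := x)) (fst q)) has_real_derivative of_bool (snd q = k) - of_bool (fst q = k)) (at x)"
    by (auto intro!: derivative_eq_intros)
  from DERIV_chain2[OF smoothed_repulsion_has_derivative[OF \<eta>] this]
  show "((\<lambda>x. smoothed_repulsion \<beta> \<eta> ((l(k := x)) (snd q) - (l(k := x)) (fst q))) has_real_derivative
     dsmoothed_repulsion \<beta> \<eta> ((l(k := x)) (snd q) - (l(k := x)) (fst q)) * (of_bool (snd q = k) - of_bool (fst q = k))) (at x)" .
qed

lemma continuous_on_update: "continuous_on UNIV (\<lambda>x. (l(k := x)) j :: real)"
  by (cases "j = k") (auto intro!: continuous_intros)

lemma continuous_on_dsmoothed_interaction:
  assumes \<eta>: "\<eta> > 0"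
  shows "continuous_on UNIV (\<lambda>x. dsmoothed_interaction \<eta> k (l(k := x)))"
  unfolding dsmoothed_interaction_def
  by (intro continuous_intros continuous_on_prod' continuous_on_update
      continuous_on_compose2[OF continuous_on_dsmoothed_repulsion[OF \<eta>]] continuous_on_compose2[OF continuous_on_smoothed_repulsion[OF \<eta>]]) auto

lemma tame_interaction: "tame I interaction"
proof -
  have "tame I (\<lambda>l. pair_repulsion \<beta> (l (snd q) - l (fst q)))" if "q \<in> pairs I" for q
  proof (rule tame_difference[OF fin _ _ borel_measurable_continuous_onI[OF continuous_on_pair_repulsion]])
    show "\<bar>pair_repulsion \<beta> x\<bar> \<le> 1 * (1 + \<bar>x\<bar>) ^ nat \<lceil>\<beta>\<rceil>" for x
      using pair_repulsion_bounds[of x] by simp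
  qed (use that in \<open>auto simp: pairs_def\<close>)
  then show ?thesis unfolding interaction_def[abs_def] case_prod_beta by (intro tame_prod)
qed

lemma tame_smoothed_repulsion:
  assumes \<eta>: "\<eta> > 0" and "q \<in> pairs I"
  shows "tame I (\<lambda>l. smoothed_repulsion \<beta> \<eta> (l (snd q) - l (fst q)))"
proof (rule tame_difference[OF fin _ _ borel_measurable_continuous_onI[OF continuous_on_smoothed_repulsion[OF \<eta>]]])
  show "\<bar>smoothed_repulsion \<beta> \<eta> x\<bar> \<le> 1 * (1 + \<bar>x\<bar>) ^ nat \<lceil>\<beta>\<rceil>" for x
    using smoothed_repulsion_bounds[OF \<eta>, of x] pair_repulsion_bounds(2)[of x] by linarith
qed (use assms in \<open>auto simp: pairs_def\<close>)

lemma tame_smoothed_interaction: "\<eta> > 0 \<Longrightarrow> tame I (smoothed_interaction \<eta>)"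
  unfolding smoothed_interaction_def[abs_def] case_prod_beta by (intro tame_prod tame_smoothed_repulsion)

lemma tame_dsmoothed_interaction:
  assumes \<eta>: "\<eta> > 0"
  shows "tame I (dsmoothed_interaction \<eta> k)"
proof -
  have "tame I (\<lambda>l. dsmoothed_repulsion \<beta> \<eta> (l (snd q) - l (fst q)))" if "q \<in> pairs I" for q
    by (rule tame_difference[OF fin _ _ borel_measurable_continuous_onI[OF continuous_on_dsmoothed_repulsion[OF \<eta>]] dsmoothed_repulsion_bound[OF \<eta>]])
      (use that \<beta> \<eta> in \<open>auto simp: pairs_def\<close>)
  then show ?thesis unfolding dsmoothed_interaction_def[abs_def]
    by (intro tame_sum tame_mult tame_prod tame_const tame_smoothed_repulsion \<eta>) auto
qed

text \<open>A pair enters the derivatives with respect to its two coordinates with opposite signs. Together they give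
\<open>f(l j) - f(l i)\<close>, whose factor \<open>l j - l i\<close> cancels the singularity of the logarithmic derivative.\<close>

lemma sum_dsmoothed_interaction:
  assumes \<eta>: "\<eta> > 0" and D: "\<And>x y. f y - f x = (y - x) * D x y"
  shows "(\<Sum>k\<in>I. f (l k) * dsmoothed_interaction \<eta> k l)
    = smoothed_interaction \<eta> l * (\<Sum>(i, j)\<in>pairs I. (\<beta> + 2 * \<eta> / ((l j - l i)\<^sup>2 + \<eta>)) * D (l i) (l j))"
proof -
  define d where "d q = l (snd q) - l (fst q)" for q :: "nat \<times> nat"
  define R where "R q = (\<Prod>r\<in>pairs I - {q}. smoothed_repulsion \<beta> \<eta> (d r))" for q
  have "(\<Sum>k\<in>I. f (l k) * dsmoothed_interaction \<eta> k l)
    = (\<Sum>q\<in>pairs I. \<Sum>k\<in>I. f (l k) * (dsmoothed_repulsion \<beta> \<eta> (d q) * (of_bool (snd q = k) - of_bool (fst q = k)) * R q))"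
    unfolding dsmoothed_interaction_def R_def d_def sum_distrib_left by (rule sum.swap)
  also have "\<dots> = (\<Sum>q\<in>pairs I. smoothed_interaction \<eta> l * ((\<beta> + 2 * \<eta> / ((d q)\<^sup>2 + \<eta>)) * D (l (fst q)) (l (snd q))))"
  proof (rule sum.cong[OF refl])
    fix q assume q: "q \<in> pairs I"
    have "(\<Sum>k\<in>I. f (l k) * (dsmoothed_repulsion \<beta> \<eta> (d q) * (of_bool (snd q = k) - of_bool (fst q = k)) * R q))
      = dsmoothed_repulsion \<beta> \<eta> (d q) * R q * (\<Sum>k\<in>I. f (l k) * of_bool (snd q = k) - f (l k) * of_bool (fst q = k))"
      unfolding sum_distrib_left by (intro sum.cong refl) (simp add: algebra_simps)
    also have "(\<Sum>k\<in>I. f (l k) * of_bool (snd q = k) - f (l k) * of_bool (fst q = k)) = f (l (snd q)) - f (l (fst q))"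
    proof -
      have "(\<Sum>k\<in>I. f (l k) * of_bool (j = k)) = f (l j)" if "j \<in> I" for j
        using fin that by (simp add: of_bool_def if_distrib cong: if_cong)
      then show ?thesis using q by (auto simp: sum_subtractf pairs_def)
    qed
    also have "dsmoothed_repulsion \<beta> \<eta> (d q) * R q * (f (l (snd q)) - f (l (fst q)))
      = (dsmoothed_repulsion \<beta> \<eta> (d q) * d q) * R q * D (l (fst q)) (l (snd q))"
      unfolding D d_def by simp
    also have "\<dots> = (smoothed_repulsion \<beta> \<eta> (d q) * R q) * ((\<beta> + 2 * \<eta> / ((d q)\<^sup>2 + \<eta>)) * D (l (fst q)) (l (snd q)))"
      unfolding dsmoothed_repulsion_times[OF \<eta>] by simp
    also have "smoothed_repulsion \<beta> \<eta> (d q) * R q = smoothed_interaction \<eta> l"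
      unfolding smoothed_interaction_def R_def case_prod_beta d_def by (rule prod.remove[symmetric]) (use q finite_pairs in auto)
    finally show "(\<Sum>k\<in>I. f (l k) * (dsmoothed_repulsion \<beta> \<eta> (d q) * (of_bool (snd q = k) - of_bool (fst q = k)) * R q))
      = smoothed_interaction \<eta> l * ((\<beta> + 2 * \<eta> / ((d q)\<^sup>2 + \<eta>)) * D (l (fst q)) (l (snd q)))" .
  qed
  finally show ?thesis by (simp add: sum_distrib_left d_def case_prod_beta)
qed

text \<open>With the smoothed interaction, integrate by parts against \<open>f(l k) G\<close> in the direction \<open>k\<close> and add over \<open>k\<close>. Then let
\<open>\<eta> \<rightarrow> 0\<close> by dominated convergence: the unsmoothed interaction dominates the smoothed one. At points with two equal
coordinates the correction term does not converge to zero, but there both interactions vanish.\<close>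

theorem loop_equation:
  fixes f :: "real poly" and D :: "real \<Rightarrow> real \<Rightarrow> real"
  assumes G: "tame I G" and G': "\<And>k. k \<in> I \<Longrightarrow> tame I (G' k)"
    and deriv: "\<And>k l x. k \<in> I \<Longrightarrow> ((\<lambda>x. G (l(k := x))) has_real_derivative G' k (l(k := x))) (at x)"
    and cont: "\<And>k l. k \<in> I \<Longrightarrow> continuous_on UNIV (\<lambda>x. G' k (l(k := x)))"
    and D: "\<And>x y. poly f y - poly f x = (y - x) * D x y"
    and tame_D: "\<And>i j. i \<in> I \<Longrightarrow> j \<in> I \<Longrightarrow> tame I (\<lambda>l. D (l i) (l j))"
  shows "(LINT l|Pi\<^sub>M I (\<lambda>_. lborel).
      (G l * ((\<Sum>k\<in>I. poly (pderiv f) (l k) - l k * poly f (l k)) + \<beta> * (\<Sum>(i, j)\<in>pairs I. D (l i) (l j)))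
        + (\<Sum>k\<in>I. poly f (l k) * G' k l)) * (interaction l * gauss I l)) = 0"
proof -
  let ?P = "Pi\<^sub>M I (\<lambda>_. lborel :: real measure)"
  define A where "A l = G l * (\<Sum>k\<in>I. poly (pderiv f) (l k) - l k * poly f (l k)) + (\<Sum>k\<in>I. poly f (l k) * G' k l)" for l
  define E where "E \<eta> l = A l + G l * (\<Sum>(i, j)\<in>pairs I. (\<beta> + 2 * \<eta> / ((l j - l i)\<^sup>2 + \<eta>)) * D (l i) (l j))" for \<eta> l
  define E0 where "E0 l = A l + G l * (\<Sum>(i, j)\<in>pairs I. \<beta> * D (l i) (l j))" for l
  note tame_poly = tame_poly_coordinate[OF fin]
  have tame_A: "tame I A"
    unfolding A_def[abs_def]
    by (intro tame_add tame_mult tame_sum tame_diff G G' tame_poly tame_coordinate[OF fin]) auto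
  have D_pair: "tame I (\<lambda>l. D (l (fst q)) (l (snd q)))" if "q \<in> pairs I" for q
    using tame_D[of "fst q" "snd q"] that by (auto simp: pairs_def)
  have zero: "(LINT l|?P. E \<eta> l * (smoothed_interaction \<eta> l * gauss I l)) = 0" if \<eta>: "\<eta> > 0" for \<eta>
  proof -
    define h where "h k l = poly f (l k) * G l * smoothed_interaction \<eta> l" for k l
    define h' where "h' k l = (poly (pderiv f) (l k) * G l + poly f (l k) * G' k l) * smoothed_interaction \<eta> l + poly f (l k) * G l * dsmoothed_interaction \<eta> k l" for k l
    have th: "tame I (h k)" "tame I (h' k)" if "k \<in> I" for k
      unfolding h_def[abs_def] h'_def[abs_def]
      by (intro tame_add tame_mult tame_poly G G' tame_smoothed_interaction tame_dsmoothed_interaction \<eta> that)+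
    have int: "integrable ?P (\<lambda>l. (h' k l - l k * h k l) * gauss I l)" if "k \<in> I" for k
      by (intro integrable_tame[OF fin] tame_diff tame_mult th tame_coordinate[OF fin] that)
    have ibp: "(LINT l|?P. (h' k l - l k * h k l) * gauss I l) = 0" if k: "k \<in> I" for k
    proof (rule gaussian_ibp[OF fin k th[OF k]])
      fix l x
      have "((\<lambda>x. poly f ((l(k := x)) k)) has_real_derivative poly (pderiv f) ((l(k := x)) k)) (at x)"
        by (simp add: poly_DERIV)
      from DERIV_mult[OF DERIV_mult[OF this deriv[OF k]] smoothed_interaction_has_derivative[OF \<eta>]]
      show "((\<lambda>x. h k (l(k := x))) has_real_derivative h' k (l(k := x))) (at x)"
        unfolding h_def h'_def by (simp add: algebra_simps)
    next
      fix l
      have "continuous_on UNIV (\<lambda>x. G (l(k := x)))" "continuous_on UNIV (\<lambda>x. smoothed_interaction \<eta> (l(k := x)))"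
        by (intro continuous_at_imp_continuous_on ballI DERIV_isCont[OF deriv[OF k]] DERIV_isCont[OF smoothed_interaction_has_derivative[OF \<eta>]])+
      then show "continuous_on UNIV (\<lambda>x. h' k (l(k := x)))"
        unfolding h'_def by (intro continuous_intros cont[OF k] continuous_on_dsmoothed_interaction[OF \<eta>] continuous_on_poly continuous_on_update)
    qed
    have "E \<eta> l * (smoothed_interaction \<eta> l * gauss I l) = (\<Sum>k\<in>I. (h' k l - l k * h k l) * gauss I l)" for l
    proof -
      have "(\<Sum>k\<in>I. h' k l - l k * h k l) = (\<Sum>k\<in>I. (G l * (poly (pderiv f) (l k) - l k * poly f (l k)) + poly f (l k) * G' k l) * smoothed_interaction \<eta> l + G l * (poly f (l k) * dsmoothed_interaction \<eta> k l))"
        by (intro sum.cong refl) (simp add: h_def h'_def algebra_simps)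
      also have "\<dots> = A l * smoothed_interaction \<eta> l + G l * (\<Sum>k\<in>I. poly f (l k) * dsmoothed_interaction \<eta> k l)"
        by (simp add: A_def sum.distrib sum_distrib_left sum_distrib_right distrib_right)
      also have "\<dots> = E \<eta> l * smoothed_interaction \<eta> l"
        unfolding sum_dsmoothed_interaction[OF \<eta> D] E_def by (simp add: algebra_simps)
      finally show ?thesis by (simp only: sum_distrib_right[symmetric] mult.assoc)
    qed
    then have "(LINT l|?P. E \<eta> l * (smoothed_interaction \<eta> l * gauss I l)) = (\<Sum>k\<in>I. LINT l|?P. (h' k l - l k * h k l) * gauss I l)"
      using int by (simp add: Bochner_Integration.integral_sum)
    then show ?thesis using ibp by simp
  qed
  have tame_E: "tame I (\<lambda>l. E \<eta> l)" if "\<eta> > 0" for \<eta>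
  proof -
    have "tame I (\<lambda>l. (\<beta> + 2 * \<eta> / ((l (snd q) - l (fst q))\<^sup>2 + \<eta>)))" if q: "q \<in> pairs I" for q
    proof (rule tame_difference[OF fin, where m = 0 and C = "\<beta> + 2" and \<phi> = "\<lambda>x. \<beta> + 2 * \<eta> / (x\<^sup>2 + \<eta>)"])
      fix x :: real
      have "x\<^sup>2 + \<eta> > 0" using \<open>\<eta> > 0\<close> by (intro add_nonneg_pos) auto
      then have "0 \<le> 2 * \<eta> / (x\<^sup>2 + \<eta>)" "2 * \<eta> / (x\<^sup>2 + \<eta>) \<le> 2" using \<open>\<eta> > 0\<close> by (auto simp: divide_simps)
      then show "\<bar>\<beta> + 2 * \<eta> / (x\<^sup>2 + \<eta>)\<bar> \<le> (\<beta> + 2) * (1 + \<bar>x\<bar>) ^ 0" using \<beta> by simp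
    qed (use q \<beta> in \<open>auto simp: pairs_def\<close>)
    then have "tame I (\<lambda>l. \<Sum>q\<in>pairs I. (\<beta> + 2 * \<eta> / ((l (snd q) - l (fst q))\<^sup>2 + \<eta>)) * D (l (fst q)) (l (snd q)))"
      by (intro tame_sum) (rule tame_mult[OF _ D_pair])
    then show ?thesis
      unfolding E_def case_prod_beta by (rule tame_add[OF tame_A tame_mult[OF G]])
  qed
  have "(\<lambda>n. LINT l|?P. E (1 / real (Suc n)) l * (smoothed_interaction (1 / real (Suc n)) l * gauss I l)) \<longlonglongrightarrow> (LINT l|?P. E0 l * (interaction l * gauss I l))"
  proof (rule integral_dominated_convergence)
    define W where "W l = \<bar>A l\<bar> + \<bar>G l\<bar> * (\<Sum>(i, j)\<in>pairs I. (\<beta> + 2) * \<bar>D (l i) (l j)\<bar>)" for l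
    have tame_W: "tame I (\<lambda>l. W l * interaction l)"
      unfolding W_def case_prod_beta
      by (intro tame_mult tame_add tame_sum tame_abs tame_A G tame_const D_pair tame_interaction)
    show "integrable ?P (\<lambda>l. (W l * interaction l) * gauss I l)" by (rule integrable_tame[OF fin tame_W])
    have "tame I E0" unfolding E0_def[abs_def] case_prod_beta
      by (intro tame_mult tame_add tame_sum tame_A G tame_const D_pair)
    then show "(\<lambda>l. E0 l * (interaction l * gauss I l)) \<in> borel_measurable ?P"
      by (intro borel_measurable_times tame_measurable tame_interaction measurable_gauss[OF fin])
    show "(\<lambda>l. E (1 / real (Suc n)) l * (smoothed_interaction (1 / real (Suc n)) l * gauss I l)) \<in> borel_measurable ?P" for n
      by (intro borel_measurable_times tame_measurable tame_E tame_smoothed_interaction measurable_gauss[OF fin]) auto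
    show "AE l in ?P. norm (E (1 / real (Suc n)) l * (smoothed_interaction (1 / real (Suc n)) l * gauss I l)) \<le> W l * interaction l * gauss I l" for n
    proof (intro AE_I2)
      fix l
      define \<eta> where "\<eta> = 1 / real (Suc n)"
      have \<eta>: "\<eta> > 0" by (simp add: \<eta>_def)
      have "\<bar>E \<eta> l\<bar> \<le> \<bar>A l\<bar> + \<bar>G l\<bar> * \<bar>\<Sum>(i, j)\<in>pairs I. (\<beta> + 2 * \<eta> / ((l j - l i)\<^sup>2 + \<eta>)) * D (l i) (l j)\<bar>"
        unfolding E_def by (rule order.trans[OF abs_triangle_ineq]) (simp add: abs_mult)
      also have "\<dots> \<le> W l"
        unfolding W_def
      proof (intro add_left_mono mult_left_mono order.trans[OF sum_abs] sum_mono)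
        fix q
        have "(l (snd q) - l (fst q))\<^sup>2 + \<eta> > 0" using \<eta> by (intro add_nonneg_pos) auto
        then have "0 \<le> 2 * \<eta> / ((l (snd q) - l (fst q))\<^sup>2 + \<eta>)" "2 * \<eta> / ((l (snd q) - l (fst q))\<^sup>2 + \<eta>) \<le> 2" using \<eta> by (auto simp: divide_simps)
        then have "\<bar>\<beta> + 2 * \<eta> / ((l (snd q) - l (fst q))\<^sup>2 + \<eta>)\<bar> \<le> \<beta> + 2" using \<beta> by linarith
        then show "\<bar>case q of (i, j) \<Rightarrow> (\<beta> + 2 * \<eta> / ((l j - l i)\<^sup>2 + \<eta>)) * D (l i) (l j)\<bar> \<le> (case q of (i, j) \<Rightarrow> (\<beta> + 2) * \<bar>D (l i) (l j)\<bar>)"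
          by (simp add: case_prod_beta abs_mult mult_right_mono)
      qed auto
      finally have EW: "\<bar>E \<eta> l\<bar> \<le> W l" .
      have "smoothed_interaction \<eta> l \<le> interaction l" "0 \<le> smoothed_interaction \<eta> l"
        unfolding smoothed_interaction_def interaction_def case_prod_beta using smoothed_repulsion_bounds[OF \<eta>] by (auto intro!: prod_mono prod_nonneg)
      then have "\<bar>E \<eta> l\<bar> * smoothed_interaction \<eta> l \<le> W l * interaction l" using EW by (intro mult_mono) auto
      then have "\<bar>E \<eta> l\<bar> * smoothed_interaction \<eta> l * gauss I l \<le> W l * interaction l * gauss I l"
        using gauss_pos[of I l] by (intro mult_right_mono) auto
      then show "norm (E (1 / real (Suc n)) l * (smoothed_interaction (1 / real (Suc n)) l * gauss I l)) \<le> W l * interaction l * gauss I l"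
        using \<open>0 \<le> smoothed_interaction \<eta> l\<close> gauss_pos[of I l] unfolding \<eta>_def[symmetric] by (simp add: abs_mult mult_ac)
    qed
    show "AE l in ?P. (\<lambda>n. E (1 / real (Suc n)) l * (smoothed_interaction (1 / real (Suc n)) l * gauss I l)) \<longlonglongrightarrow> E0 l * (interaction l * gauss I l)"
    proof (intro AE_I2)
      fix l
      show "(\<lambda>n. E (1 / real (Suc n)) l * (smoothed_interaction (1 / real (Suc n)) l * gauss I l)) \<longlonglongrightarrow> E0 l * (interaction l * gauss I l)"
      proof (cases "\<exists>(i, j)\<in>pairs I. l j - l i = 0")
        case True
        then obtain i j where ij: "(i, j) \<in> pairs I" "l j - l i = 0" by auto
        have "smoothed_interaction \<eta> l = 0" for \<eta>
          unfolding smoothed_interaction_def by (rule prod_zero[OF finite_pairs]) (use ij \<beta> in \<open>auto simp: smoothed_repulsion_def intro!: bexI[of _ "(i, j)"]\<close>)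
        moreover have "interaction l = 0"
          unfolding interaction_def by (rule prod_zero[OF finite_pairs]) (use ij \<beta> in \<open>auto simp: pair_repulsion_def intro!: bexI[of _ "(i, j)"]\<close>)
        ultimately show ?thesis by simp
      next
        case False
        have "(\<lambda>n. smoothed_interaction (1 / real (Suc n)) l) \<longlonglongrightarrow> interaction l"
          unfolding smoothed_interaction_def interaction_def case_prod_beta by (intro tendsto_prod smoothed_repulsion_tendsto)
        moreover have "(\<lambda>n. E (1 / real (Suc n)) l) \<longlonglongrightarrow> A l + G l * (\<Sum>q\<in>pairs I. (\<beta> + 0) * D (l (fst q)) (l (snd q)))"
          unfolding E_def case_prod_beta
          by (intro tendsto_intros smoothed_repulsion_correction_tendsto) (use False in auto)
        then have "(\<lambda>n. E (1 / real (Suc n)) l) \<longlonglongrightarrow> E0 l" by (simp add: E0_def case_prod_beta)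
        ultimately show ?thesis by (intro tendsto_intros)
      qed
    qed
  qed
  then have "(LINT l|?P. E0 l * (interaction l * gauss I l)) = 0"
    using zero by (simp add: LIMSEQ_const_iff del: of_nat_Suc)
  moreover have "E0 l = G l * ((\<Sum>k\<in>I. poly (pderiv f) (l k) - l k * poly f (l k)) + \<beta> * (\<Sum>(i, j)\<in>pairs I. D (l i) (l j)))
        + (\<Sum>k\<in>I. poly f (l k) * G' k l)" for l
    unfolding E0_def A_def case_prod_beta sum_distrib_left[symmetric] by (simp add: algebra_simps)
  ultimately show ?thesis by simp
qed

end

end

section \<open>The loop equation for the fluctuations\<close>

text \<open>If a vector is not ordered, some pair \<open>i < j\<close> has \<open>l j < l i\<close> and contributes the factor zero.\<close>

lemma GBE_weight_eq:
  assumes \<beta>: "\<beta> > 0"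
  shows "GBE_weight N \<beta> l = interaction \<beta> {1..N} l * gauss {1..N} l"
proof (cases "\<forall>i\<in>{1..N}. \<forall>j\<in>{1..N}. i \<le> j \<longrightarrow> l i \<le> l j")
  case True
  have pr: "pairs {1..N} = prod.swap ` (SIGMA j:{1..N}. {1..<j})"
    by (auto simp: pairs_def image_iff)
  have "interaction \<beta> {1..N} l = (\<Prod>q\<in>(SIGMA j:{1..N}. {1..<j}). pair_repulsion \<beta> (l (fst q) - l (snd q)))"
    unfolding interaction_def[OF \<beta> finite_atLeastAtMost] pr
    by (subst prod.reindex) (auto simp: case_prod_beta)
  also have "\<dots> = (\<Prod>j\<in>{1..N}. \<Prod>i\<in>{1..<j}. pair_repulsion \<beta> (l j - l i))"
    by (simp add: prod.Sigma case_prod_beta)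
  also have "\<dots> = (\<Prod>j\<in>{1..N}. \<Prod>i\<in>{1..<j}. \<bar>l j - l i\<bar> powr \<beta>)"
  proof (intro prod.cong refl)
    fix j i assume "j \<in> {1..N}" "i \<in> {1..<j}"
    then have "l i \<le> l j" using True by auto
    then show "pair_repulsion \<beta> (l j - l i) = \<bar>l j - l i\<bar> powr \<beta>" by (simp add: pair_repulsion_def)
  qed
  finally show ?thesis using True by (simp add: GBE_weight_def gauss_def)
next
  case False
  then obtain i j where ij: "i \<in> {1..N}" "j \<in> {1..N}" "i \<le> j" "l j < l i" by force
  then have "i < j" by (cases "i = j") auto
  then have "(i, j) \<in> pairs {1..N}" using ij by (simp add: pairs_def)
  moreover have "pair_repulsion \<beta> (l j - l i) = 0" using ij \<beta> by (simp add: pair_repulsion_def max_def)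
  ultimately have "interaction \<beta> {1..N} l = 0"
    unfolding interaction_def[OF \<beta> finite_atLeastAtMost]
    by (intro prod_zero[OF finite_pairs[OF \<beta> finite_atLeastAtMost] bexI[of _ "(i, j)"]]) auto
  then show ?thesis using False by (simp only: GBE_weight_def if_False)
qed

lemma sum_pairs_symmetric:
  fixes D :: "nat \<Rightarrow> nat \<Rightarrow> real"
  assumes fin: "finite I" and sym: "\<And>i j. D i j = D j i"
  shows "2 * (\<Sum>(i, j)\<in>pairs I. D i j) = (\<Sum>i\<in>I. \<Sum>j\<in>I. D i j) - (\<Sum>i\<in>I. D i i)"
proof -
  have fp: "finite (pairs I)" by (rule finite_subset[of _ "I \<times> I"]) (auto simp: pairs_def fin)
  have "(\<Sum>i\<in>I. \<Sum>j\<in>I. D i j) = (\<Sum>q\<in>I \<times> I. D (fst q) (snd q))"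
    by (simp add: sum.cartesian_product case_prod_beta)
  also have "I \<times> I = pairs I \<union> (prod.swap ` pairs I \<union> (\<lambda>i. (i, i)) ` I)"
    by (auto simp: pairs_def image_iff)
  also have "(\<Sum>q\<in>\<dots>. D (fst q) (snd q)) = (\<Sum>q\<in>pairs I. D (fst q) (snd q)) + ((\<Sum>q\<in>prod.swap ` pairs I. D (fst q) (snd q)) + (\<Sum>q\<in>(\<lambda>i. (i, i)) ` I. D (fst q) (snd q)))"
    using fp fin by (subst sum.union_disjoint sum.union_disjoint | force simp: pairs_def)+
  also have "(\<Sum>q\<in>prod.swap ` pairs I. D (fst q) (snd q)) = (\<Sum>q\<in>pairs I. D (fst q) (snd q))"
    by (subst sum.reindex) (auto intro!: sum.cong sym)
  also have "(\<Sum>q\<in>(\<lambda>i. (i, i)) ` I. D (fst q) (snd q)) = (\<Sum>i\<in>I. D i i)"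
    by (subst sum.reindex) (auto simp: inj_on_def)
  finally show ?thesis by (simp add: case_prod_beta)
qed

text \<open>The linear statistic \<open>\<langle>L\<^sub>N, f\<rangle>\<close> of the empirical distribution.\<close>

definition avg :: "nat \<Rightarrow> real poly \<Rightarrow> (nat \<Rightarrow> real) \<Rightarrow> real" where
  "avg N f l = (\<Sum>k=1..N. poly f (l k)) / real N"

lemma avg_add: "avg N (f + g) l = avg N f l + avg N g l"
  by (simp add: avg_def sum.distrib add_divide_distrib)

lemma avg_smult: "avg N (smult a f) l = a * avg N f l"
  by (simp add: avg_def sum_distrib_left)

text \<open>The ensembles for all \<open>N\<close> at once, as laws on \<open>\<real>\<^sup>N\<close>, together with the functional \<open>L\<close> around which they are expanded.\<close>

locale gbe = hermite_functional +
  fixes \<mu> :: "nat \<Rightarrow> (nat \<Rightarrow> real) measure"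
  assumes prob: "N \<ge> 1 \<Longrightarrow> prob_space (\<mu> N)"
    and dens: "N \<ge> 1 \<Longrightarrow> \<exists>Z>0. \<mu> N = density (Pi\<^sub>M {1..N} (\<lambda>_. lborel)) (\<lambda>l. ennreal (GBE_weight N (2 * c / real N) l / Z))"
begin

abbreviation "I \<equiv> \<lambda>N::nat. {1..N}"
abbreviation "E \<equiv> \<lambda>N X. LINT l|\<mu> N. X l :: real"

lemma sets_\<mu>: "N \<ge> 1 \<Longrightarrow> sets (\<mu> N) = sets (Pi\<^sub>M {1..N} (\<lambda>_. lborel))"
  using dens by fastforce

lemma beta_pos: "N \<ge> 1 \<Longrightarrow> 2 * c / real N > 0"
  using c_pos by simp

lemma E_density:
  assumes N: "N \<ge> 1"
  obtains Z where "Z > 0" "\<And>X. tame (I N) X \<Longrightarrow> integrable (\<mu> N) X"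
    "\<And>X. tame (I N) X \<Longrightarrow> E N X = (LINT l|Pi\<^sub>M {1..N} (\<lambda>_. lborel). X l * (interaction (2 * c / real N) {1..N} l * gauss {1..N} l)) / Z"
proof -
  let ?\<beta> = "2 * c / real N" and ?P = "Pi\<^sub>M {1..N} (\<lambda>_. lborel :: real measure)"
  note b = beta_pos[OF N]
  obtain Z where Z: "Z > 0" "\<mu> N = density ?P (\<lambda>l. ennreal (GBE_weight N ?\<beta> l / Z))"
    using dens[OF N] by blast
  let ?w = "\<lambda>l. interaction ?\<beta> {1..N} l * gauss {1..N} l / Z"
  have mu: "\<mu> N = density ?P (\<lambda>l. ennreal (?w l))" unfolding Z(2) GBE_weight_eq[OF b] ..
  have w0: "0 \<le> ?w l" for l
    using gauss_pos[of "{1..N}" l] Z(1) pair_repulsion_bounds[OF b]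
    by (auto simp: interaction_def[OF b finite_atLeastAtMost] case_prod_beta intro!: divide_nonneg_pos mult_nonneg_nonneg prod_nonneg)
  have tP: "tame {1..N} (interaction ?\<beta> {1..N})" by (rule tame_interaction[OF b]) simp
  have mw: "?w \<in> borel_measurable ?P"
    by (intro borel_measurable_divide borel_measurable_times tame_measurable[OF tP] measurable_gauss) auto
  have eq: "?w l *\<^sub>R X l = X l * (interaction ?\<beta> {1..N} l * gauss {1..N} l) / Z" for X l by simp
  have int: "integrable ?P (\<lambda>l. X l * (interaction ?\<beta> {1..N} l * gauss {1..N} l) / Z)" if "tame (I N) X" for X
    using integrable_tame[OF _ tame_mult[OF that tP]] by (simp add: mult.assoc)
  show thesis
  proof (rule that[OF Z(1)])
    fix X assume X: "tame (I N) X"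
    have "AE l in ?P. 0 \<le> ?w l" by (intro AE_I2 w0)
    moreover have "integrable ?P (\<lambda>l. ?w l *\<^sub>R X l)" unfolding eq by (rule int[OF X])
    ultimately show "integrable (\<mu> N) X"
      unfolding mu using integrable_density[OF tame_measurable[OF X] mw] by blast
    have "E N X = (LINT l|?P. ?w l *\<^sub>R X l)"
      unfolding mu by (rule integral_density[OF tame_measurable[OF X] mw]) (intro AE_I2 w0)
    then show "E N X = (LINT l|?P. X l * (interaction ?\<beta> {1..N} l * gauss {1..N} l)) / Z"
      by (simp only: eq integral_divide_zero)
  qed
qed

lemma integrable_E: "N \<ge> 1 \<Longrightarrow> tame (I N) X \<Longrightarrow> integrable (\<mu> N) X"
  by (metis E_density)

lemma E_add: "N \<ge> 1 \<Longrightarrow> tame (I N) X \<Longrightarrow> tame (I N) Y \<Longrightarrow> E N (\<lambda>l. X l + Y l) = E N X + E N Y"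
  by (intro Bochner_Integration.integral_add integrable_E)

lemma E_cmult: "E N (\<lambda>l. a * X l) = a * E N X"
  by simp

lemma E_const: "N \<ge> 1 \<Longrightarrow> E N (\<lambda>_. a) = a"
  using prob_space.prob_space[OF prob] by simp

definition Y :: "nat \<Rightarrow> real poly \<Rightarrow> (nat \<Rightarrow> real) \<Rightarrow> real" where
  "Y N f l = sqrt (real N) * (avg N f l - L f)"

lemma Y_add: "Y N (f + g) l = Y N f l + Y N g l"
  by (simp add: Y_def avg_add L_add algebra_simps)

lemma Y_smult: "Y N (smult a f) l = a * Y N f l"
  by (simp add: Y_def avg_smult L_smult algebra_simps)

lemma Y_0: "Y N 0 l = 0"
  using Y_smult[of N 0 0 l] by simp

lemma Y_diff: "Y N (f - g) l = Y N f l - Y N g l"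
  using Y_add[of N f "smult (-1) g" l] Y_smult[of N "-1" g l] by simp

lemma Y_sum: "Y N (\<Sum>i\<in>A. f i) l = (\<Sum>i\<in>A. Y N (f i) l)"
  by (induction A rule: infinite_finite_induct) (auto simp: Y_add Y_0)

lemma Y_const: "N \<ge> 1 \<Longrightarrow> Y N [:a:] l = 0"
  by (simp add: Y_def avg_def L_const)

lemma avg_Y: "N \<ge> 1 \<Longrightarrow> avg N f l = L f + Y N f l / sqrt (real N)"
  by (simp add: Y_def)

lemma tame_avg: "tame (I N) (avg N f)"
proof -
  have "tame (I N) (\<lambda>l. 1 / real N * (\<Sum>k=1..N. poly f (l k)))"
    by (intro tame_mult tame_sum tame_const tame_poly_coordinate) auto
  then show ?thesis by (simp add: avg_def[abs_def])
qed

lemma tame_Y: "tame (I N) (Y N f)"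
  unfolding Y_def[abs_def] by (intro tame_mult tame_diff tame_const tame_avg)

lemma Y_has_derivative:
  assumes k: "k \<in> I N"
  shows "((\<lambda>x. Y N f (l(k := x))) has_real_derivative poly (pderiv f) ((l(k := x)) k) / sqrt (real N)) (at x)"
proof -
  have "((\<lambda>x. \<Sum>j=1..N. poly f ((l(k := x)) j)) has_real_derivative (\<Sum>j=1..N. if j = k then poly (pderiv f) x else 0)) (at x)"
    by (intro DERIV_sum) (auto intro: poly_DERIV)
  then have "((\<lambda>x. \<Sum>j=1..N. poly f ((l(k := x)) j)) has_real_derivative poly (pderiv f) x) (at x)"
    using k by simp
  then have "((\<lambda>x. Y N f (l(k := x))) has_real_derivative sqrt (real N) * (poly (pderiv f) x / real N - 0)) (at x)"
    unfolding Y_def avg_def by (intro DERIV_cmult DERIV_diff DERIV_cdivide DERIV_const)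
  moreover have "sqrt (real N) * (poly (pderiv f) x / real N - 0) = poly (pderiv f) ((l(k := x)) k) / sqrt (real N)"
    using k by (simp add: field_simps real_div_sqrt)
  ultimately show ?thesis by simp
qed

lemma continuous_on_Y: "k \<in> I N \<Longrightarrow> continuous_on UNIV (\<lambda>x. Y N f (l(k := x)))"
  by (intro continuous_at_imp_continuous_on ballI DERIV_isCont[OF Y_has_derivative])

text \<open>For \<open>f = x\<^sup>d\<close> the sum over pairs of divided differences is a double sum minus its diagonal,
\<open>(N\<^sup>2 \<Sum>\<^bsub>a<d\<^esub> \<langle>L\<^sub>N, x\<^bsup>d-1-a\<^esup>\<rangle> \<langle>L\<^sub>N, x\<^sup>a\<rangle> - N \<langle>L\<^sub>N, f'\<rangle>) / 2\<close>. Inserting \<open>\<langle>L\<^sub>N, g\<rangle> = L(g) + N\<^bsup>-1/2\<^esup> Y(g)\<close> everywhere, the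
terms of order \<open>N\<close> cancel by the equation for \<open>L\<close>, those linear in \<open>Y\<close> form \<open>Y(\<Lambda>f)\<close>, and the quadratic ones stay with the
factor \<open>N\<^bsup>-1/2\<^esup>\<close>.\<close>

lemma loop_equation_Y:
  assumes N: "N \<ge> 1" and G: "tame (I N) G" and G': "\<And>k. k \<in> I N \<Longrightarrow> tame (I N) (G' k)"
    and deriv: "\<And>k l x. k \<in> I N \<Longrightarrow> ((\<lambda>x. G (l(k := x))) has_real_derivative G' k (l(k := x))) (at x)"
    and cont: "\<And>k l. k \<in> I N \<Longrightarrow> continuous_on UNIV (\<lambda>x. G' k (l(k := x)))"
  shows "E N (\<lambda>l. G l * Y N (\<Lambda> (monom 1 d)) l)
    = E N (\<lambda>l. G l * (c / sqrt (real N) * ((\<Sum>a<d. Y N (monom 1 (d - 1 - a)) l * Y N (monom 1 a) l) - avg N (pderiv (monom 1 d)) l)))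
      + E N (\<lambda>l. 1 / sqrt (real N) * (\<Sum>k=1..N. l k ^ d * G' k l))"
proof -
  let ?f = "monom 1 d :: real poly" and ?\<beta> = "2 * c / real N"
  let ?yy = "\<lambda>l. \<Sum>a<d. Y N (monom 1 (d - 1 - a)) l * Y N (monom 1 a) l"
  let ?ss = "\<lambda>l. \<Sum>a<d. avg N (monom 1 (d - 1 - a)) l * avg N (monom 1 a) l"
  let ?dG = "\<lambda>l. \<Sum>k\<in>I N. poly ?f (l k) * G' k l"
  define D where "D x y = (\<Sum>a<d. x ^ (d - Suc a) * y ^ a)" for x y :: real
  let ?P = "Pi\<^sub>M {1..N} (\<lambda>_. lborel :: real measure)"
  define S where "S = sqrt (real N)"
  have S: "S > 0" "S * S = real N" using N by (auto simp: S_def)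
  have symD: "D x y = D y x" for x y
    unfolding D_def by (rule sum.reindex_bij_witness[of _ "\<lambda>a. d - Suc a" "\<lambda>a. d - Suc a"]) (auto simp: mult.commute)
  have tame_D: "tame (I N) (\<lambda>l. D (l i) (l j))" if "i \<in> I N" "j \<in> I N" for i j
    unfolding D_def by (intro tame_sum tame_mult tame_power tame_coordinate that) auto
  have Dsum: "(\<Sum>(i, j)\<in>pairs (I N). D (l i) (l j)) = ((real N)\<^sup>2 * ?ss l - real N * avg N (pderiv ?f) l) / 2" for l
  proof -
    have "(\<Sum>i\<in>I N. \<Sum>j\<in>I N. D (l i) (l j)) = (\<Sum>a<d. (\<Sum>i\<in>I N. l i ^ (d - 1 - a)) * (\<Sum>j\<in>I N. l j ^ a))"
    proof -
      have "(\<Sum>i\<in>I N. \<Sum>j\<in>I N. D (l i) (l j)) = (\<Sum>i\<in>I N. \<Sum>a<d. \<Sum>j\<in>I N. l i ^ (d - 1 - a) * l j ^ a)"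
        unfolding D_def by (rule sum.cong[OF refl]) (subst sum.swap, simp)
      also have "\<dots> = (\<Sum>a<d. \<Sum>i\<in>I N. \<Sum>j\<in>I N. l i ^ (d - 1 - a) * l j ^ a)" by (rule sum.swap)
      finally show ?thesis by (simp only: sum_product)
    qed
    also have "\<dots> = (\<Sum>a<d. (real N)\<^sup>2 * (avg N (monom 1 (d - 1 - a)) l * avg N (monom 1 a) l))"
      using N by (intro sum.cong refl) (simp add: avg_def poly_monom power2_eq_square)
    also have "\<dots> = (real N)\<^sup>2 * ?ss l"
      by (rule sum_distrib_left[symmetric])
    finally have 1: "(\<Sum>i\<in>I N. \<Sum>j\<in>I N. D (l i) (l j)) = (real N)\<^sup>2 * ?ss l" .
    have "D x x = poly (pderiv ?f) x" for x
    proof -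
      have "D x x = (\<Sum>a<d. x ^ (d - 1))" unfolding D_def
        by (intro sum.cong refl) (auto simp flip: power_add)
      then show ?thesis by (simp add: pderiv_monom poly_monom)
    qed
    then have 2: "(\<Sum>i\<in>I N. D (l i) (l i)) = real N * avg N (pderiv ?f) l" using N by (simp add: avg_def)
    have "2 * (\<Sum>(i, j)\<in>pairs (I N). D (l i) (l j)) = (\<Sum>i\<in>I N. \<Sum>j\<in>I N. D (l i) (l j)) - (\<Sum>i\<in>I N. D (l i) (l i))"
      by (rule sum_pairs_symmetric) (auto intro: symD)
    then show ?thesis unfolding 1 2 by simp
  qed
  (* H collects the terms of the loop equation that multiply G. *)
  define H where "H l = (\<Sum>k\<in>I N. poly (pderiv ?f) (l k) - l k * poly ?f (l k)) + ?\<beta> * (\<Sum>(i, j)\<in>pairs (I N). D (l i) (l j))" for l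
  have H: "H l = S * (c / S * (?yy l - avg N (pderiv ?f) l) - Y N (\<Lambda> ?f) l)" for l
  proof -
    define m where "m a = L (monom 1 a)" for a
    define y where "y a = Y N (monom 1 a) l" for a
    have av: "avg N (monom 1 a) l = m a + y a / S" for a using avg_Y[OF N] by (simp add: m_def y_def S_def)
    have "(\<Sum>k\<in>I N. poly (pderiv ?f) (l k) - l k * poly ?f (l k)) = real N * (avg N (pderiv ?f) l - avg N ([:0, 1:] * ?f) l)"
      using N by (simp add: avg_def sum_subtractf right_diff_distrib)
    moreover have "?\<beta> * (\<Sum>(i, j)\<in>pairs (I N). D (l i) (l j)) = real N * c * ?ss l - c * avg N (pderiv ?f) l"
      unfolding Dsum using N by (simp add: power2_eq_square field_simps)
    moreover have "avg N (pderiv ?f) l - avg N ([:0, 1:] * ?f) l = L (pderiv ?f) - L ([:0, 1:] * ?f) + (Y N (pderiv ?f) l - Y N ([:0, 1:] * ?f) l) / S"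
      using avg_Y[OF N] by (simp add: S_def diff_divide_distrib)
    moreover have "?ss l = L (Q ?f) + 2 * Y N (Q ?f) l / S + (\<Sum>a<d. y (d - 1 - a) * y a) / real N"
    proof -
      have "?ss l = (\<Sum>a<d. m (d - 1 - a) * m a + (m (d - 1 - a) * y a / S + y (d - 1 - a) * m a / S) + y (d - 1 - a) * y a / real N)"
        unfolding av S(2)[symmetric] by (intro sum.cong refl) (simp add: distrib_left distrib_right add_divide_distrib)
      also have "\<dots> = (\<Sum>a<d. m (d - 1 - a) * m a) + ((\<Sum>a<d. m (d - 1 - a) * y a) + (\<Sum>a<d. y (d - 1 - a) * m a)) / S + (\<Sum>a<d. y (d - 1 - a) * y a) / real N"
        by (simp add: sum.distrib sum_divide_distrib add_divide_distrib)
      also have "(\<Sum>a<d. y (d - 1 - a) * m a) = (\<Sum>a<d. m (d - 1 - a) * y a)"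
        by (rule sum.reindex_bij_witness[of _ "\<lambda>a. d - Suc a" "\<lambda>a. d - Suc a"]) (auto simp: mult.commute)
      also have "(\<Sum>a<d. m (d - 1 - a) * m a) = L (Q ?f)"
        unfolding Q_monom L_sum m_def
        by (intro sum.cong refl) (simp flip: L_smult add: smult_monom)
      also have "(\<Sum>a<d. m (d - 1 - a) * y a) = Y N (Q ?f) l"
        unfolding Q_monom Y_sum m_def y_def
        by (intro sum.cong refl) (simp flip: Y_smult add: smult_monom)
      finally show ?thesis by simp
    qed
    ultimately have "H l = real N * (L (pderiv ?f) - L ([:0, 1:] * ?f) + (Y N (pderiv ?f) l - Y N ([:0, 1:] * ?f) l) / S)
       + (real N * c * (L (Q ?f) + 2 * Y N (Q ?f) l / S + (\<Sum>a<d. y (d - 1 - a) * y a) / real N) - c * avg N (pderiv ?f) l)"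
      by (simp only: H_def)
    also have "\<dots> = real N * (L (pderiv ?f) - L ([:0, 1:] * ?f) + c * L (Q ?f))
       + (real N / S) * (Y N (pderiv ?f) l - Y N ([:0, 1:] * ?f) l + 2 * c * Y N (Q ?f) l)
       + c * ((\<Sum>a<d. y (d - 1 - a) * y a) - avg N (pderiv ?f) l)"
      using N S(1) by (simp add: field_simps)
    also have "L (pderiv ?f) - L ([:0, 1:] * ?f) + c * L (Q ?f) = 0" using L_loop_equation[of ?f] by simp
    also have "Y N (pderiv ?f) l - Y N ([:0, 1:] * ?f) l + 2 * c * Y N (Q ?f) l = - Y N (\<Lambda> ?f) l"
      unfolding \<Lambda>_def Y_diff Y_smult by simp
    also have "real N / S = S" using S by (simp add: field_simps)
    finally show ?thesis using S(1) by (simp add: y_def algebra_simps)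
  qed
  obtain Z where Z: "Z > 0" "\<And>X. tame (I N) X \<Longrightarrow> E N X = (LINT l|?P. X l * (interaction ?\<beta> {1..N} l * gauss {1..N} l)) / Z"
    by (rule E_density[OF N]) (rule that)
  have tG: "tame (I N) (\<lambda>l. ?dG l)"
    by (intro tame_sum tame_mult tame_poly_coordinate G') auto
  have tX: "tame (I N) (\<lambda>l. G l * (c / S * (?yy l - avg N (pderiv ?f) l)))"
    by (intro tame_mult G tame_const tame_diff tame_sum tame_Y tame_avg)
  have tY: "tame (I N) (\<lambda>l. G l * Y N (\<Lambda> ?f) l)" by (intro tame_mult G tame_Y)
  have tH: "tame (I N) (\<lambda>l. G l * H l + ?dG l)"
  proof -
    have "tame (I N) H" unfolding H_def case_prod_beta
      by (intro tame_add tame_mult tame_sum tame_diff tame_const tame_poly_coordinate tame_coordinate tame_D) (auto simp: pairs_def)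
    then show ?thesis by (intro tame_add tG tame_mult G)
  qed
  have "(LINT l|?P. (G l * H l + ?dG l) * (interaction ?\<beta> {1..N} l * gauss {1..N} l)) = 0"
    unfolding H_def
  proof (rule loop_equation[where D = D and G = G and G' = G' and f = ?f and \<beta> = ?\<beta> and I = "I N"])
    fix x y :: real
    have "y ^ d - x ^ d = (y - x) * D x y" unfolding D_def by (rule power_diff_sumr2)
    then show "poly ?f y - poly ?f x = (y - x) * D x y" by (simp add: poly_monom)
  qed (use beta_pos[OF N] G G' deriv cont tame_D in auto)
  then have "0 = E N (\<lambda>l. G l * H l + ?dG l)" using Z(2)[OF tH] by simp
  also have "\<dots> = E N (\<lambda>l. S * (G l * (c / S * (?yy l - avg N (pderiv ?f) l)) + - 1 * (G l * Y N (\<Lambda> ?f) l) + 1 / S * ?dG l))"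
    unfolding H using S(1) by (intro Bochner_Integration.integral_cong refl) (simp add: algebra_simps)
  also have "\<dots> = S * E N (\<lambda>l. G l * (c / S * (?yy l - avg N (pderiv ?f) l)) + - 1 * (G l * Y N (\<Lambda> ?f) l) + 1 / S * ?dG l)"
    by (rule E_cmult)
  finally have "0 = E N (\<lambda>l. G l * (c / S * (?yy l - avg N (pderiv ?f) l)) + - 1 * (G l * Y N (\<Lambda> ?f) l) + 1 / S * ?dG l)"
    using S(1) by simp
  also have "\<dots> = E N (\<lambda>l. G l * (c / S * (?yy l - avg N (pderiv ?f) l)))
     + E N (\<lambda>l. - 1 * (G l * Y N (\<Lambda> ?f) l)) + E N (\<lambda>l. 1 / S * ?dG l)"
    by (subst E_add[OF N tame_add[OF tX tame_mult[OF tame_const tY]] tame_mult[OF tame_const tG]],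
        subst E_add[OF N tX tame_mult[OF tame_const tY]]) (rule refl)
  also have "E N (\<lambda>l. - 1 * (G l * Y N (\<Lambda> ?f) l)) = - E N (\<lambda>l. G l * Y N (\<Lambda> ?f) l)" by (subst E_cmult) simp
  finally show ?thesis unfolding S_def[symmetric] by (simp add: poly_monom)
qed

end

section \<open>Boundedness of the mixed moments\<close>

context gbe
begin

text \<open>Boundedness concerns the mean and not the mean of the absolute value: a product of two such families need not be one. For
that reason mixed moments of all orders have to be treated at once.\<close>

definition bounded_mean :: "(nat \<Rightarrow> (nat \<Rightarrow> real) \<Rightarrow> real) \<Rightarrow> bool" where
  "bounded_mean X \<longleftrightarrow> (\<forall>N\<ge>1. tame (I N) (X N)) \<and> (\<exists>C. \<forall>N\<ge>1. \<bar>E N (X N)\<bar> \<le> C)"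

lemma bounded_mean_tame: "bounded_mean X \<Longrightarrow> N \<ge> 1 \<Longrightarrow> tame (I N) (X N)"
  by (simp add: bounded_mean_def)

lemma bounded_mean_bound:
  assumes "bounded_mean X"
  obtains C where "C \<ge> 0" "\<And>N. N \<ge> 1 \<Longrightarrow> \<bar>E N (X N)\<bar> \<le> C"
  using assms unfolding bounded_mean_def by (meson abs_ge_zero order.trans le_refl)

lemma bounded_mean_cong:
  assumes "bounded_mean X" "\<And>N l. N \<ge> 1 \<Longrightarrow> X' N l = X N l"
  shows "bounded_mean X'"
proof -
  have "X' N = X N" if "N \<ge> 1" for N using assms(2)[OF that] by auto
  then show ?thesis using assms(1) by (simp add: bounded_mean_def)
qed

lemma bounded_mean_const: "bounded_mean (\<lambda>N l. a)"
proof -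
  have "\<bar>E N (\<lambda>_. a)\<bar> \<le> \<bar>a\<bar>" if "N \<ge> 1" for N by (simp only: E_const[OF that])
  then show ?thesis unfolding bounded_mean_def by (blast intro: tame_const)
qed

lemma bounded_mean_add:
  assumes "bounded_mean X" "bounded_mean X'"
  shows "bounded_mean (\<lambda>N l. X N l + X' N l)"
proof -
  obtain C where C: "\<And>N. N \<ge> 1 \<Longrightarrow> \<bar>E N (X N)\<bar> \<le> C" using bounded_mean_bound[OF assms(1)] by metis
  obtain C' where C': "\<And>N. N \<ge> 1 \<Longrightarrow> \<bar>E N (X' N)\<bar> \<le> C'" using bounded_mean_bound[OF assms(2)] by metis
  have "\<bar>E N (\<lambda>l. X N l + X' N l)\<bar> \<le> C + C'" if N: "N \<ge> 1" for N
    using C[OF N] C'[OF N] E_add[OF N bounded_mean_tame[OF assms(1) N] bounded_mean_tame[OF assms(2) N]] by linarith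
  moreover have "tame (I N) (\<lambda>l. X N l + X' N l)" if "N \<ge> 1" for N
    by (intro tame_add bounded_mean_tame[OF assms(1) that] bounded_mean_tame[OF assms(2) that])
  ultimately show ?thesis unfolding bounded_mean_def by blast
qed

lemma bounded_mean_scale:
  assumes "bounded_mean X" and r: "\<And>N. N \<ge> 1 \<Longrightarrow> \<bar>r N\<bar> \<le> K"
  shows "bounded_mean (\<lambda>N l. r N * X N l)"
proof -
  obtain C where C: "C \<ge> 0" "\<And>N. N \<ge> 1 \<Longrightarrow> \<bar>E N (X N)\<bar> \<le> C" using bounded_mean_bound[OF assms(1)] by metis
  have "\<bar>E N (\<lambda>l. r N * X N l)\<bar> \<le> K * C" if N: "N \<ge> 1" for N
    unfolding E_cmult abs_mult using C(2)[OF N] r[OF N] by (intro mult_mono) auto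
  moreover have "tame (I N) (\<lambda>l. r N * X N l)" if "N \<ge> 1" for N
    by (intro tame_mult tame_const bounded_mean_tame[OF assms(1) that])
  ultimately show ?thesis unfolding bounded_mean_def by blast
qed

lemma bounded_mean_cmult: "bounded_mean X \<Longrightarrow> bounded_mean (\<lambda>N l. a * X N l)"
  by (rule bounded_mean_scale[where r = "\<lambda>_. a" and K = "\<bar>a\<bar>"]) auto

lemma bounded_mean_sqrt:
  assumes "bounded_mean X"
  shows "bounded_mean (\<lambda>N l. 1 / sqrt (real N) * X N l)"
proof (rule bounded_mean_scale[OF assms])
  fix N :: nat assume "N \<ge> 1"
  then have "sqrt (real N) \<ge> 1" by simp
  then show "\<bar>1 / sqrt (real N)\<bar> \<le> 1" by (simp add: divide_le_eq)
qed

lemma bounded_mean_sum: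
  "(\<And>a. a \<in> A \<Longrightarrow> bounded_mean (X a)) \<Longrightarrow> bounded_mean (\<lambda>N l. \<Sum>a\<in>A. X a N l)"
  by (induction A rule: infinite_finite_induct) (auto intro: bounded_mean_add bounded_mean_const)

text \<open>The index set \<open>J\<close> only labels the factors. The map \<open>\<alpha>\<close> need not be injective, so powers of one \<open>Y(x\<^sup>a)\<close> are included.\<close>

definition monomial :: "nat set \<Rightarrow> (nat \<Rightarrow> nat) \<Rightarrow> nat \<Rightarrow> (nat \<Rightarrow> real) \<Rightarrow> real" where
  "monomial J \<alpha> N l = (\<Prod>i\<in>J. Y N (monom 1 (\<alpha> i)) l)"

lemma tame_monomial: "tame (I N) (monomial J \<alpha> N)"
  unfolding monomial_def[abs_def] by (intro tame_prod tame_Y)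

lemma monomial_cong: "(\<And>i. i \<in> J \<Longrightarrow> \<alpha> i = \<alpha>' i) \<Longrightarrow> monomial J \<alpha> = monomial J \<alpha>'"
  by (intro ext) (simp add: monomial_def)

lemma monomial_insert:
  assumes "finite J" "j \<notin> J"
  shows "monomial (insert j J) (\<alpha>(j := a)) N l = monomial J \<alpha> N l * Y N (monom 1 a) l"
  using assms monomial_cong[of J "\<alpha>(j := a)" \<alpha>] by (auto simp: monomial_def mult.commute intro!: prod.cong)

definition dmonomial :: "nat set \<Rightarrow> (nat \<Rightarrow> nat) \<Rightarrow> nat \<Rightarrow> nat \<Rightarrow> (nat \<Rightarrow> real) \<Rightarrow> real" where
  "dmonomial J \<alpha> N k l = (\<Sum>i\<in>J. poly (pderiv (monom 1 (\<alpha> i))) (l k) / sqrt (real N) * monomial (J - {i}) \<alpha> N l)"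

lemma monomial_has_derivative:
  assumes k: "k \<in> I N"
  shows "((\<lambda>x. monomial J \<alpha> N (l(k := x))) has_real_derivative dmonomial J \<alpha> N k (l(k := x))) (at x)"
  unfolding monomial_def dmonomial_def by (rule has_field_derivative_prod) (rule Y_has_derivative[OF k])

lemma tame_dmonomial: "k \<in> I N \<Longrightarrow> tame (I N) (dmonomial J \<alpha> N k)"
  unfolding dmonomial_def[abs_def] divide_inverse
  by (intro tame_sum tame_mult tame_const tame_monomial tame_poly_coordinate) auto

lemma continuous_on_dmonomial:
  assumes k: "k \<in> I N"
  shows "continuous_on UNIV (\<lambda>x. dmonomial J \<alpha> N k (l(k := x)))"
  unfolding dmonomial_def divide_inverse
  by (intro continuous_intros continuous_on_poly continuous_on_update[of 1]
      continuous_at_imp_continuous_on ballI DERIV_isCont[OF monomial_has_derivative[OF k]]) auto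

lemma monom_times_pderiv: "monom 1 d * pderiv (monom 1 a) = smult (real a) (monom 1 (d + (a - 1)) :: real poly)"
  by (cases a) (simp_all add: pderiv_monom mult_monom smult_monom)

lemma sum_dmonomial:
  assumes N: "N \<ge> 1"
  shows "1 / sqrt (real N) * (\<Sum>k=1..N. l k ^ d * dmonomial J \<alpha> N k l)
    = (\<Sum>i\<in>J. real (\<alpha> i) * (avg N (monom 1 (d + (\<alpha> i - 1))) l * monomial (J - {i}) \<alpha> N l))"
proof -
  have s: "sqrt (real N) * sqrt (real N) = real N" by simp
  have "1 / sqrt (real N) * (\<Sum>k=1..N. l k ^ d * dmonomial J \<alpha> N k l)
    = (\<Sum>k=1..N. \<Sum>i\<in>J. poly (monom 1 d * pderiv (monom 1 (\<alpha> i))) (l k) / real N * monomial (J - {i}) \<alpha> N l)"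
  proof -
    have "1 / r * (u * (v / r * M)) = u * v / (r * r) * M" for r u v M :: real by simp
    then show ?thesis
      unfolding dmonomial_def sum_distrib_left by (intro sum.cong refl) (simp only: s poly_mult poly_monom mult_1)
  qed
  also have "\<dots> = (\<Sum>i\<in>J. \<Sum>k=1..N. poly (monom 1 d * pderiv (monom 1 (\<alpha> i))) (l k) / real N * monomial (J - {i}) \<alpha> N l)"
    by (rule sum.swap)
  also have "\<dots> = (\<Sum>i\<in>J. avg N (monom 1 d * pderiv (monom 1 (\<alpha> i))) l * monomial (J - {i}) \<alpha> N l)"
    by (simp add: avg_def sum_divide_distrib sum_distrib_right)
  finally show ?thesis by (simp only: monom_times_pderiv avg_smult mult.assoc)
qed

lemma \<Lambda>_monom: "\<Lambda> (monom 1 d) = monom 1 (Suc d) - smult (real d) (monom 1 (d - 1)) - smult (2 * c) (\<Sum>a<d. smult (L (monom 1 (d - 1 - a))) (monom 1 a))"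
  using monom_times_pderiv[of 0 d] by (simp add: \<Lambda>_def Q_monom monom_Suc smult_monom monom_0 flip: one_pCons)

text \<open>Induction on the total degree \<open>\<Sum> \<alpha> i\<close>. If all exponents are zero, the product is empty or zero, as \<open>Y(1) = 0\<close>.
Otherwise single out a factor \<open>Y(x\<^bsup>d+1\<^esup>)\<close> and let \<open>G\<close> be the product of the others. Up to terms of degree at most \<open>d - 1\<close>,
\<open>x\<^bsup>d+1\<^esup>\<close> is \<open>\<Lambda>(x\<^sup>d)\<close>, to which the loop equation applies. In every resulting term the degree has dropped by at least two: the
products \<open>Y(x\<^bsup>d-1-a\<^esup>) Y(x\<^sup>a)\<close> have degree \<open>d - 1\<close> in place of \<open>d + 1\<close>, and differentiating a factor \<open>Y(x\<^bsup>b\<^esup>)\<close> of \<open>G\<close>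
merges it with \<open>x\<^sup>d\<close> into \<open>Y(x\<^bsup>d+b-1\<^esup>)\<close> plus a constant.\<close>

lemma bounded_mean_monomial: "finite J \<Longrightarrow> bounded_mean (monomial J \<alpha>)"
proof (induction "\<Sum>i\<in>J. \<alpha> i" arbitrary: J \<alpha> rule: less_induct)
  case less
  show ?case
  proof (cases "\<exists>i\<in>J. \<alpha> i > 0")
    case False
    show ?thesis
    proof (cases "J = {}")
      case True
      then show ?thesis using bounded_mean_const[of 1] by (simp add: monomial_def[abs_def])
    next
      case nonempty: False
      then obtain i where i: "i \<in> J" "\<alpha> i = 0" using False by auto
      show ?thesis
      proof (rule bounded_mean_cong[OF bounded_mean_const[of 0]])
        fix N :: nat and l assume "N \<ge> 1"
        then have "Y N (monom 1 (\<alpha> i)) l = 0" using i Y_const[of N 1] by (simp add: monom_0)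
        then show "monomial J \<alpha> N l = 0" unfolding monomial_def by (intro prod_zero less.prems bexI[OF _ i(1)])
      qed
    qed
  next
    case True
    then obtain i0 d where i0: "i0 \<in> J" "\<alpha> i0 = Suc d" by (metis gr0_implies_Suc)
    define J' where "J' = J - {i0}"
    define w where "w = (\<Sum>i\<in>J'. \<alpha> i)"
    have J': "finite J'" "J = insert i0 J'" "i0 \<notin> J'" using less.prems i0 by (auto simp: J'_def)
    have w: "(\<Sum>i\<in>J. \<alpha> i) = w + Suc d" using J' i0 by (simp add: w_def)
    (* A fresh label: a product of two factors can take the place of the single factor at i0. *)
    obtain j where j: "j \<notin> J" using ex_new_if_finite[OF infinite_UNIV_nat less.prems] by blast
    define G where "G = monomial J' \<alpha>"
    let ?y = "\<lambda>N a l. Y N (monom 1 a) l"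
    let ?yy = "\<lambda>N l. \<Sum>a<d. ?y N (d - 1 - a) l * ?y N a l"
    let ?my = "\<lambda>N l. \<Sum>a<d. L (monom 1 (d - 1 - a)) * ?y N a l"
    have up0: "(\<Sum>i\<in>J'. (\<alpha>(i0 := b)) i) = w" for b
      unfolding w_def using J' by (intro sum.cong) auto
    have bG: "bounded_mean G"
      unfolding G_def by (rule less.hyps) (use J' w in \<open>auto simp: w_def[symmetric]\<close>)
    have bG1: "bounded_mean (\<lambda>N l. G N l * ?y N b l)" if "b \<le> d" for b
    proof -
      have "bounded_mean (monomial J (\<alpha>(i0 := b)))"
        by (rule less.hyps) (use J' w up0[of b] that in auto)
      then show ?thesis unfolding J'(2) G_def by (rule bounded_mean_cong) (simp add: monomial_insert J')
    qed
    have bG2: "bounded_mean (\<lambda>N l. G N l * ?y N b l * ?y N a l)" if "a + b \<le> d" for a b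
    proof -
      have "(\<Sum>i\<in>J. (\<alpha>(i0 := b, j := a)) i) = (\<Sum>i\<in>J. (\<alpha>(i0 := b)) i)"
        using j by (intro sum.cong) auto
      then have "(\<Sum>i\<in>insert j J. (\<alpha>(i0 := b, j := a)) i) = a + (b + w)"
        using j less.prems J' up0[of b] by simp
      then have "bounded_mean (monomial (insert j J) (\<alpha>(i0 := b, j := a)))"
        by (intro less.hyps) (use w that less.prems in auto)
      then show ?thesis
      proof (rule bounded_mean_cong)
        show "G N l * ?y N b l * ?y N a l = monomial (insert j J) (\<alpha>(i0 := b, j := a)) N l" for N l
          unfolding monomial_insert[OF less.prems j] unfolding J'(2) G_def monomial_insert[OF J'(1,3)] ..
      qed
    qed
    (* R is the sum of all terms that the loop equation produces from the monomial; ?R below writes it as a combination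
       of monomials to which the induction hypothesis applies. *)
    define R where "R N l = G N l * (real d * ?y N (d - 1) l + 2 * c * ?my N l)
       + (G N l * (c / sqrt (real N) * (?yy N l - avg N (pderiv (monom 1 d)) l))
         + 1 / sqrt (real N) * (\<Sum>k=1..N. l k ^ d * dmonomial J' \<alpha> N k l))" for N l
    let ?R = "\<lambda>N l. (real d * (G N l * ?y N (d - 1) l) + (\<Sum>a<d. (2 * c * L (monom 1 (d - 1 - a))) * (G N l * ?y N a l)))
         + (1 / sqrt (real N) * ((\<Sum>a<d. c * (G N l * ?y N (d - 1 - a) l * ?y N a l))
              + (- c * real d * L (monom 1 (d - 1))) * G N l)
            + 1 / sqrt (real N) * (1 / sqrt (real N) * ((- c * real d) * (G N l * ?y N (d - 1) l)))
         + (\<Sum>i\<in>J'. real (\<alpha> i) * (L (monom 1 (d + (\<alpha> i - 1))) * monomial (J' - {i}) \<alpha> N l + 1 / sqrt (real N) * (monomial (J' - {i}) \<alpha> N l * ?y N (d + (\<alpha> i - 1)) l))))"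
    have "bounded_mean R"
    proof (rule bounded_mean_cong)
      show "bounded_mean ?R"
      proof (intro bounded_mean_add bounded_mean_sum bounded_mean_cmult bounded_mean_sqrt bG bG1 bG2)
        fix i assume i: "i \<in> J'"
        have wi: "w = \<alpha> i + (\<Sum>i\<in>J' - {i}. \<alpha> i)" unfolding w_def using J' i by (simp add: sum.remove)
        show "bounded_mean (monomial (J' - {i}) \<alpha>)"
          by (rule less.hyps) (use w wi J' in auto)
        show "bounded_mean (\<lambda>N l. monomial (J' - {i}) \<alpha> N l * ?y N (d + (\<alpha> i - 1)) l)"
        proof (cases "\<alpha> i = 0 \<and> d = 0")
          case True
          show ?thesis
            by (rule bounded_mean_cong[OF bounded_mean_const[of 0]]) (use True Y_const[of _ 1] in \<open>simp add: monom_0\<close>)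
        next
          case False
          have "(\<Sum>x\<in>J' - {i}. (\<alpha>(i := d + (\<alpha> i - 1))) x) = (\<Sum>x\<in>J' - {i}. \<alpha> x)" by (intro sum.cong) auto
          then have "(\<Sum>x\<in>J'. (\<alpha>(i := d + (\<alpha> i - 1))) x) = d + (\<alpha> i - 1) + (\<Sum>x\<in>J' - {i}. \<alpha> x)"
            using J'(1) i by (simp add: sum.remove)
          then have "bounded_mean (monomial J' (\<alpha>(i := d + (\<alpha> i - 1))))"
            by (intro less.hyps) (use w wi J' in auto)
          then show ?thesis
            by (rule bounded_mean_cong) (use monomial_insert[of "J' - {i}" i \<alpha> "d + (\<alpha> i - 1)"] J' i in \<open>simp add: insert_absorb\<close>)
        qed
      qed auto
    next
      fix N :: nat and l assume N: "N \<ge> 1"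
      define r where "r = 1 / sqrt (real N)"
      have cr: "c / sqrt (real N) = c * r" by (simp add: r_def)
      have av: "avg N (pderiv (monom 1 d)) l = real d * (L (monom 1 (d - 1)) + ?y N (d - 1) l * r)"
        using monom_times_pderiv[of 0 d] avg_Y[OF N, of "monom 1 (d - 1)"] by (simp add: avg_smult monom_0 r_def flip: one_pCons)
      show "R N l = ?R N l"
      proof -
        have "(\<Sum>i\<in>J'. real (\<alpha> i) * (avg N (monom 1 (d + (\<alpha> i - 1))) l * monomial (J' - {i}) \<alpha> N l)) = (\<Sum>i\<in>J'. real (\<alpha> i) * (L (monom 1 (d + (\<alpha> i - 1))) * monomial (J' - {i}) \<alpha> N l + 1 / sqrt (real N) * (monomial (J' - {i}) \<alpha> N l * ?y N (d + (\<alpha> i - 1)) l)))"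
          by (intro sum.cong refl) (simp add: avg_Y[OF N] algebra_simps)
        moreover have "(\<Sum>a<d. (2 * c * L (monom 1 (d - 1 - a))) * (G N l * ?y N a l)) = G N l * (2 * c * ?my N l)"
          unfolding sum_distrib_left by (intro sum.cong refl) (simp add: mult_ac)
        moreover have "(\<Sum>a<d. c * (G N l * ?y N (d - 1 - a) l * ?y N a l)) = G N l * c * ?yy N l"
          unfolding sum_distrib_left by (intro sum.cong refl) (simp add: mult_ac)
        ultimately show ?thesis
          unfolding R_def sum_dmonomial[OF N] av cr unfolding r_def[symmetric]
          by (simp only:) (simp add: algebra_simps)
      qed
    qed
    have E_eq: "E N (monomial J \<alpha> N) = E N (R N)" if N: "N \<ge> 1" for N
    proof -
      have monomial_J: "monomial J \<alpha> N l = G N l * (real d * ?y N (d - 1) l + 2 * c * ?my N l) + G N l * Y N (\<Lambda> (monom 1 d)) l" for l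
      proof -
        have "monomial J \<alpha> N l = G N l * ?y N (Suc d) l"
          using monomial_insert[OF J'(1,3), of \<alpha> "Suc d"] i0 fun_upd_triv[of \<alpha> i0] by (simp add: J'(2) G_def)
        then show ?thesis by (simp add: \<Lambda>_monom Y_add Y_diff Y_smult Y_sum algebra_simps)
      qed
      have t1: "tame (I N) (\<lambda>l. G N l * (real d * ?y N (d - 1) l + 2 * c * ?my N l))"
        unfolding G_def by (intro tame_mult tame_monomial tame_add tame_const tame_sum tame_Y)
      have t2: "tame (I N) (\<lambda>l. G N l * Y N (\<Lambda> (monom 1 d)) l)"
        unfolding G_def by (intro tame_mult tame_monomial tame_Y)
      have t3: "tame (I N) (\<lambda>l. G N l * (c / sqrt (real N) * (?yy N l - avg N (pderiv (monom 1 d)) l)))"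
        unfolding G_def by (intro tame_mult tame_monomial tame_diff tame_const tame_sum tame_Y tame_avg)
      have t4: "tame (I N) (\<lambda>l. 1 / sqrt (real N) * (\<Sum>k=1..N. l k ^ d * dmonomial J' \<alpha> N k l))"
        by (intro tame_mult tame_const tame_sum tame_power tame_dmonomial tame_coordinate) auto
      have "E N (monomial J \<alpha> N) = E N (\<lambda>l. G N l * (real d * ?y N (d - 1) l + 2 * c * ?my N l)) + E N (\<lambda>l. G N l * Y N (\<Lambda> (monom 1 d)) l)"
        unfolding monomial_J by (rule E_add[OF N t1 t2])
      also have "E N (\<lambda>l. G N l * Y N (\<Lambda> (monom 1 d)) l) = E N (\<lambda>l. G N l * (c / sqrt (real N) * (?yy N l - avg N (pderiv (monom 1 d)) l)))
         + E N (\<lambda>l. 1 / sqrt (real N) * (\<Sum>k=1..N. l k ^ d * dmonomial J' \<alpha> N k l))"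
        unfolding G_def by (rule loop_equation_Y[OF N tame_monomial tame_dmonomial monomial_has_derivative continuous_on_dmonomial])
      also have "\<dots> = E N (\<lambda>l. G N l * (c / sqrt (real N) * (?yy N l - avg N (pderiv (monom 1 d)) l)) + 1 / sqrt (real N) * (\<Sum>k=1..N. l k ^ d * dmonomial J' \<alpha> N k l))"
        by (rule E_add[OF N t3 t4, symmetric])
      finally show ?thesis unfolding R_def using E_add[OF N t1 tame_add[OF t3 t4]] by simp
    qed
    show ?thesis
      using \<open>bounded_mean R\<close> tame_monomial E_eq unfolding bounded_mean_def by auto
  qed
qed

end

section \<open>From moments to weak convergence\<close>

text \<open>The \<open>k\<close>-th moment of the centred Gaussian law with variance \<open>V\<close>.\<close>

definition gaussian_moment :: "real \<Rightarrow> nat \<Rightarrow> real" where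
  "gaussian_moment V k = (if even k then V ^ (k div 2) * (fact k / (2 ^ (k div 2) * fact (k div 2))) else 0)"

lemma gaussian_moment_even: "gaussian_moment V (2 * m) = V ^ m * (fact (2 * m) / (2 ^ m * fact m))"
  by (simp add: gaussian_moment_def)

lemma gaussian_moment_rec: "gaussian_moment V (Suc k) = real k * V * gaussian_moment V (k - 1)"
proof (cases "even k")
  case True
  then show ?thesis by (cases k) (auto simp: gaussian_moment_def)
next
  case False
  then obtain j where k: "k = Suc (2 * j)" by (metis oddE add.commute plus_1_eq_Suc)
  have cancel: "(2 * real j + 2) * F / (2 * (T * (real j + 1) * J)) = F / (T * J)" for F T J :: real
  proof -
    have "(2 * real j + 2) * F / (2 * (T * (real j + 1) * J)) = ((2 * real j + 2) * F) / ((2 * real j + 2) * (T * J))"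
      by (simp add: algebra_simps)
    also have "\<dots> = F / (T * J)" by (rule mult_divide_mult_cancel_left) linarith
    finally show ?thesis .
  qed
  have "fact (2 * Suc j) = (2 * real j + 2) * ((2 * real j + 1) * fact (2 * j))"
    "2 ^ Suc j * fact (Suc j) = 2 * (2 ^ j * (real j + 1) * fact j)" by (simp_all add: algebra_simps)
  then have "gaussian_moment V (2 * Suc j) = V ^ Suc j * (((2 * real j + 1) * fact (2 * j)) / (2 ^ j * fact j))"
    by (simp only: gaussian_moment_even cancel)
  then show ?thesis by (simp add: k gaussian_moment_even)
qed

text \<open>Truncated at an even order, the formal series of the characteristic function is the exponential series at \<open>- V/2\<close>.\<close>

lemma gaussian_moment_series:
  "(\<Sum>k\<le>2 * j. (\<i> * complex_of_real 1) ^ k / fact k * of_real (gaussian_moment V k)) = of_real (\<Sum>m\<le>j. (- V / 2) ^ m /\<^sub>R fact m)"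
proof (induction j)
  case (Suc j)
  have "2 * Suc j = Suc (Suc (2 * j))" by simp
  then have "(\<Sum>k\<le>2 * Suc j. (\<i> * complex_of_real 1) ^ k / fact k * of_real (gaussian_moment V k))
    = (\<Sum>k\<le>2 * j. (\<i> * complex_of_real 1) ^ k / fact k * of_real (gaussian_moment V k)) + (\<i> ^ (2 * Suc j) / fact (2 * Suc j) * of_real (gaussian_moment V (2 * Suc j)))"
    by (simp add: gaussian_moment_def)
  moreover have "\<i> ^ (2 * Suc j) / fact (2 * Suc j) * complex_of_real (gaussian_moment V (2 * Suc j)) = of_real ((- V / 2) ^ Suc j /\<^sub>R fact (Suc j))"
  proof -
    have "\<i> ^ (2 * Suc j) = complex_of_real ((- 1) ^ Suc j)" by (simp only: power_mult) simp
    moreover have "fact (2 * Suc j) = complex_of_real (fact (2 * Suc j))" by (simp only: of_real_fact)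
    moreover have "(- 1) ^ m / F * (V ^ m * (F / (2 ^ m * K))) = (- V / 2) ^ m / K" if "F \<noteq> 0" for F K :: real and m
    proof -
      have "- V / 2 = (- 1) * (V / 2)" by simp
      then have "(- V / 2) ^ m = (- 1) ^ m * (V ^ m / 2 ^ m)" by (simp only: power_mult_distrib power_divide)
      then show ?thesis using that by simp
    qed
    then have "(- 1) ^ Suc j / fact (2 * Suc j) * gaussian_moment V (2 * Suc j) = (- V / 2) ^ Suc j / fact (Suc j)"
      unfolding gaussian_moment_even using fact_nonzero by blast
    moreover have "(- V / 2) ^ Suc j /\<^sub>R fact (Suc j) = (- V / 2) ^ Suc j / fact (Suc j)"
      by (simp only: real_scaleR_def divide_inverse mult.commute)
    ultimately show ?thesis by (simp only: of_real_divide[symmetric] of_real_mult[symmetric])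
  qed
  ultimately show ?case by (simp only: Suc.IH sum.atMost_Suc of_real_add)
qed (simp add: gaussian_moment_def)

text \<open>The Taylor polynomial of order \<open>2 j\<close> approximates the characteristic function up to twice the \<open>2 j\<close>-th moment divided by
\<open>(2 j)!\<close>. In the limit \<open>N \<rightarrow> \<infinity>\<close> this error is \<open>2 (V/2)\<^sup>j / j!\<close>, which is small for large \<open>j\<close>.\<close>

lemma char_tendsto_of_moments:
  fixes M :: "nat \<Rightarrow> 'a measure" and X :: "nat \<Rightarrow> 'a \<Rightarrow> real"
  assumes prob: "\<And>N. N \<ge> 1 \<Longrightarrow> prob_space (M N)"
    and meas: "\<And>N. N \<ge> 1 \<Longrightarrow> X N \<in> borel_measurable (M N)"
    and int: "\<And>N k. N \<ge> 1 \<Longrightarrow> integrable (M N) (\<lambda>\<omega>. X N \<omega> ^ k)"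
    and lim: "\<And>k. (\<lambda>N. LINT \<omega>|M N. X N \<omega> ^ k) \<longlonglongrightarrow> gaussian_moment V k"
  shows "(\<lambda>N. LINT \<omega>|M N. iexp (X N \<omega>)) \<longlonglongrightarrow> complex_of_real (exp (- V / 2))"
proof (rule tendstoI)
  fix e :: real assume e: "e > 0"
  let ?x = "- V / 2"
  have sums: "(\<lambda>n. ?x ^ n /\<^sub>R fact n) sums exp ?x" by (rule exp_converges)
  have "(\<lambda>n. norm (?x ^ n /\<^sub>R fact n)) \<longlonglongrightarrow> 0"
    using summable_LIMSEQ_zero[OF sums_summable[OF sums]] by (rule tendsto_norm_zero)
  then have "\<forall>\<^sub>F n in sequentially. norm (?x ^ n /\<^sub>R fact n) < e / 8" using e by (auto dest!: order_tendstoD(2)[of _ _ _ "e / 8"])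
  moreover have "(\<lambda>n. \<Sum>i\<le>n. ?x ^ i /\<^sub>R fact i) \<longlonglongrightarrow> exp ?x" using sums by (simp add: sums_def_le)
  then have "\<forall>\<^sub>F n in sequentially. dist (\<Sum>i\<le>n. ?x ^ i /\<^sub>R fact i) (exp ?x) < e / 4" using e by (auto dest!: tendstoD[of _ _ _ "e / 4"])
  ultimately have "\<forall>\<^sub>F n in sequentially. norm (?x ^ n /\<^sub>R fact n) < e / 8 \<and> dist (\<Sum>i\<le>n. ?x ^ i /\<^sub>R fact i) (exp ?x) < e / 4"
    by (rule eventually_conj)
  then obtain j where j: "norm (?x ^ j /\<^sub>R fact j) < e / 8" "dist (\<Sum>i\<le>j. ?x ^ i /\<^sub>R fact i) (exp ?x) < e / 4"
    using eventually_happens'[OF sequentially_bot] by blast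
  let ?S = "\<lambda>N. \<Sum>k\<le>2 * j. (\<i> * complex_of_real 1) ^ k / fact k * of_real (LINT \<omega>|M N. X N \<omega> ^ k)"
  have S: "?S \<longlonglongrightarrow> of_real (\<Sum>m\<le>j. ?x ^ m /\<^sub>R fact m)"
    unfolding gaussian_moment_series[symmetric] by (intro tendsto_intros lim)
  have tail: "(\<lambda>N. 2 / fact (2 * j) * (LINT \<omega>|M N. X N \<omega> ^ (2 * j))) \<longlonglongrightarrow> 2 / fact (2 * j) * gaussian_moment V (2 * j)"
    by (intro tendsto_intros lim)
  have "2 / fact (2 * j) * gaussian_moment V (2 * j) < e / 4"
  proof -
    have "(V / 2) ^ j / fact j \<le> norm (?x ^ j /\<^sub>R fact j)"
    proof -
      have "norm (u /\<^sub>R fact j) = \<bar>u\<bar> / fact j" for u :: real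
        by (simp add: divide_inverse mult.commute abs_mult)
      moreover have "\<bar>?x ^ j\<bar> = \<bar>(V / 2) ^ j\<bar>" by (simp add: power_abs)
      ultimately have "norm (?x ^ j /\<^sub>R fact j) = \<bar>(V / 2) ^ j\<bar> / fact j" by (simp only:)
      then show ?thesis by (simp add: divide_right_mono)
    qed
    moreover have "2 / fact (2 * j) * gaussian_moment V (2 * j) = 2 * ((V / 2) ^ j / fact j)"
      by (simp add: gaussian_moment_def power_divide)
    ultimately show ?thesis using j(1) by linarith
  qed
  then have "\<forall>\<^sub>F N in sequentially. 2 / fact (2 * j) * (LINT \<omega>|M N. X N \<omega> ^ (2 * j)) < e / 4"
    using order_tendstoD(2)[OF tail] by blast
  moreover have "\<forall>\<^sub>F N in sequentially. dist (?S N) (of_real (\<Sum>m\<le>j. ?x ^ m /\<^sub>R fact m)) < e / 4"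
    using tendstoD[OF S, of "e / 4"] e by simp
  moreover have "\<forall>\<^sub>F N in sequentially. N \<ge> (1::nat)" by (rule eventually_ge_at_top)
  ultimately show "\<forall>\<^sub>F N in sequentially. dist (LINT \<omega>|M N. iexp (X N \<omega>)) (complex_of_real (exp (- V / 2))) < e"
  proof eventually_elim
    case (elim N)
    interpret prob_space "M N" by (rule prob) fact
    have "cmod (char (distr (M N) borel (X N)) 1 - (\<Sum>k\<le>2 * j. ((\<i> * complex_of_real 1) ^ k / fact k) * expectation (\<lambda>x. X N x ^ k)))
      \<le> (2 * \<bar>1\<bar> ^ (2 * j) / fact (2 * j)) * expectation (\<lambda>x. \<bar>X N x\<bar> ^ (2 * j))"
      by (rule char_approx1') (use int meas elim in auto)
    moreover have "char (distr (M N) borel (X N)) 1 = (LINT \<omega>|M N. iexp (X N \<omega>))"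
      unfolding char_def by (subst integral_distr) (use meas elim in auto)
    moreover have "\<bar>X N x\<bar> ^ (2 * j) = X N x ^ (2 * j)" for x by (simp add: power_mult)
    ultimately have "cmod ((LINT \<omega>|M N. iexp (X N \<omega>)) - ?S N) < e / 4"
      using elim(1) by simp
    moreover have "dist (complex_of_real (\<Sum>m\<le>j. ?x ^ m /\<^sub>R fact m)) (of_real (exp ?x)) < e / 4"
      using j(2) by (simp only: dist_of_real)
    ultimately show ?case
      using elim(2) e dist_triangle[of "LINT \<omega>|M N. iexp (X N \<omega>)" "of_real (exp ?x)" "?S N"]
        dist_triangle[of "?S N" "of_real (exp ?x)" "complex_of_real (\<Sum>m\<le>j. ?x ^ m /\<^sub>R fact m)"]
      unfolding dist_norm by linarith
  qed
qed

text \<open>Real trigonometric polynomials in the coordinates from \<open>I\<close>; the shift \<open>s\<close> makes sines a special case. These are the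
functions whose integrals a characteristic function determines.\<close>

inductive trig :: "nat set \<Rightarrow> ((nat \<Rightarrow> real) \<Rightarrow> real) \<Rightarrow> bool" for I where
  cosine: "trig I (\<lambda>x. a * cos ((\<Sum>i\<in>I. t i * x i) + s))"
| add: "trig I f \<Longrightarrow> trig I g \<Longrightarrow> trig I (\<lambda>x. f x + g x)"

lemma trig_const: "trig I (\<lambda>_. a)"
  using trig.cosine[of I a "\<lambda>_. 0" 0] by simp

lemma trig_mult:
  assumes "trig I f" "trig I g"
  shows "trig I (\<lambda>x. f x * g x)"
  using assms
proof (induction f rule: trig.induct)
  case (cosine a t s)
  from cosine.prems show ?case
  proof (induction g rule: trig.induct)
    case (cosine b u r)
    have "(a * cos ((\<Sum>i\<in>I. t i * x i) + s)) * (b * cos ((\<Sum>i\<in>I. u i * x i) + r))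
      = a * b / 2 * cos ((\<Sum>i\<in>I. (t i - u i) * x i) + (s - r)) + a * b / 2 * cos ((\<Sum>i\<in>I. (t i + u i) * x i) + (s + r))" for x
    proof -
      have "(\<Sum>i\<in>I. (t i - u i) * x i) + (s - r) = ((\<Sum>i\<in>I. t i * x i) + s) - ((\<Sum>i\<in>I. u i * x i) + r)"
        "(\<Sum>i\<in>I. (t i + u i) * x i) + (s + r) = ((\<Sum>i\<in>I. t i * x i) + s) + ((\<Sum>i\<in>I. u i * x i) + r)"
        by (simp_all add: sum_subtractf sum.distrib algebra_simps)
      moreover have "(a * cos w) * (b * cos z) = a * b / 2 * cos (w - z) + a * b / 2 * cos (w + z)" for w z
        using cos_times_cos[of w z] by (simp add: field_simps)
      ultimately show ?thesis by (simp only:)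
    qed
    then show ?case by (simp only:) (intro trig.intros)
  next
    case (add g h)
    then show ?case using trig.add[OF add.IH] by (simp add: distrib_left)
  qed
next
  case (add f h)
  then show ?case using trig.add[OF add.IH(1)[OF add.prems] add.IH(2)[OF add.prems]] by (simp add: distrib_right)
qed

lemma trig_bounded:
  assumes "trig I f"
  shows "\<exists>K. \<forall>x. \<bar>f x\<bar> \<le> K"
  using assms
proof induction
  case (cosine a t s)
  have "\<bar>a * cos z\<bar> \<le> \<bar>a\<bar>" for z unfolding abs_mult by (rule mult_left_le) auto
  then show ?case by blast
next
  case (add f g)
  then obtain K K' where "\<And>x. \<bar>f x\<bar> \<le> K" "\<And>x. \<bar>g x\<bar> \<le> K'" by blast
  then have "\<bar>f x + g x\<bar> \<le> K + K'" for x using abs_triangle_ineq[of "f x" "g x"] by (smt (verit))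
  then show ?case by blast
qed

lemma trig_continuous:
  assumes "trig I f"
  shows "continuous_on S f"
  using assms
proof induction
  case (cosine a t s)
  have "continuous_on S (\<lambda>x::nat \<Rightarrow> real. x i)" for i
    by (rule continuous_on_product_coordinates[THEN continuous_on_subset]) simp
  then show ?case by (intro continuous_intros)
qed (intro continuous_intros)

lemma trig_polynomial:
  assumes "real_polynomial_function q" "trig I f"
  shows "trig I (\<lambda>x. q (f x))"
  using assms(1)
proof induction
  case (linear h)
  then interpret bounded_linear h .
  have "h u = h 1 * u" for u :: real
    using scaleR[of u 1] by (simp add: mult.commute)
  then have "(\<lambda>x. h (f x)) = (\<lambda>x. h 1 * f x)" by (intro ext)
  then show ?case using trig_mult[OF trig_const[of I "h 1"] assms(2)] by (simp only:)
next
  case (const a)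
  show ?case by (rule trig_const)
next
  case (add f g)
  then show ?case by (intro trig.add)
next
  case (mult f g)
  then show ?case by (intro trig_mult)
qed

text \<open>By the Stone-Weierstrass theorem a trigonometric polynomial approximates \<open>g\<close> on the box, but outside the box it may be large.
Composing it with a polynomial close to the truncation \<open>u \<mapsto> max (- B) (min B u)\<close> on the range of the first one restores
the bound everywhere and hardly changes the values near \<open>[-B, B]\<close>.\<close>

lemma clamped_trig_approximation:
  fixes g :: "(nat \<Rightarrow> real) \<Rightarrow> real"
  assumes I: "finite I" and g: "continuous_on UNIV g" and B: "\<And>x. \<bar>g x\<bar> \<le> B" and R: "R > 0" and e: "e > 0"
  obtains T where "trig I T" "\<And>x. \<bar>T x\<bar> \<le> B + e"
    "\<And>x. x \<in> I \<rightarrow>\<^sub>E {-R..R} \<Longrightarrow> \<bar>g x - T x\<bar> \<le> 2 * e"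
proof -
  let ?S = "I \<rightarrow>\<^sub>E {-R..R}"
  have "compactin (product_topology (\<lambda>_. euclideanreal) UNIV) (Pi\<^sub>E UNIV (\<lambda>i. if i \<in> I then {-R..R} else {undefined}))"
    unfolding compactin_PiE by auto
  moreover have "Pi\<^sub>E UNIV (\<lambda>i. if i \<in> I then {-R..R} else {undefined}) = ?S"
    by (auto simp: PiE_iff extensional_def split: if_splits)
  ultimately have comp: "compact ?S"
    by (simp add: euclidean_product_topology)
  obtain T0 where T0: "trig I T0" "\<And>x. x \<in> ?S \<Longrightarrow> \<bar>g x - T0 x\<bar> < e"
  proof -
    have "\<exists>T. trig I T \<and> (\<forall>x\<in>?S. \<bar>g x - T x\<bar> < e)"
    proof (rule Stone_Weierstrass_HOL[OF comp])
      show "continuous_on ?S g" using g continuous_on_subset by blast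
      show "\<exists>f. trig I f \<and> f x \<noteq> f y" if "x \<in> ?S \<and> y \<in> ?S \<and> x \<noteq> y" for x y
      proof -
        have "\<exists>i\<in>I. x i \<noteq> y i"
        proof (rule ccontr)
          assume "\<not> (\<exists>i\<in>I. x i \<noteq> y i)"
          then have "x = y" using that by (intro PiE_ext[of x I "\<lambda>_. {-R..R}" y]) auto
          then show False using that by simp
        qed
        then obtain i where i: "i \<in> I" "x i \<noteq> y i" by blast
        have bnd: "\<bar>x i\<bar> \<le> R" "\<bar>y i\<bar> \<le> R" using that i by (auto simp: PiE_iff abs_le_iff)
        (* The sine of x i / R separates the points of the box, since the sine is injective on [-1, 1]. *)
        let ?f = "\<lambda>x. 1 * cos ((\<Sum>k\<in>I. (if k = i then 1 / R else 0) * x k) + (- pi / 2)) :: real"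
        have f: "?f x = sin (x i / R)" for x
        proof -
          have "(\<Sum>k\<in>I. (if k = i then 1 / R else 0) * x k) = x i / R"
            using I i by (subst sum.remove[of _ i]) auto
          then show ?thesis by (simp add: cos_diff)
        qed
        have r: "\<bar>u / R\<bar> \<le> pi / 2" if "\<bar>u\<bar> \<le> R" for u
        proof -
          have "\<bar>u / R\<bar> = \<bar>u\<bar> / R" using R by simp
          also have "\<dots> \<le> 1" using that R by (simp add: pos_divide_le_eq)
          finally show ?thesis using pi_gt3 by linarith
        qed
        have "sin (x i / R) \<noteq> sin (y i / R)"
        proof
          assume "sin (x i / R) = sin (y i / R)"
          then have "x i / R = y i / R"
          proof (rule sin_inj_pi[rotated 4])
            show "- (pi / 2) \<le> x i / R" "x i / R \<le> pi / 2" "- (pi / 2) \<le> y i / R" "y i / R \<le> pi / 2"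
              using r[OF bnd(1)] r[OF bnd(2)] by linarith+
          qed
          then show False using i R by simp
        qed
        then have "?f x \<noteq> ?f y" unfolding f .
        then show ?thesis using trig.cosine[of I 1 "\<lambda>k. if k = i then 1 / R else 0" "- pi / 2"] by blast
      qed
    qed (use e trig_const trig.add trig_mult trig_continuous in blast)+
    then show thesis using that by blast
  qed
  obtain K where K: "\<And>x. \<bar>T0 x\<bar> \<le> K" using trig_bounded[OF T0(1)] by blast
  have B0: "B \<ge> 0" using B[of undefined] by linarith
  define clamp where "clamp u = max (- B) (min B u)" for u :: real
  have "continuous_on {-K..K} clamp" unfolding clamp_def by (intro continuous_intros)
  from Stone_Weierstrass_real_polynomial_function[OF compact_Icc this e]
  obtain q where q: "real_polynomial_function q" "\<And>u. u \<in> {-K..K} \<Longrightarrow> \<bar>clamp u - q u\<bar> < e" by metis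
  have qT: "\<bar>clamp (T0 x) - q (T0 x)\<bar> < e" for x
    using K[of x] by (intro q(2)) (simp add: abs_le_iff)
  show thesis
  proof (rule that[OF trig_polynomial[OF q(1) T0(1)]])
    show "\<bar>q (T0 x)\<bar> \<le> B + e" for x
      using qT[of x] B0 unfolding clamp_def max_def min_def by (smt (verit))
    fix x assume "x \<in> ?S"
    then show "\<bar>g x - q (T0 x)\<bar> \<le> 2 * e"
      using qT[of x] T0(2)[of x] B[of x] unfolding clamp_def max_def min_def by (smt (verit))
  qed
qed

text \<open>Restriction extends \<open>g\<close> to all functions on \<open>nat\<close>, where the type class topology is available.\<close>

lemma continuous_map_restrict:
  assumes "continuous_map (product_topology (\<lambda>_. euclideanreal) I) euclideanreal g"
  shows "continuous_on UNIV (\<lambda>x :: nat \<Rightarrow> real. g (restrict x I))"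
proof -
  have "continuous_map euclidean (product_topology (\<lambda>_. euclideanreal) I) (\<lambda>x :: nat \<Rightarrow> real. restrict x I)"
    by (auto simp: continuous_map_componentwise intro: continuous_on_product_coordinates)
  from continuous_map_compose[OF this assms] show ?thesis by (simp add: o_def)
qed

lemma measurable_identity_PiM: "(\<lambda>y. y) \<in> measurable (Pi\<^sub>M I (\<lambda>_. borel)) (borel :: (nat \<Rightarrow> real) measure)"
proof -
  have "(\<lambda>y. y) \<in> measurable (Pi\<^sub>M I (\<lambda>_. borel)) (Pi\<^sub>M UNIV (\<lambda>_. borel :: real measure))"
  proof (rule measurable_PiM_single')
    fix i :: nat
    show "(\<lambda>y. y i) \<in> measurable (Pi\<^sub>M I (\<lambda>_. borel)) (borel :: real measure)"
    proof (cases "i \<in> I")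
      case False
      have "(\<lambda>y. y i) \<in> measurable (Pi\<^sub>M I (\<lambda>_. borel)) (borel :: real measure) \<longleftrightarrow> (\<lambda>y. undefined) \<in> measurable (Pi\<^sub>M I (\<lambda>_. borel :: real measure)) (borel :: real measure)"
        by (rule measurable_cong) (use False in \<open>auto simp: space_PiM PiE_iff extensional_def\<close>)
      then show ?thesis by simp
    qed measurable
  qed (auto simp: PiE_iff)
  then show ?thesis by (simp add: measurable_cong_sets[OF refl sets_PiM_equal_borel])
qed

text \<open>Characteristic functions give the convergence for trigonometric polynomials. For general \<open>g\<close>, choose one that is close on a
box and bounded outside; by Chebyshev's inequality and the common bound \<open>C\<close> on second moments the complement of a large
box has small mass under all the laws.\<close>

theorem weak_conv_vec_of_char:
  fixes \<mu> :: "nat \<Rightarrow> (nat \<Rightarrow> real) measure"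
  assumes I: "finite I"
    and prob: "\<And>N. N \<ge> 1 \<Longrightarrow> prob_space (\<mu> N)" and prob': "prob_space \<mu>'"
    and sets: "\<And>N. N \<ge> 1 \<Longrightarrow> sets (\<mu> N) = sets (Pi\<^sub>M I (\<lambda>_. borel))" and sets': "sets \<mu>' = sets (Pi\<^sub>M I (\<lambda>_. borel))"
    and char: "\<And>t. (\<lambda>N. LINT y|\<mu> N. iexp (\<Sum>i\<in>I. t i * y i)) \<longlonglongrightarrow> (LINT y|\<mu>'. iexp (\<Sum>i\<in>I. t i * y i))"
    and int: "\<And>N i. N \<ge> 1 \<Longrightarrow> i \<in> I \<Longrightarrow> integrable (\<mu> N) (\<lambda>y. (y i)\<^sup>2)"
    and bnd: "\<And>N i. N \<ge> 1 \<Longrightarrow> i \<in> I \<Longrightarrow> (LINT y|\<mu> N. (y i)\<^sup>2) \<le> C"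
    and int': "\<And>i. i \<in> I \<Longrightarrow> integrable \<mu>' (\<lambda>y. (y i)\<^sup>2)"
    and bnd': "\<And>i. i \<in> I \<Longrightarrow> (LINT y|\<mu>'. (y i)\<^sup>2) \<le> C"
  shows "weak_conv_vec I \<mu> \<mu>'"
  unfolding weak_conv_vec_def
proof (intro allI impI, elim conjE)
  fix g :: "(nat \<Rightarrow> real) \<Rightarrow> real"
  assume g: "continuous_map (product_topology (\<lambda>_. euclideanreal) I) euclideanreal g" and b: "bounded (g ` (I \<rightarrow>\<^sub>E UNIV))"
  define G where "G x = g (restrict x I)" for x
  have contG: "continuous_on UNIV G" unfolding G_def using continuous_map_restrict[OF g] .
  obtain B where B: "\<And>x. \<bar>G x\<bar> \<le> B"
  proof -
    obtain B where "\<And>x. x \<in> I \<rightarrow>\<^sub>E UNIV \<Longrightarrow> norm (g x) \<le> B" using b by (auto simp: bounded_iff)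
    then show thesis using that[of B] by (auto simp: G_def)
  qed
  have B0: "B \<ge> 0" using B[of undefined] by linarith
  have meas_cont: "f \<in> borel_measurable (Pi\<^sub>M I (\<lambda>_. borel))" if "continuous_on UNIV f" for f :: "(nat \<Rightarrow> real) \<Rightarrow> real"
    using measurable_compose[OF measurable_identity_PiM borel_measurable_continuous_onI[OF that]] .
  have space: "x \<in> I \<rightarrow>\<^sub>E UNIV" if "x \<in> space M" "sets M = sets (Pi\<^sub>M I (\<lambda>_. borel :: real measure))" for M x
    using that sets_eq_imp_space_eq[OF that(2)] by (simp add: space_PiM)
  have gG: "(LINT y|M. g y) = (LINT y|M. G y)" if "sets M = sets (Pi\<^sub>M I (\<lambda>_. borel :: real measure))" for M
    by (intro Bochner_Integration.integral_cong refl) (use space[OF _ that] in \<open>auto simp: G_def PiE_iff extensional_restrict\<close>)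
  have trig_int: "integrable M T" if T: "trig I T" "prob_space M" "sets M = sets (Pi\<^sub>M I (\<lambda>_. borel :: real measure))" for M T
  proof -
    interpret prob_space M by fact
    obtain K where "\<And>x. \<bar>T x\<bar> \<le> K" using trig_bounded[OF T(1)] by blast
    then show ?thesis
      using meas_cont[OF trig_continuous[OF T(1)]] measurable_cong_sets[OF T(3) refl]
      by (intro integrable_const_bound[of _ K]) auto
  qed
  have trig_lim: "(\<lambda>N. LINT y|\<mu> N. T y) \<longlonglongrightarrow> (LINT y|\<mu>'. T y)" if "trig I T" for T
    using that
  proof induction
    case (cosine a t s)
    have eq: "(LINT y|M. a * cos ((\<Sum>i\<in>I. t i * y i) + s)) = Re (of_real a * iexp s * (LINT y|M. iexp (\<Sum>i\<in>I. t i * y i)))"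
      if M: "prob_space M" "sets M = sets (Pi\<^sub>M I (\<lambda>_. borel :: real measure))" for M
    proof -
      interpret prob_space M by fact
      have [measurable]: "(\<lambda>y. y i) \<in> borel_measurable M" if "i \<in> I" for i
        using that by (simp add: measurable_cong_sets[OF M(2) refl])
      have m: "(\<lambda>y. \<Sum>i\<in>I. t i * y i) \<in> borel_measurable M" by (intro borel_measurable_sum) measurable
      have "integrable M (\<lambda>y. iexp (\<Sum>i\<in>I. t i * y i))"
        using m by (intro integrable_const_bound[of _ 1]) (auto simp del: of_real_sum)
      then have ii: "integrable M (\<lambda>y. of_real a * iexp s * iexp (\<Sum>i\<in>I. t i * y i))" by (rule integrable_mult_right)
      have e: "of_real a * iexp s * iexp (\<Sum>i\<in>I. t i * y i) = of_real a * cis ((\<Sum>i\<in>I. t i * y i) + s)" for y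
        by (simp add: cis_conv_exp exp_add algebra_simps del: of_real_sum)
      have "Re (of_real a * iexp s * iexp (\<Sum>i\<in>I. t i * y i)) = a * cos ((\<Sum>i\<in>I. t i * y i) + s)" for y
        unfolding e by simp
      then have "(LINT y|M. a * cos ((\<Sum>i\<in>I. t i * y i) + s)) = (LINT y|M. Re (of_real a * iexp s * iexp (\<Sum>i\<in>I. t i * y i)))" by simp
      also have "\<dots> = Re (LINT y|M. of_real a * iexp s * iexp (\<Sum>i\<in>I. t i * y i))" by (rule integral_Re[OF ii])
      finally show ?thesis by simp
    qed
    have "(\<lambda>N. Re (of_real a * iexp s * (LINT y|\<mu> N. iexp (\<Sum>i\<in>I. t i * y i)))) \<longlonglongrightarrow> Re (of_real a * iexp s * (LINT y|\<mu>'. iexp (\<Sum>i\<in>I. t i * y i)))"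
      by (intro tendsto_intros char)
    moreover have "\<forall>\<^sub>F N in sequentially. Re (of_real a * iexp s * (LINT y|\<mu> N. iexp (\<Sum>i\<in>I. t i * y i))) = (LINT y|\<mu> N. a * cos ((\<Sum>i\<in>I. t i * y i) + s))"
      using eventually_ge_at_top[of 1] by eventually_elim (rule eq[symmetric]; use prob sets in blast)
    ultimately show ?case unfolding eq[OF prob' sets'] by (rule Lim_transform_eventually)
  next
    case (add f h)
    have "\<forall>\<^sub>F N in sequentially. (LINT y|\<mu> N. f y) + (LINT y|\<mu> N. h y) = (LINT y|\<mu> N. f y + h y)"
      using eventually_ge_at_top[of 1]
      by eventually_elim (intro Bochner_Integration.integral_add[symmetric] trig_int add.hyps prob sets)
    moreover have "(LINT y|\<mu>'. f y + h y) = (LINT y|\<mu>'. f y) + (LINT y|\<mu>'. h y)"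
      by (intro Bochner_Integration.integral_add trig_int add.hyps prob' sets')
    ultimately show ?case using Lim_transform_eventually[OF tendsto_add[OF add.IH]] by simp
  qed
  have "(\<lambda>N. LINT y|\<mu> N. G y) \<longlonglongrightarrow> (LINT y|\<mu>'. G y)"
  proof (rule tendstoI)
    fix e0 :: real assume e0: "e0 > 0"
    define e where "e = min 1 (e0 / 8)"
    have e: "e > 0" "e \<le> 1" "8 * e \<le> e0" using e0 by (auto simp: e_def)
    (* The box [-R, R]^I is chosen so large that its complement contributes at most e. *)
    define A where "A = (2 * B + 1) * (real (card I) * \<bar>C\<bar>) / e"
    have A0: "A \<ge> 0" using B0 e by (simp add: A_def)
    define R where "R = sqrt (A + 1)"
    have R: "R > 0" "R\<^sup>2 = A + 1" using A0 by (auto simp: R_def)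
    obtain T where T: "trig I T" "\<And>x. \<bar>T x\<bar> \<le> B + e" "\<And>x. x \<in> I \<rightarrow>\<^sub>E {-R..R} \<Longrightarrow> \<bar>G x - T x\<bar> \<le> 2 * e"
      using clamped_trig_approximation[OF I contG B R(1) e(1)] by metis
    have close: "\<bar>(LINT y|M. G y) - (LINT y|M. T y)\<bar> \<le> 3 * e"
      if M: "prob_space M" "sets M = sets (Pi\<^sub>M I (\<lambda>_. borel :: real measure))"
        and i2: "\<And>i. i \<in> I \<Longrightarrow> integrable M (\<lambda>y. (y i)\<^sup>2)" and b2: "\<And>i. i \<in> I \<Longrightarrow> (LINT y|M. (y i)\<^sup>2) \<le> C" for M
    proof -
      interpret prob_space M by fact
      have iG: "integrable M G"
        using meas_cont[OF contG] measurable_cong_sets[OF M(2) refl] B by (intro integrable_const_bound[of _ B]) auto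
      note iT = trig_int[OF T(1) M]
      let ?h = "\<lambda>y. 2 * e + (2 * B + 1) / R\<^sup>2 * (\<Sum>i\<in>I. (y i)\<^sup>2)"
      have ih: "integrable M ?h" by (intro Bochner_Integration.integrable_add integrable_mult_right Bochner_Integration.integrable_sum i2) auto
      have "\<bar>G y - T y\<bar> \<le> ?h y" if y: "y \<in> space M" for y
      proof (cases "y \<in> I \<rightarrow>\<^sub>E {-R..R}")
        case True
        have "0 \<le> (2 * B + 1) / R\<^sup>2 * (\<Sum>i\<in>I. (y i)\<^sup>2)" using B0 by (intro mult_nonneg_nonneg sum_nonneg) auto
        then show ?thesis using T(3)[OF True] by linarith
      next
        case False
        then obtain i where i: "i \<in> I" "\<not> \<bar>y i\<bar> \<le> R" using space[OF y M(2)] by (auto simp: PiE_iff abs_le_iff)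
        have "R\<^sup>2 \<le> \<bar>y i\<bar>\<^sup>2" using i R by (intro power_mono) auto
        also have "\<dots> \<le> (\<Sum>i\<in>I. (y i)\<^sup>2)" using I i by (subst power2_abs) (intro member_le_sum, auto)
        finally have "1 \<le> (\<Sum>i\<in>I. (y i)\<^sup>2) / R\<^sup>2" using R(1) by (simp add: pos_le_divide_eq)
        then have "(2 * B + 1) * 1 \<le> (2 * B + 1) * ((\<Sum>i\<in>I. (y i)\<^sup>2) / R\<^sup>2)" using B0 by (intro mult_left_mono) auto
        moreover have "\<bar>G y - T y\<bar> \<le> 2 * B + 1" using B[of y] T(2)[of y] e by linarith
        ultimately show ?thesis using e by simp
      qed
      then have "\<bar>LINT y|M. G y - T y\<bar> \<le> (LINT y|M. ?h y)"
        using integral_mono[of M "\<lambda>y. \<bar>G y - T y\<bar>" ?h] integral_abs_bound[of M "\<lambda>y. G y - T y"] iG iT ih by (auto intro: order.trans)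
      also have "\<dots> = 2 * e + (2 * B + 1) / R\<^sup>2 * (\<Sum>i\<in>I. LINT y|M. (y i)\<^sup>2)"
        using i2 by (subst Bochner_Integration.integral_add) (auto simp: prob_space intro!: integrable_mult_right Bochner_Integration.integrable_sum)
      also have "\<dots> \<le> 2 * e + (2 * B + 1) / R\<^sup>2 * (\<Sum>i\<in>I. \<bar>C\<bar>)"
        using B0 b2 by (intro add_left_mono mult_left_mono sum_mono) force+
      also have "(2 * B + 1) / R\<^sup>2 * (\<Sum>i\<in>I. \<bar>C\<bar>) = A * e / (A + 1)"
        using e by (simp add: R A_def)
      also have "A * e / (A + 1) \<le> e" using A0 e by (simp add: divide_simps algebra_simps)
      finally show ?thesis using iG iT by simp
    qed
    have "\<forall>\<^sub>F N in sequentially. dist (LINT y|\<mu> N. T y) (LINT y|\<mu>'. T y) < e"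
      by (rule tendstoD[OF trig_lim[OF T(1)] e(1)])
    moreover have "\<forall>\<^sub>F N in sequentially. N \<ge> (1 :: nat)" by (rule eventually_ge_at_top)
    ultimately show "\<forall>\<^sub>F N in sequentially. dist (LINT y|\<mu> N. G y) (LINT y|\<mu>'. G y) < e0"
    proof eventually_elim
      case (elim N)
      have "\<bar>(LINT y|\<mu> N. G y) - (LINT y|\<mu> N. T y)\<bar> \<le> 3 * e"
        by (rule close) (use prob sets int bnd elim in auto)
      moreover have "\<bar>(LINT y|\<mu>'. G y) - (LINT y|\<mu>'. T y)\<bar> \<le> 3 * e"
        by (rule close) (use prob' sets' int' bnd' in auto)
      ultimately show ?case using elim(1) e unfolding dist_real_def by linarith
    qed
  qed
  moreover have "\<forall>\<^sub>F N in sequentially. (LINT y|\<mu> N. G y) = (LINT y|\<mu> N. g y)"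
    using eventually_ge_at_top[of 1] by eventually_elim (simp add: gG sets)
  ultimately show "(\<lambda>N. LINT y|\<mu> N. g y) \<longlonglongrightarrow> (LINT y|\<mu>'. g y)"
    unfolding gG[OF sets'] by (rule Lim_transform_eventually)
qed

section \<open>The moment recursion\<close>

context gbe
begin

text \<open>In contrast to \<open>bounded_mean\<close> this notion is stable under multiplication by any \<open>Y f\<close>, a linear combination of the \<open>Y(x\<^sup>a)\<close>.\<close>

definition robustly_bounded :: "(nat \<Rightarrow> (nat \<Rightarrow> real) \<Rightarrow> real) \<Rightarrow> bool" where
  "robustly_bounded X \<longleftrightarrow> (\<forall>J \<alpha>. finite J \<longrightarrow> bounded_mean (\<lambda>N l. X N l * monomial J \<alpha> N l))"

lemma robustly_bounded_bounded_mean: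
  assumes "robustly_bounded X"
  shows "bounded_mean X"
proof -
  have "bounded_mean (\<lambda>N l. X N l * monomial {} id N l)" using assms unfolding robustly_bounded_def by blast
  then show ?thesis by (rule bounded_mean_cong) (simp add: monomial_def)
qed

lemma robustly_bounded_cong:
  assumes "robustly_bounded X" "\<And>N l. N \<ge> 1 \<Longrightarrow> X' N l = X N l"
  shows "robustly_bounded X'"
  unfolding robustly_bounded_def
proof (intro allI impI)
  fix J :: "nat set" and \<alpha> assume "finite J"
  then have "bounded_mean (\<lambda>N l. X N l * monomial J \<alpha> N l)" using assms(1) by (simp add: robustly_bounded_def)
  then show "bounded_mean (\<lambda>N l. X' N l * monomial J \<alpha> N l)" by (rule bounded_mean_cong) (simp add: assms(2))
qed

lemma robustly_bounded_const: "robustly_bounded (\<lambda>N l. a)"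
  unfolding robustly_bounded_def by (auto intro: bounded_mean_cmult bounded_mean_monomial)

lemma robustly_bounded_add: "robustly_bounded X \<Longrightarrow> robustly_bounded X' \<Longrightarrow> robustly_bounded (\<lambda>N l. X N l + X' N l)"
  unfolding robustly_bounded_def distrib_right by (auto intro: bounded_mean_add)

lemma robustly_bounded_cmult: "robustly_bounded X \<Longrightarrow> robustly_bounded (\<lambda>N l. a * X N l)"
  unfolding robustly_bounded_def mult.assoc by (auto intro: bounded_mean_cmult)

lemma robustly_bounded_sqrt: "robustly_bounded X \<Longrightarrow> robustly_bounded (\<lambda>N l. 1 / sqrt (real N) * X N l)"
  unfolding robustly_bounded_def mult.assoc by (intro allI impI bounded_mean_sqrt) blast

lemma robustly_bounded_sum: "(\<And>a. a \<in> A \<Longrightarrow> robustly_bounded (X a)) \<Longrightarrow> robustly_bounded (\<lambda>N l. \<Sum>a\<in>A. X a N l)"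
  by (induction A rule: infinite_finite_induct) (auto intro: robustly_bounded_add robustly_bounded_const)

text \<open>A fresh label turns the new factor into one more factor of the monomial.\<close>

lemma robustly_bounded_mult_monom:
  assumes "robustly_bounded X"
  shows "robustly_bounded (\<lambda>N l. X N l * Y N (monom 1 a) l)"
  unfolding robustly_bounded_def
proof (intro allI impI)
  fix J :: "nat set" and \<alpha> assume J: "finite J"
  obtain j where j: "j \<notin> J" using ex_new_if_finite[OF infinite_UNIV_nat J] by blast
  have "bounded_mean (\<lambda>N l. X N l * monomial (insert j J) (\<alpha>(j := a)) N l)"
    using assms J unfolding robustly_bounded_def by blast
  then show "bounded_mean (\<lambda>N l. X N l * Y N (monom 1 a) l * monomial J \<alpha> N l)"
    by (rule bounded_mean_cong) (simp add: monomial_insert[OF J j])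
qed

lemma robustly_bounded_mult_Y:
  assumes "robustly_bounded X"
  shows "robustly_bounded (\<lambda>N l. X N l * Y N f l)"
proof -
  have "Y N f l = (\<Sum>i\<le>degree f. coeff f i * Y N (monom 1 i) l)" for N l
  proof -
    have "Y N f l = Y N (\<Sum>i\<le>degree f. smult (coeff f i) (monom 1 i)) l"
      by (simp add: smult_monom poly_as_sum_of_monoms)
    then show ?thesis by (simp add: Y_sum Y_smult)
  qed
  then have "X N l * Y N f l = (\<Sum>i\<le>degree f. coeff f i * (X N l * Y N (monom 1 i) l))" for N l
    by (simp add: sum_distrib_left mult_ac)
  then show ?thesis
    by (simp only:) (intro robustly_bounded_sum robustly_bounded_cmult robustly_bounded_mult_monom assms)
qed

lemma robustly_bounded_power: "robustly_bounded X \<Longrightarrow> robustly_bounded (\<lambda>N l. X N l * Y N f l ^ k)"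
proof (induction k)
  case (Suc k)
  have "robustly_bounded (\<lambda>N l. X N l * Y N f l ^ k * Y N f l)" by (intro robustly_bounded_mult_Y Suc)
  then show ?case by (simp add: mult_ac)
qed simp

lemma robustly_bounded_avg:
  assumes "robustly_bounded X"
  shows "robustly_bounded (\<lambda>N l. X N l * avg N f l)"
proof (rule robustly_bounded_cong)
  show "robustly_bounded (\<lambda>N l. L f * X N l + 1 / sqrt (real N) * (X N l * Y N f l))"
    by (intro robustly_bounded_add robustly_bounded_cmult robustly_bounded_sqrt robustly_bounded_mult_Y assms)
qed (simp add: avg_Y algebra_simps)

text \<open>The loop equation for \<open>G = Y(P)\<^sup>k\<close>, whose derivative in the direction \<open>j\<close> is \<open>k Y(P)\<^bsup>k-1\<^esup> P'(l j) N\<^bsup>-1/2\<^esup>\<close>; the sum over \<open>j\<close>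
of \<open>l\<^sub>j\<^sup>d P'(l j) / N\<close> is again a linear statistic.\<close>

lemma loop_equation_power_monom:
  assumes N: "N \<ge> 1"
  shows "E N (\<lambda>l. Y N P l ^ k * Y N (\<Lambda> (monom 1 d)) l)
    = 1 / sqrt (real N) * E N (\<lambda>l. c * (\<Sum>a<d. Y N P l ^ k * Y N (monom 1 (d - 1 - a)) l * Y N (monom 1 a) l) + (- c) * (Y N P l ^ k * avg N (pderiv (monom 1 d)) l))
      + real k * E N (\<lambda>l. Y N P l ^ (k - 1) * avg N (monom 1 d * pderiv P) l)"
proof -
  define G where "G l = Y N P l ^ k" for l
  define G' where "G' j l = real k * (poly (pderiv P) (l j) / sqrt (real N) * Y N P l ^ (k - 1))" for j l
  have s: "sqrt (real N) * sqrt (real N) = real N" by simp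
  have "E N (\<lambda>l. G l * Y N (\<Lambda> (monom 1 d)) l)
    = E N (\<lambda>l. G l * (c / sqrt (real N) * ((\<Sum>a<d. Y N (monom 1 (d - 1 - a)) l * Y N (monom 1 a) l) - avg N (pderiv (monom 1 d)) l)))
      + E N (\<lambda>l. 1 / sqrt (real N) * (\<Sum>j=1..N. l j ^ d * G' j l))"
  proof (rule loop_equation_Y[OF N])
    show "tame (I N) G" unfolding G_def[abs_def] by (intro tame_power tame_Y)
    show "tame (I N) (G' j)" if "j \<in> I N" for j
      unfolding G'_def[abs_def] divide_inverse by (intro tame_mult tame_power tame_Y tame_const tame_poly_coordinate that) auto
    show "((\<lambda>x. G (l(j := x))) has_real_derivative G' j (l(j := x))) (at x)" if j: "j \<in> I N" for j l x
      unfolding G_def G'_def using DERIV_power[OF Y_has_derivative[OF j, of P l x], of k] by simp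
    show "continuous_on UNIV (\<lambda>x. G' j (l(j := x)))" if j: "j \<in> I N" for j l
      unfolding G'_def divide_inverse by (intro continuous_intros continuous_on_poly continuous_on_update[of 1] continuous_on_Y j) auto
  qed
  also have "E N (\<lambda>l. G l * (c / sqrt (real N) * ((\<Sum>a<d. Y N (monom 1 (d - 1 - a)) l * Y N (monom 1 a) l) - avg N (pderiv (monom 1 d)) l)))
    = E N (\<lambda>l. 1 / sqrt (real N) * (c * (\<Sum>a<d. Y N P l ^ k * Y N (monom 1 (d - 1 - a)) l * Y N (monom 1 a) l) + (- c) * (Y N P l ^ k * avg N (pderiv (monom 1 d)) l)))"
  proof (intro Bochner_Integration.integral_cong refl)
    fix l
    have "(\<Sum>a<d. Y N P l ^ k * Y N (monom 1 (d - 1 - a)) l * Y N (monom 1 a) l) = G l * (\<Sum>a<d. Y N (monom 1 (d - 1 - a)) l * Y N (monom 1 a) l)"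
      by (simp add: G_def sum_distrib_left mult.assoc)
    then show "G l * (c / sqrt (real N) * ((\<Sum>a<d. Y N (monom 1 (d - 1 - a)) l * Y N (monom 1 a) l) - avg N (pderiv (monom 1 d)) l))
      = 1 / sqrt (real N) * (c * (\<Sum>a<d. Y N P l ^ k * Y N (monom 1 (d - 1 - a)) l * Y N (monom 1 a) l) + (- c) * (Y N P l ^ k * avg N (pderiv (monom 1 d)) l))"
      by (simp only:) (simp add: G_def algebra_simps diff_divide_distrib)
  qed
  also have "\<dots> = 1 / sqrt (real N) * E N (\<lambda>l. c * (\<Sum>a<d. Y N P l ^ k * Y N (monom 1 (d - 1 - a)) l * Y N (monom 1 a) l) + (- c) * (Y N P l ^ k * avg N (pderiv (monom 1 d)) l))"
    by (rule E_cmult)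
  also have "E N (\<lambda>l. 1 / sqrt (real N) * (\<Sum>j=1..N. l j ^ d * G' j l)) = E N (\<lambda>l. real k * (Y N P l ^ (k - 1) * avg N (monom 1 d * pderiv P) l))"
  proof (intro Bochner_Integration.integral_cong refl)
    fix l
    have e: "1 / r * (u * (real k * (v / r * M))) = real k * (M * (u * v / (r * r)))" for r u v M :: real by simp
    have "1 / sqrt (real N) * (\<Sum>j=1..N. l j ^ d * G' j l) = (\<Sum>j=1..N. real k * (Y N P l ^ (k - 1) * (l j ^ d * poly (pderiv P) (l j) / real N)))"
      unfolding sum_distrib_left G'_def e s ..
    also have "\<dots> = real k * (Y N P l ^ (k - 1) * avg N (monom 1 d * pderiv P) l)"
      by (simp add: avg_def poly_monom sum_distrib_left sum_divide_distrib)
    finally show "1 / sqrt (real N) * (\<Sum>j=1..N. l j ^ d * G' j l) = real k * (Y N P l ^ (k - 1) * avg N (monom 1 d * pderiv P) l)" .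
  qed
  also have "\<dots> = real k * E N (\<lambda>l. Y N P l ^ (k - 1) * avg N (monom 1 d * pderiv P) l)" by (rule E_cmult)
  finally show ?thesis by (simp only: G_def)
qed

text \<open>Extends the previous equation to all polynomials by linearity. The remainder \<open>W\<close> is kept abstract, as only its boundedness
matters.\<close>

lemma loop_equation_power:
  "\<exists>W. robustly_bounded W \<and> (\<forall>N\<ge>1. E N (\<lambda>l. Y N P l ^ k * Y N (\<Lambda> f) l)
    = 1 / sqrt (real N) * E N (W N) + real k * E N (\<lambda>l. Y N P l ^ (k - 1) * avg N (f * pderiv P) l))"
  (is "?S f")
proof -
  let ?l = "\<lambda>N f. E N (\<lambda>l. Y N P l ^ k * Y N (\<Lambda> f) l)" and ?r = "\<lambda>N f. E N (\<lambda>l. Y N P l ^ (k - 1) * avg N (f * pderiv P) l)"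
  have tT: "tame (I N) (\<lambda>l. Y N P l ^ j * Y N h l)" "tame (I N) (\<lambda>l. Y N P l ^ j * avg N h l)" for N j h
    by (intro tame_mult tame_power tame_Y tame_avg)+
  have add: "?S (f + g)" if f: "?S f" and g: "?S g" for f g
  proof -
    obtain W where W: "robustly_bounded W" "\<And>N. N \<ge> 1 \<Longrightarrow> ?l N f = 1 / sqrt (real N) * E N (W N) + real k * ?r N f"
      using f by blast
    obtain V where V: "robustly_bounded V" "\<And>N. N \<ge> 1 \<Longrightarrow> ?l N g = 1 / sqrt (real N) * E N (V N) + real k * ?r N g"
      using g by blast
    show ?thesis
    proof (intro exI[of _ "\<lambda>N l. W N l + V N l"] conjI robustly_bounded_add W(1) V(1) allI impI)
      fix N :: nat assume N: "N \<ge> 1"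
      have "?l N (f + g) = ?l N f + ?l N g"
        unfolding \<Lambda>_add Y_add distrib_left by (rule E_add[OF N tT(1) tT(1)])
      moreover have "?r N (f + g) = ?r N f + ?r N g"
        unfolding distrib_right avg_add distrib_left by (rule E_add[OF N tT(2) tT(2)])
      moreover have "E N (\<lambda>l. W N l + V N l) = E N (W N) + E N (V N)"
        by (intro E_add N bounded_mean_tame robustly_bounded_bounded_mean W(1) V(1))
      ultimately show "?l N (f + g) = 1 / sqrt (real N) * E N (\<lambda>l. W N l + V N l) + real k * ?r N (f + g)"
        unfolding W(2)[OF N] V(2)[OF N] by (simp only:) (simp add: algebra_simps add_divide_distrib)
    qed
  qed
  have smult: "?S (smult a f)" if f: "?S f" for a f
  proof -
    obtain W where W: "robustly_bounded W" "\<And>N. N \<ge> 1 \<Longrightarrow> ?l N f = 1 / sqrt (real N) * E N (W N) + real k * ?r N f"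
      using f by blast
    show ?thesis
    proof (intro exI[of _ "\<lambda>N l. a * W N l"] conjI robustly_bounded_cmult W(1) allI impI)
      fix N :: nat assume N: "N \<ge> 1"
      have "?l N (smult a f) = a * ?l N f"
        unfolding \<Lambda>_smult Y_smult E_cmult[symmetric] by (simp only: mult.left_commute)
      moreover have "?r N (smult a f) = a * ?r N f"
        unfolding mult_smult_left avg_smult E_cmult[symmetric] by (simp only: mult.left_commute)
      ultimately show "?l N (smult a f) = 1 / sqrt (real N) * E N (\<lambda>l. a * W N l) + real k * ?r N (smult a f)"
        unfolding W(2)[OF N] by (simp only: E_cmult) (simp add: algebra_simps)
    qed
  qed
  have monom: "?S (monom 1 d)" for d
  proof (intro exI[of _ "\<lambda>N l. c * (\<Sum>a<d. Y N P l ^ k * Y N (monom 1 (d - 1 - a)) l * Y N (monom 1 a) l) + (- c) * (Y N P l ^ k * avg N (pderiv (monom 1 d)) l)"] conjI allI impI loop_equation_power_monom)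
    have T: "robustly_bounded (\<lambda>N l. Y N P l ^ k)" using robustly_bounded_power[OF robustly_bounded_const[of 1], of P k] by simp
    show "robustly_bounded (\<lambda>N l. c * (\<Sum>a<d. Y N P l ^ k * Y N (monom 1 (d - 1 - a)) l * Y N (monom 1 a) l) + (- c) * (Y N P l ^ k * avg N (pderiv (monom 1 d)) l))"
      by (intro robustly_bounded_add robustly_bounded_cmult robustly_bounded_sum robustly_bounded_mult_Y robustly_bounded_avg T)
  qed
  have "?S (\<Sum>i\<in>A. smult (coeff f i) (monom 1 i))" if "finite A" for A
    using that
  proof (induction A rule: finite_induct)
    case empty
    show ?case using smult[OF monom, of 0 0] by simp
  next
    case (insert i A)
    have "?S (smult (coeff f i) (monom 1 i) + (\<Sum>i\<in>A. smult (coeff f i) (monom 1 i)))"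
      by (rule add[OF smult[OF monom] insert.IH])
    then show ?case using insert.hyps by simp
  qed
  from this[of "{..degree f}"] show ?thesis by (simp add: smult_monom poly_as_sum_of_monoms)
qed

text \<open>As \<open>\<Lambda>f\<close> and \<open>P\<close> differ by a constant, \<open>Y(\<Lambda>f) = Y(P)\<close>. On the right side \<open>\<langle>L\<^sub>N, f P'\<rangle>\<close> may be replaced by its limit
\<open>L(f P')\<close>, because the difference is \<open>N\<^bsup>-1/2\<^esup> Y(f P')\<close> and all mixed moments are bounded.\<close>

lemma moment_recursion:
  assumes P: "pderiv (\<Lambda> f) = pderiv P"
  shows "\<exists>C. \<forall>N\<ge>1. \<bar>E N (\<lambda>l. Y N P l ^ Suc k) - real k * L (f * pderiv P) * E N (\<lambda>l. Y N P l ^ (k - 1))\<bar> \<le> C / sqrt (real N)"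
proof -
  let ?D = "f * pderiv P"
  let ?TY = "\<lambda>N l. Y N P l ^ (k - 1) * Y N (f * pderiv P) l" and ?Ta = "\<lambda>N l. Y N P l ^ (k - 1) * avg N (f * pderiv P) l"
  let ?T = "\<lambda>N l. Y N P l ^ (k - 1)"
  obtain W where W: "robustly_bounded W" "\<And>N. N \<ge> 1 \<Longrightarrow> E N (\<lambda>l. Y N P l ^ k * Y N (\<Lambda> f) l) = 1 / sqrt (real N) * E N (W N) + real k * E N (?Ta N)"
    using loop_equation_power by blast
  have T: "robustly_bounded (\<lambda>N l. Y N P l ^ (k - 1) * Y N (f * pderiv P) l)"
    using robustly_bounded_mult_Y[OF robustly_bounded_power[OF robustly_bounded_const[of 1]], of P "k - 1"] by simp
  obtain C1 where C1: "\<And>N. N \<ge> 1 \<Longrightarrow> \<bar>E N (W N)\<bar> \<le> C1" using bounded_mean_bound[OF robustly_bounded_bounded_mean[OF W(1)]] by metis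
  obtain C2 where C2: "\<And>N. N \<ge> 1 \<Longrightarrow> \<bar>E N (?TY N)\<bar> \<le> C2" using bounded_mean_bound[OF robustly_bounded_bounded_mean[OF T]] by metis
  have "pderiv (\<Lambda> f - P) = 0" by (simp add: pderiv_diff P)
  then obtain a where a: "\<Lambda> f - P = [:a:]" by (metis degree_eq_zeroE pderiv_eq_0_iff)
  show ?thesis
  proof (intro exI[of _ "C1 + real k * C2"] allI impI)
    fix N :: nat assume N: "N \<ge> 1"
    have "Y N (\<Lambda> f) l = Y N P l" for l
      using Y_const[OF N, of a l] unfolding a[symmetric] Y_diff by simp
    then have "E N (\<lambda>l. Y N P l ^ Suc k) = 1 / sqrt (real N) * E N (W N) + real k * E N (?Ta N)"
      using W(2)[OF N] by (simp add: mult.commute)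
    moreover have "E N (?Ta N) = L (f * pderiv P) * E N (?T N) + 1 / sqrt (real N) * E N (?TY N)"
    proof -
      have "E N (?Ta N) = E N (\<lambda>l. L (f * pderiv P) * Y N P l ^ (k - 1) + 1 / sqrt (real N) * (Y N P l ^ (k - 1) * Y N (f * pderiv P) l))"
        by (intro Bochner_Integration.integral_cong refl) (simp add: avg_Y[OF N] algebra_simps)
      also have "\<dots> = E N (\<lambda>l. L (f * pderiv P) * Y N P l ^ (k - 1)) + E N (\<lambda>l. 1 / sqrt (real N) * (Y N P l ^ (k - 1) * Y N (f * pderiv P) l))"
        by (intro E_add N tame_mult tame_const tame_power tame_Y)
      finally show ?thesis by (simp only: E_cmult)
    qed
    ultimately have "E N (\<lambda>l. Y N P l ^ Suc k) - real k * L (f * pderiv P) * E N (?T N)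
      = (E N (W N) + real k * E N (?TY N)) / sqrt (real N)"
      by (simp only:) (simp add: algebra_simps add_divide_distrib)
    moreover have "\<bar>E N (W N) + real k * E N (?TY N)\<bar> \<le> C1 + real k * C2"
      using C1[OF N] C2[OF N] by (intro order.trans[OF abs_triangle_ineq] add_mono) (auto simp: abs_mult mult_left_mono)
    ultimately show "\<bar>E N (\<lambda>l. Y N P l ^ Suc k) - real k * L (f * pderiv P) * E N (?T N)\<bar> \<le> (C1 + real k * C2) / sqrt (real N)"
      by (simp only: abs_divide) (simp add: divide_right_mono)
  qed
qed

text \<open>The limits satisfy the recursion that characterises the Gaussian moments, starting from \<open>1\<close>.\<close>

theorem moments_converge:
  assumes P: "pderiv (\<Lambda> f) = pderiv P"
  shows "(\<lambda>N. E N (\<lambda>l. Y N P l ^ k)) \<longlonglongrightarrow> gaussian_moment (L (f * pderiv P)) k"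
proof (induction k rule: less_induct)
  case (less k)
  show ?case
  proof (cases k)
    case 0
    have "\<forall>\<^sub>F N in sequentially. E N (\<lambda>l. Y N P l ^ 0) = 1"
      using eventually_ge_at_top[of 1] by eventually_elim (simp only: power_0 E_const)
    then show ?thesis using 0 by (auto simp: gaussian_moment_def intro: tendsto_eventually)
  next
    case (Suc j)
    define V where "V = L (f * pderiv P)"
    obtain C where C: "\<And>N. N \<ge> 1 \<Longrightarrow> \<bar>E N (\<lambda>l. Y N P l ^ Suc j) - real j * V * E N (\<lambda>l. Y N P l ^ (j - 1))\<bar> \<le> C / sqrt (real N)"
      using moment_recursion[OF P, of j] unfolding V_def by blast
    have "(\<lambda>N. E N (\<lambda>l. Y N P l ^ Suc j) - real j * V * E N (\<lambda>l. Y N P l ^ (j - 1))) \<longlonglongrightarrow> 0"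
    proof (rule Lim_null_comparison)
      show "\<forall>\<^sub>F N in sequentially. norm (E N (\<lambda>l. Y N P l ^ Suc j) - real j * V * E N (\<lambda>l. Y N P l ^ (j - 1))) \<le> C / sqrt (real N)"
        using eventually_ge_at_top[of 1] by eventually_elim (use C in simp)
      show "(\<lambda>N. C / sqrt (real N)) \<longlonglongrightarrow> 0" by real_asymp
    qed
    moreover have "(\<lambda>N. real j * V * E N (\<lambda>l. Y N P l ^ (j - 1))) \<longlonglongrightarrow> real j * V * gaussian_moment V (j - 1)"
      using less[of "j - 1"] Suc unfolding V_def by (intro tendsto_mult tendsto_const) auto
    ultimately have "(\<lambda>N. (E N (\<lambda>l. Y N P l ^ Suc j) - real j * V * E N (\<lambda>l. Y N P l ^ (j - 1))) + real j * V * E N (\<lambda>l. Y N P l ^ (j - 1))) \<longlonglongrightarrow> 0 + real j * V * gaussian_moment V (j - 1)"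
      by (rule tendsto_add)
    then show ?thesis unfolding Suc gaussian_moment_rec V_def[symmetric] by simp
  qed
qed

end

section \<open>The central limit theorem\<close>

lemma char_gaussian:
  assumes v: "v > 0"
  shows "(LINT x|gaussian 0 v. iexp (t * x)) = complex_of_real (exp (- (t\<^sup>2 * v) / 2))"
proof -
  define s where "s = sqrt v"
  have s: "s > 0" "s\<^sup>2 = v" using v by (auto simp: s_def)
  have nd: "normal_density 0 s (0 + s * x) * s = std_normal_density x" for x
    using s(1) by (simp add: normal_density_def power_mult_distrib real_sqrt_mult)
  have "(LINT x|gaussian 0 v. iexp (t * x)) = (LINT x|lborel. normal_density 0 s x *\<^sub>R iexp (t * x))"
    unfolding gaussian_def s_def[symmetric] using s by (intro integral_density) auto
  also have "\<dots> = \<bar>s\<bar> *\<^sub>R (LINT x|lborel. normal_density 0 s (0 + s * x) *\<^sub>R iexp (t * (0 + s * x)))"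
    using s by (intro lborel_integral_real_affine) simp
  also have "\<dots> = (LINT x|lborel. \<bar>s\<bar> *\<^sub>R (normal_density 0 s (0 + s * x) *\<^sub>R iexp (t * (0 + s * x))))"
    by (rule integral_scaleR_right[symmetric])
  also have "\<dots> = (LINT x|lborel. of_real (std_normal_density x) * exp (\<i> * of_real ((t * s) * x)))"
  proof (intro Bochner_Integration.integral_cong refl)
    fix x
    have "\<bar>s\<bar> *\<^sub>R (normal_density 0 s (0 + s * x) *\<^sub>R iexp (t * (0 + s * x))) = of_real (normal_density 0 s (0 + s * x) * s) * iexp (t * (0 + s * x))"
      using s by (simp add: scaleR_conv_of_real mult_ac)
    then show "\<bar>s\<bar> *\<^sub>R (normal_density 0 s (0 + s * x) *\<^sub>R iexp (t * (0 + s * x))) = of_real (std_normal_density x) * exp (\<i> * of_real ((t * s) * x))"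
      unfolding nd by (simp add: mult.assoc)
  qed
  also have "\<dots> = complex_of_real (exp (- ((t * s)\<^sup>2) / 2))" by (rule std_normal_char)
  finally show ?thesis by (simp add: power_mult_distrib s)
qed

lemma prob_space_gaussian: "v > 0 \<Longrightarrow> prob_space (gaussian 0 v)"
  unfolding gaussian_def by (rule prob_space_normal_density) simp

lemma sets_gaussian [simp, measurable_cong]: "sets (gaussian m v) = sets borel"
  by (simp add: gaussian_def)

lemma integrable_square_gaussian:
  assumes v: "v > 0"
  shows "integrable (gaussian 0 v) (\<lambda>x. x\<^sup>2)"
proof -
  have "integrable lborel (\<lambda>x. normal_density 0 (sqrt v) x * (x - 0) ^ (2 * 1))"
    using normal_moment_even[of "sqrt v" 0 1] v by (auto simp: has_bochner_integral_iff)
  then show ?thesis unfolding gaussian_def by (subst integrable_density) auto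
qed

lemma integrable_iexp_gaussian:
  assumes "v > 0"
  shows "integrable (gaussian 0 v) (\<lambda>x. iexp (t * x))"
proof -
  interpret prob_space "gaussian 0 v" by (rule prob_space_gaussian[OF assms])
  show ?thesis by (intro integrable_const_bound[of _ 1]) auto
qed

lemma measurable_iexp_linear:
  "(\<lambda>y. iexp (\<Sum>i\<in>I. t i * y i)) \<in> borel_measurable (Pi\<^sub>M I (\<lambda>_. borel :: real measure))"
proof -
  have "(\<lambda>y. \<Sum>i\<in>I. t i * y i) \<in> borel_measurable (Pi\<^sub>M I (\<lambda>_. borel :: real measure))"
    by (intro borel_measurable_sum borel_measurable_times borel_measurable_const measurable_component_singleton)
  then show ?thesis by measurable
qed

text \<open>The empirical distribution is the image under \<open>l\<close> of the uniform distribution on the indices, and for the latter the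
integral is an average.\<close>

lemma integral_empirical_distribution:
  assumes N: "N \<ge> 1" and f: "continuous_on UNIV f"
  shows "(LINT x|empirical_distribution N l. f x) = (\<Sum>i\<in>{1..N}. f (l i)) / real N"
proof -
  let ?U = "uniform_count_measure {1..N}"
  have m: "l \<in> measurable ?U borel"
    by (rule measurableI) (auto simp: space_uniform_count_measure sets_uniform_count_measure)
  have "empirical_distribution N l = distr ?U borel l"
  proof (rule measure_eqI)
    fix A assume "A \<in> sets (empirical_distribution N l)"
    then have A: "A \<in> sets borel" by simp
    have "(\<Sum>i\<in>{1..N}. emeasure (return borel (l i)) A) = (\<Sum>i\<in>{1..N}. ennreal (indicator A (l i)))"
      using A by (simp add: ennreal_indicator)
    also have "\<dots> = ennreal (\<Sum>i\<in>{1..N}. indicator A (l i))" by (simp add: sum_ennreal)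
    also have "(\<Sum>i\<in>{1..N}. indicator A (l i)) = real (card (l -` A \<inter> {1..N}))"
    proof -
      have "(\<Sum>i\<in>{1..N}. indicator A (l i)) = (\<Sum>i\<in>{1..N}. if l i \<in> A then 1 else 0 :: real)"
        by (intro sum.cong refl) (simp add: indicator_def)
      also have "\<dots> = real (card ({1..N} \<inter> {i. l i \<in> A}))" by (subst sum.If_cases) auto
      also have "{1..N} \<inter> {i. l i \<in> A} = l -` A \<inter> {1..N}" by auto
      finally show ?thesis .
    qed
    finally have "emeasure (empirical_distribution N l) A = ennreal (real (card (l -` A \<inter> {1..N}))) / of_nat N"
      using emeasure_empirical_distribution[OF A] by simp
    also have "\<dots> = ennreal (real (card (l -` A \<inter> {1..N})) / real N)"
      unfolding ennreal_of_nat_eq_real_of_nat using N by (intro divide_ennreal) auto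
    also have "\<dots> = emeasure (distr ?U borel l) A"
      using A m by (subst emeasure_distr) (auto simp: emeasure_uniform_count_measure space_uniform_count_measure)
    finally show "emeasure (empirical_distribution N l) A = emeasure (distr ?U borel l) A" .
  qed simp
  then have "(LINT x|empirical_distribution N l. f x) = (LINT i|?U. f (l i))"
    by (simp only: integral_distr[OF m borel_measurable_continuous_onI[OF f]])
  also have "\<dots> = (\<Sum>i\<in>{1..N}. f (l i)) / real N" by (simp add: integral_uniform_count_measure)
  finally show ?thesis .
qed

text \<open>Nothing is known about the law with index \<open>0\<close>; Levy's continuity theorem is applied to the shifted sequence.\<close>

lemma weak_conv_m_of_char:
  fixes M :: "nat \<Rightarrow> real measure"
  assumes "\<And>N. N \<ge> 1 \<Longrightarrow> real_distribution (M N)" "real_distribution M'"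
    and "\<And>t. (\<lambda>N. char (M N) t) \<longlonglongrightarrow> char M' t"
  shows "weak_conv_m M M'"
proof -
  have "weak_conv_m (\<lambda>N. M (Suc N)) M'"
    by (rule levy_continuity) (use assms in \<open>auto intro: LIMSEQ_Suc\<close>)
  then show ?thesis
    unfolding weak_conv_m_def weak_conv_def by (blast intro: LIMSEQ_imp_Suc)
qed

text \<open>The polynomials \<open>\<Lambda>(p\<^sub>n)/(n + 1)\<close> are primitives of the \<open>p\<^sub>n\<close>, and constants do not change fluctuations. Linear combinations
of them have Gaussian limits with a diagonal covariance form, which is the joint statement by the criterion for
vectors and the marginal one by Levy's theorem.\<close>

theorem theorem1p1:
  fixes c :: real
    and P :: "nat \<Rightarrow> real \<Rightarrow> real"
    and \<Omega> :: "nat \<Rightarrow> 'a measure"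
    and lam :: "nat \<Rightarrow> 'a \<Rightarrow> nat \<Rightarrow> real"
  assumes "c > 0"
    and "\<And>n x. (P n has_real_derivative poly (assoc_hermite c n) x) (at x)"
    and "\<And>N. N \<ge> 1 \<Longrightarrow> prob_space (\<Omega> N)"
    and "\<And>N. N \<ge> 1 \<Longrightarrow> gaussian_beta_ensemble N (2 * c / real N) (\<Omega> N) (lam N)"
  shows "(\<forall>n. weak_conv_m (\<lambda>N. distr (\<Omega> N) borel (\<lambda>\<omega>. fluctuation c (P n) N (lam N \<omega>)))
                (gaussian 0 (sigma2 c n)))
       \<and> (\<forall>n. sigma2 c n = 1 / (real n + 1) * (\<Prod>k=1..n. c + real k))
       \<and> (\<forall>M. weak_conv_vec {..M}
                (\<lambda>N. distr (\<Omega> N) (Pi\<^sub>M {..M} (\<lambda>_. borel))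
                       (\<lambda>\<omega>. \<lambda>n\<in>{..M}. fluctuation c (P n) N (lam N \<omega>)))
                (Pi\<^sub>M {..M} (\<lambda>n. gaussian 0 (sigma2 c n))))"
proof -
  note c = assms(1)
  define ell where "ell f = (LINT x|nu c. poly f x)" for f
  define \<mu> where "\<mu> N = distr (\<Omega> N) (Pi\<^sub>M {1..N} (\<lambda>_. lborel)) (lam N)" for N
  have lam_meas: "lam N \<in> measurable (\<Omega> N) (Pi\<^sub>M {1..N} (\<lambda>_. lborel))" if "N \<ge> 1" for N
    using assms(4)[OF that] unfolding gaussian_beta_ensemble_def by (auto dest: distributed_measurable)
  interpret gbe c ell \<mu>
  proof (intro gbe.intro hermite_functional.intro gbe_axioms.intro)
    show "c > 0" by (rule c)
    show "ell (f + g) = ell f + ell g" for f g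
      using integrable_poly_nu[OF c] by (simp add: ell_def)
    show "ell (smult a f) = a * ell f" for a f by (simp add: ell_def)
    show "ell (assoc_hermite c n) = (if n = 0 then 1 else 0)" for n
      unfolding ell_def by (rule integral_assoc_hermite_nu[OF c])
    show "prob_space (\<mu> N)" if "N \<ge> 1" for N
      unfolding \<mu>_def by (rule prob_space.prob_space_distr[OF assms(3)[OF that] lam_meas[OF that]])
    show "\<exists>Z>0. \<mu> N = density (Pi\<^sub>M {1..N} (\<lambda>_. lborel)) (\<lambda>l. ennreal (GBE_weight N (2 * c / real N) l / Z))" if "N \<ge> 1" for N
      using assms(4)[OF that] unfolding gaussian_beta_ensemble_def \<mu>_def by (auto dest: distributed_distr_eq_density)
  qed
  have sigma: "sigma2 c n = 1 / (real n + 1) * ell (p n * p n)" for n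
    by (simp add: sigma2_def ell_def)
  have sigma_prod: "sigma2 c n = 1 / (real n + 1) * (\<Prod>k=1..n. c + real k)" for n
    unfolding sigma by (simp add: L_hermite_prod)
  have sigma_pos: "sigma2 c n > 0" for n
    unfolding sigma_prod using c by (intro mult_pos_pos prod_pos) (auto intro: add_pos_nonneg)
  (* A n is the primitive of p n to which the moment recursion applies directly. *)
  define A where "A n = smult (1 / (real n + 1)) (\<Lambda> (p n))" for n
  have dA: "pderiv (A n) = p n" for n
    by (simp add: A_def pderiv_smult pderiv_\<Lambda>_hermite)
  have fluct: "fluctuation c (P n) N l = Y N (A n) l" if N: "N \<ge> 1" for n N l
  proof -
    have "\<forall>x. ((\<lambda>x. P n x - poly (A n) x) has_real_derivative 0) (at x)"
      using DERIV_diff[OF assms(2)[of n] poly_DERIV[of "A n"]] by (simp add: dA)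
    then have "P n x - poly (A n) x = P n 0 - poly (A n) 0" for x by (rule DERIV_isconst_all)
    then have "P n x = poly (A n + [:P n 0 - poly (A n) 0:]) x" for x by (simp add: algebra_simps)
    then obtain a where a: "P n = poly (A n + [:a:])" by blast
    have "fluctuation c (P n) N l = sqrt (real N) * (avg N (A n + [:a:]) l - ell (A n + [:a:]))"
      unfolding fluctuation_def a ell_def avg_def
      by (subst integral_empirical_distribution[OF N]) (auto intro!: continuous_intros)
    also have "\<dots> = Y N (A n) l"
      using Y_add[of N "A n" "[:a:]" l] Y_const[OF N, of a l] unfolding Y_def by simp
    finally show ?thesis .
  qed
  have char_lim: "(\<lambda>N. LINT l|\<mu> N. iexp (\<Sum>n\<in>J. t n * Y N (A n) l)) \<longlonglongrightarrow> complex_of_real (exp (- (\<Sum>n\<in>J. (t n)\<^sup>2 * sigma2 c n) / 2))"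
    if J: "finite J" for J :: "nat set" and t
  proof -
    (* f and R realise the pair of moment_recursion for the linear combination with coefficients t. *)
    define f where "f = (\<Sum>n\<in>J. smult (t n / (real n + 1)) (p n))"
    define R where "R = (\<Sum>n\<in>J. smult (t n) (A n))"
    have "\<Lambda> f = R"
    proof -
      have "\<Lambda> (\<Sum>n\<in>J. smult (s n) (p n)) = (\<Sum>n\<in>J. smult (s n) (\<Lambda> (p n)))" for s
        using \<Lambda>_smult[of 0 0] by (induction J rule: infinite_finite_induct) (auto simp: \<Lambda>_add \<Lambda>_smult)
      then show ?thesis by (simp add: f_def R_def A_def)
    qed
    then have f: "pderiv (\<Lambda> f) = pderiv R" by simp
    have dR: "pderiv R = (\<Sum>n\<in>J. smult (t n) (p n))"
      unfolding R_def by (induction J rule: infinite_finite_induct) (auto simp: pderiv_add pderiv_smult dA)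
    have "ell (f * pderiv R) = (\<Sum>m\<in>J. \<Sum>n\<in>J. t m / (real m + 1) * t n * ell (p m * p n))"
      unfolding dR f_def sum_product by (simp add: L_sum L_smult mult.assoc mult.left_commute)
    also have "\<dots> = (\<Sum>m\<in>J. t m / (real m + 1) * t m * ell (p m * p m))"
    proof (rule sum.cong[OF refl])
      fix m assume m: "m \<in> J"
      have "(\<Sum>n\<in>J. t m / (real m + 1) * t n * ell (p m * p n)) = (\<Sum>n\<in>J. if n = m then t m / (real m + 1) * t m * ell (p m * p m) else 0)"
        by (intro sum.cong refl) (auto simp: L_hermite_prod)
      then show "(\<Sum>n\<in>J. t m / (real m + 1) * t n * ell (p m * p n)) = t m / (real m + 1) * t m * ell (p m * p m)"
        using J m by simp
    qed
    also have "\<dots> = (\<Sum>n\<in>J. (t n)\<^sup>2 * sigma2 c n)"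
      by (intro sum.cong refl) (simp add: sigma power2_eq_square)
    finally have V: "ell (f * pderiv R) = (\<Sum>n\<in>J. (t n)\<^sup>2 * sigma2 c n)" .
    have "(\<lambda>N. LINT l|\<mu> N. iexp (Y N R l)) \<longlonglongrightarrow> complex_of_real (exp (- ell (f * pderiv R) / 2))"
    proof (rule char_tendsto_of_moments)
      show "Y N R \<in> borel_measurable (\<mu> N)" if "N \<ge> 1" for N
        unfolding measurable_cong_sets[OF sets_\<mu>[OF that] refl] by (rule tame_measurable[OF tame_Y])
      show "integrable (\<mu> N) (\<lambda>l. Y N R l ^ k)" if "N \<ge> 1" for N k
        by (intro integrable_E that tame_power tame_Y)
    qed (use prob moments_converge[OF f] in auto)
    moreover have "Y N R l = (\<Sum>n\<in>J. t n * Y N (A n) l)" for N l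
      by (simp add: R_def Y_sum Y_smult)
    ultimately show ?thesis by (simp only: V)
  qed
  have meas_Y: "(\<lambda>\<omega>. Y N (A n) (lam N \<omega>)) \<in> borel_measurable (\<Omega> N)" if "N \<ge> 1" for N n
    using measurable_compose[OF lam_meas[OF that] tame_measurable[OF tame_Y]] .
  have transfer: "(LINT \<omega>|\<Omega> N. h (lam N \<omega>)) = (LINT l|\<mu> N. h l)"
    if "N \<ge> 1" "h \<in> borel_measurable (Pi\<^sub>M {1..N} (\<lambda>_. lborel))" for N and h :: "(nat \<Rightarrow> real) \<Rightarrow> 'z :: {banach, second_countable_topology}"
    unfolding \<mu>_def by (rule integral_distr[OF lam_meas[OF that(1)] that(2), symmetric])
  have "weak_conv_m (\<lambda>N. distr (\<Omega> N) borel (\<lambda>\<omega>. fluctuation c (P n) N (lam N \<omega>))) (gaussian 0 (sigma2 c n))" for n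
  proof (rule weak_conv_m_of_char)
    have rd: "real_distribution (distr (\<Omega> N) borel (\<lambda>\<omega>. Y N (A n) (lam N \<omega>)))" if "N \<ge> 1" for N
      using prob_space.real_distribution_distr[OF assms(3)[OF that] meas_Y[OF that]] .
    then show "real_distribution (distr (\<Omega> N) borel (\<lambda>\<omega>. fluctuation c (P n) N (lam N \<omega>)))" if "N \<ge> 1" for N
      using that by (simp add: fluct)
    show "real_distribution (gaussian 0 (sigma2 c n))"
      using prob_space_gaussian[OF sigma_pos[of n]] by (simp add: real_distribution_def real_distribution_axioms_def)
    fix t
    have ch: "char (distr (\<Omega> N) borel (\<lambda>\<omega>. fluctuation c (P n) N (lam N \<omega>))) t = (LINT l|\<mu> N. iexp (\<Sum>m\<in>{n}. t * Y N (A m) l))" if N: "N \<ge> 1" for N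
    proof -
      have "char (distr (\<Omega> N) borel (\<lambda>\<omega>. fluctuation c (P n) N (lam N \<omega>))) t = (LINT \<omega>|\<Omega> N. iexp (t * Y N (A n) (lam N \<omega>)))"
        unfolding char_def fluct[OF N] by (rule integral_distr[OF meas_Y[OF N]]) measurable
      also have "\<dots> = (LINT l|\<mu> N. iexp (t * Y N (A n) l))"
        by (rule transfer[OF N, of "\<lambda>l. iexp (t * Y N (A n) l)"]) (use tame_measurable[OF tame_Y] in measurable)
      finally show ?thesis by simp
    qed
    have "\<forall>\<^sub>F N in sequentially. (LINT l|\<mu> N. iexp (\<Sum>m\<in>{n}. t * Y N (A m) l)) = char (distr (\<Omega> N) borel (\<lambda>\<omega>. fluctuation c (P n) N (lam N \<omega>))) t"
      by (intro eventually_sequentiallyI[of 1] ch[symmetric])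
    moreover have "char (gaussian 0 (sigma2 c n)) t = complex_of_real (exp (- (\<Sum>m\<in>{n}. t\<^sup>2 * sigma2 c m) / 2))"
      unfolding char_def using char_gaussian[OF sigma_pos[of n], of t] by simp
    ultimately show "(\<lambda>N. char (distr (\<Omega> N) borel (\<lambda>\<omega>. fluctuation c (P n) N (lam N \<omega>))) t) \<longlonglongrightarrow> char (gaussian 0 (sigma2 c n)) t"
      using Lim_transform_eventually[OF char_lim[of "{n}" "\<lambda>_. t"]] by simp
  qed
  moreover have "weak_conv_vec {..M} (\<lambda>N. distr (\<Omega> N) (Pi\<^sub>M {..M} (\<lambda>_. borel)) (\<lambda>\<omega>. \<lambda>n\<in>{..M}. fluctuation c (P n) N (lam N \<omega>)))
     (Pi\<^sub>M {..M} (\<lambda>n. gaussian 0 (sigma2 c n)))" for M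
  proof -
    let ?F = "\<lambda>N \<omega>. \<lambda>n\<in>{..M}. fluctuation c (P n) N (lam N \<omega>)" and ?G = "Pi\<^sub>M {..M} (\<lambda>n. gaussian 0 (sigma2 c n))"
    let ?B = "Pi\<^sub>M {..M} (\<lambda>_. borel :: real measure)"
    interpret G: product_prob_space "\<lambda>n. gaussian 0 (sigma2 c n)" "{..M}"
      using prob_space_gaussian[OF sigma_pos]
      by (auto simp: product_prob_space_def product_prob_space_axioms_def product_sigma_finite_def intro: prob_space_imp_sigma_finite)
    have meas_F: "?F N \<in> measurable (\<Omega> N) ?B" if N: "N \<ge> 1" for N
      unfolding fluct[OF N] using meas_Y[OF N] by (intro measurable_restrict)
    have sq: "bounded_mean (\<lambda>N l. Y N (A n) l ^ 2)" for n
      using robustly_bounded_bounded_mean[OF robustly_bounded_power[OF robustly_bounded_const[of 1], of "A n" 2]] by simp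
    have "\<exists>C. \<forall>N\<ge>1. \<bar>E N (\<lambda>l. Y N (A n) l ^ 2)\<bar> \<le> C" for n using sq[of n] by (simp add: bounded_mean_def)
    then obtain Cn where Cn: "\<And>n N. N \<ge> 1 \<Longrightarrow> \<bar>E N (\<lambda>l. Y N (A n) l ^ 2)\<bar> \<le> Cn n" by metis
    define C where "C = (\<Sum>n\<le>M. \<bar>Cn n\<bar> + \<bar>LINT x|gaussian 0 (sigma2 c n). x\<^sup>2\<bar>)"
    have C: "\<bar>Cn n\<bar> + \<bar>LINT x|gaussian 0 (sigma2 c n). x\<^sup>2\<bar> \<le> C" if "n \<in> {..M}" for n
      unfolding C_def using that by (intro member_le_sum) auto
    have int_F: "(LINT y|distr (\<Omega> N) ?B (?F N). h y) = (LINT l|\<mu> N. h (\<lambda>n\<in>{..M}. Y N (A n) l))"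
      if N: "N \<ge> 1" and h: "h \<in> borel_measurable ?B" for N and h :: "(nat \<Rightarrow> real) \<Rightarrow> 'z :: {banach, second_countable_topology}"
    proof -
      have "(LINT y|distr (\<Omega> N) ?B (?F N). h y) = (LINT \<omega>|\<Omega> N. h (\<lambda>n\<in>{..M}. Y N (A n) (lam N \<omega>)))"
        using integral_distr[OF meas_F[OF N] h] unfolding fluct[OF N] .
      also have "\<dots> = (LINT l|\<mu> N. h (\<lambda>n\<in>{..M}. Y N (A n) l))"
      proof (rule transfer[OF N, of "\<lambda>l. h (\<lambda>n\<in>{..M}. Y N (A n) l)"])
        have "(\<lambda>l. \<lambda>n\<in>{..M}. Y N (A n) l) \<in> measurable (Pi\<^sub>M {1..N} (\<lambda>_. lborel)) ?B"
          by (intro measurable_restrict tame_measurable tame_Y)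
        from measurable_compose[OF this h] show "(\<lambda>l. h (\<lambda>n\<in>{..M}. Y N (A n) l)) \<in> borel_measurable (Pi\<^sub>M {1..N} (\<lambda>_. lborel))" .
      qed
      finally show ?thesis .
    qed
    have sq_meas: "(\<lambda>y. (y i)\<^sup>2) \<in> borel_measurable ?B" if "i \<in> {..M}" for i :: nat
      using that by measurable
    show ?thesis
    proof (rule weak_conv_vec_of_char[where C = C])
      show "prob_space (distr (\<Omega> N) ?B (?F N))" if "N \<ge> 1" for N
        by (rule prob_space.prob_space_distr[OF assms(3)[OF that] meas_F[OF that]])
      show "prob_space ?G" by (rule G.P.prob_space_axioms)
      show "sets ?G = sets ?B" by (intro sets_PiM_cong) auto
      show "integrable (distr (\<Omega> N) ?B (?F N)) (\<lambda>y. (y i)\<^sup>2)" if N: "N \<ge> 1" and i: "i \<in> {..M}" for N i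
      proof (subst integrable_distr_eq[OF meas_F[OF N] sq_meas[OF i]])
        have "integrable (\<mu> N) (\<lambda>l. (Y N (A i) l)\<^sup>2)" by (intro integrable_E N tame_power tame_Y)
        then have "integrable (\<Omega> N) (\<lambda>\<omega>. (Y N (A i) (lam N \<omega>))\<^sup>2)"
          unfolding \<mu>_def by (subst (asm) integrable_distr_eq[OF lam_meas[OF N] tame_measurable[OF tame_power[OF tame_Y]]])
        then show "integrable (\<Omega> N) (\<lambda>\<omega>. (?F N \<omega> i)\<^sup>2)" using i by (simp add: fluct[OF N])
      qed
      show "(LINT y|distr (\<Omega> N) ?B (?F N). (y i)\<^sup>2) \<le> C" if N: "N \<ge> 1" and i: "i \<in> {..M}" for N i
      proof -
        have "(LINT y|distr (\<Omega> N) ?B (?F N). (y i)\<^sup>2) = E N (\<lambda>l. (Y N (A i) l)\<^sup>2)"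
          using i by (subst int_F[OF N sq_meas[OF i]]) simp
        then show ?thesis using Cn[OF N, of i] C[OF i] by linarith
      qed
      have distG: "distr ?G (gaussian 0 (sigma2 c i)) (\<lambda>y. y i) = gaussian 0 (sigma2 c i)" if "i \<in> {..M}" for i
        using that by (rule G.PiM_component)
      have mG: "(\<lambda>y. y i) \<in> measurable ?G (gaussian 0 (sigma2 c i))" if "i \<in> {..M}" for i
        using that by (rule measurable_component_singleton)
      show "integrable ?G (\<lambda>y. (y i)\<^sup>2)" if i: "i \<in> {..M}" for i
      proof -
        have "integrable (distr ?G (gaussian 0 (sigma2 c i)) (\<lambda>y. y i)) (\<lambda>x. x\<^sup>2)"
          unfolding distG[OF i] by (rule integrable_square_gaussian[OF sigma_pos])
        then show ?thesis by (rule integrable_distr[OF mG[OF i]])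
      qed
      show "(LINT y|?G. (y i)\<^sup>2) \<le> C" if i: "i \<in> {..M}" for i
      proof -
        have "(LINT x|distr ?G (gaussian 0 (sigma2 c i)) (\<lambda>y. y i). x\<^sup>2) = (LINT y|?G. (y i)\<^sup>2)"
          by (rule integral_distr[OF mG[OF i] borel_measurable_integrable[OF integrable_square_gaussian[OF sigma_pos]]])
        then show ?thesis unfolding distG[OF i] using C[OF i] by linarith
      qed
      fix t :: "nat \<Rightarrow> real"
      have "(LINT y|?G. iexp (\<Sum>i\<le>M. t i * y i)) = (LINT y|?G. (\<Prod>i\<le>M. iexp (t i * y i)))"
        by (simp add: exp_sum sum_distrib_left)
      also have "\<dots> = (\<Prod>i\<le>M. (LINT x|gaussian 0 (sigma2 c i). iexp (t i * x)))"
      proof (rule G.product_integral_prod)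
        fix i
        show "integrable (gaussian 0 (sigma2 c i)) (\<lambda>x. iexp (t i * x))"
          by (rule integrable_iexp_gaussian[OF sigma_pos])
      qed simp
      also have "\<dots> = (\<Prod>i\<le>M. complex_of_real (exp (- ((t i)\<^sup>2 * sigma2 c i) / 2)))"
        by (intro prod.cong refl char_gaussian sigma_pos)
      also have "\<dots> = complex_of_real (exp (- (\<Sum>i\<le>M. (t i)\<^sup>2 * sigma2 c i) / 2))"
        by (simp add: exp_sum[symmetric] sum_negf sum_divide_distrib flip: of_real_prod)
      finally have G_char: "(LINT y|?G. iexp (\<Sum>i\<le>M. t i * y i)) = complex_of_real (exp (- (\<Sum>i\<le>M. (t i)\<^sup>2 * sigma2 c i) / 2))" .
      have ch: "(LINT y|distr (\<Omega> N) ?B (?F N). iexp (\<Sum>i\<le>M. t i * y i)) = (LINT l|\<mu> N. iexp (\<Sum>i\<le>M. t i * Y N (A i) l))" if N: "N \<ge> 1" for N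
        using int_F[OF N measurable_iexp_linear[of t]] by simp
      have "\<forall>\<^sub>F N in sequentially. (LINT l|\<mu> N. iexp (\<Sum>i\<le>M. t i * Y N (A i) l)) = (LINT y|distr (\<Omega> N) ?B (?F N). iexp (\<Sum>i\<le>M. t i * y i))"
        by (intro eventually_sequentiallyI[of 1] ch[symmetric])
      then show "(\<lambda>N. LINT y|distr (\<Omega> N) ?B (?F N). iexp (\<Sum>i\<le>M. t i * y i)) \<longlonglongrightarrow> (LINT y|?G. iexp (\<Sum>i\<le>M. t i * y i))"
        unfolding G_char by (rule Lim_transform_eventually[OF char_lim[OF finite_atMost]])
    qed auto
  qed
  ultimately show ?thesis using sigma_prod by blast
qed

end
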